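(* There exists a universal constant $C$ such that for every isotropic unconditional log-concave random vector $X=(X_1,\ldots,X_n)$ in $\mathbb{R}^n$, every $p\geq 2$ and every $a\in\mathbb{R}^n$, $$\Big\|\sum_{i=1}^n a_iX_i\Big\|_p\leq \gamma_p\|a\|_2+ C p^{3/2}\log n\,\|a\|_{\infty}.$$
   Context: For a random variable $Y$ and $p>0$, $\|Y\|_p=(\mathbb{E}|Y|^p)^{1/p}$. $\gamma_p=\|G\|_p$ where $G$ is a standard Gaussian $\mathcal{N}(0,1)$ random variable. For $a\in\mathbb{R}^n$, $\|a\|_2=(\sum_i a_i^2)^{1/2}$ and $\|a\|_\infty=\max_i|a_i|$. A random vector $X$ in $\mathbb{R}^n$ is log-concave if it has a density of the form $e^{-h}$ with $h\colon\mathbb{R}^n\to(-\infty,\infty]$ convex. $X$ is unconditional if $(\eta_1X_1,\ldots,\eta_nX_n)$ has the same distribution as $X$ for every choice of signs $\eta_i\in\{-1,1\}$. $X$ is isotropic if its covariance matrix is the identity.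
   Formalization: Proved for n ≥ 2: for n = 1 one has log n = 0 and the claim fails (Laplace variable of variance 1, p = 4: fourth moment 6 > 3). Random vectors live on one fixed type of sample space, which realizes every law on R^n. *)

theory Defs
  imports "HOL-Probability.Probability"
begin

text \<open>
  Vectors in $n$-space are functions on the index set \<open>{1..n}\<close>, so that a constant can be
  quantified outside of the dimension. A random vector is a family of real random variables
  \<open>X 1, \<dots>, X n\<close>; \<open>joint n X\<close> is the corresponding map into \<open>euclid n\<close>.
\<close>

abbreviation euclid :: "nat \<Rightarrow> (nat \<Rightarrow> real) measure" where
  "euclid n \<equiv> (\<Pi>\<^sub>M i\<in>{1..n}. lborel)"

definition joint :: "nat \<Rightarrow> (nat \<Rightarrow> 'a \<Rightarrow> real) \<Rightarrow> 'a \<Rightarrow> nat \<Rightarrow> real" where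
  "joint n X \<omega> = (\<lambda>i\<in>{1..n}. X i \<omega>)"

text \<open>
  Convexity of a function with values in $(-\infty,\infty]$. The library's \<open>convex_on\<close> does not
  apply: it is for real-valued functions on a real vector space.
\<close>

definition convex_ereal :: "nat \<Rightarrow> ((nat \<Rightarrow> real) \<Rightarrow> ereal) \<Rightarrow> bool" where
  "convex_ereal n h \<longleftrightarrow>
     (\<forall>x\<in>space (euclid n). h x \<noteq> -\<infinity>) \<and>
     (\<forall>x\<in>space (euclid n). \<forall>y\<in>space (euclid n). \<forall>t\<in>{0<..<1}.
        h (\<lambda>i\<in>{1..n}. (1 - t) * x i + t * y i) \<le> ereal (1 - t) * h x + ereal t * h y)"

text \<open>$e^{-u}$ for $u \in (-\infty,\infty]$.\<close>

definition exp_neg :: "ereal \<Rightarrow> ennreal" where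
  "exp_neg u = (if u = \<infinity> then 0 else ennreal (exp (- real_of_ereal u)))"

text \<open>
  The library's \<open>distributed\<close> asks for a Borel density. This is no restriction on the law:
  changing a convex \<open>h\<close> on the boundary of its domain, a null set, makes it
  lower semicontinuous.
\<close>

definition log_concave_vector :: "'a measure \<Rightarrow> nat \<Rightarrow> (nat \<Rightarrow> 'a \<Rightarrow> real) \<Rightarrow> bool" where
  "log_concave_vector M n X \<longleftrightarrow>
     (\<exists>h. convex_ereal n h \<and> distributed M (euclid n) (joint n X) (\<lambda>x. exp_neg (h x)))"

definition unconditional_vector :: "'a measure \<Rightarrow> nat \<Rightarrow> (nat \<Rightarrow> 'a \<Rightarrow> real) \<Rightarrow> bool" where
  "unconditional_vector M n X \<longleftrightarrow>
     joint n X \<in> measurable M (euclid n) \<and>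
     (\<forall>\<eta> :: nat \<Rightarrow> real. (\<forall>i\<in>{1..n}. \<eta> i \<in> {-1, 1}) \<longrightarrow>
        distr M (euclid n) (joint n (\<lambda>i \<omega>. \<eta> i * X i \<omega>)) = distr M (euclid n) (joint n X))"

definition covariance :: "'a measure \<Rightarrow> ('a \<Rightarrow> real) \<Rightarrow> ('a \<Rightarrow> real) \<Rightarrow> real" where
  "covariance M Y Z =
     (\<integral>\<omega>. (Y \<omega> - (\<integral>\<omega>'. Y \<omega>' \<partial>M)) * (Z \<omega> - (\<integral>\<omega>'. Z \<omega>' \<partial>M)) \<partial>M)"

text \<open>
  The Bochner integral of a non-integrable function is 0, but the diagonal condition
  \<open>covariance M (X i) (X i) = 1\<close> already forces every \<open>X i\<close> to be square integrable.
\<close>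

definition isotropic_vector :: "'a measure \<Rightarrow> nat \<Rightarrow> (nat \<Rightarrow> 'a \<Rightarrow> real) \<Rightarrow> bool" where
  "isotropic_vector M n X \<longleftrightarrow>
     (\<forall>i\<in>{1..n}. \<forall>j\<in>{1..n}. covariance M (X i) (X j) = (if i = j then 1 else 0))"

text \<open>Only meaningful when the $p$-th absolute moment is finite, see \<open>has_moment\<close>.\<close>

definition Lp_norm :: "'a measure \<Rightarrow> real \<Rightarrow> ('a \<Rightarrow> real) \<Rightarrow> real" where
  "Lp_norm M p Y = (\<integral>\<omega>. \<bar>Y \<omega>\<bar> powr p \<partial>M) powr (1 / p)"

definition has_moment :: "'a measure \<Rightarrow> real \<Rightarrow> ('a \<Rightarrow> real) \<Rightarrow> bool" where
  "has_moment M p Y \<longleftrightarrow> integrable M (\<lambda>\<omega>. \<bar>Y \<omega>\<bar> powr p)"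

definition gaussian_norm :: "real \<Rightarrow> real" where
  "gaussian_norm p = Lp_norm std_normal_distribution p (\<lambda>x. x)"

definition max_norm :: "nat \<Rightarrow> (nat \<Rightarrow> real) \<Rightarrow> real" where
  "max_norm n a = Max ((\<lambda>i. \<bar>a i\<bar>) ` {1..n})"

text \<open>
  A constant quantified inside a formula cannot be uniform over all types of sample spaces.
  The next lemma shows that the sample space \<open>nat \<Rightarrow> real\<close> suffices: every random vector, on a
  probability space of any type, can be replaced by the coordinate functions under its law,
  without affecting any of the notions above.
\<close>

lemma canonical_realization:
  fixes M :: "'a measure" and X :: "nat \<Rightarrow> 'a \<Rightarrow> real" and a :: "nat \<Rightarrow> real"
  assumes "prob_space M" and X: "log_concave_vector M n X"
    and "unconditional_vector M n X" and "isotropic_vector M n X"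
  defines "N \<equiv> distr M (euclid n) (joint n X)" and "Y \<equiv> (\<lambda>i (\<omega> :: nat \<Rightarrow> real). \<omega> i)"
  shows "prob_space N" "log_concave_vector N n Y"
    "unconditional_vector N n Y" "isotropic_vector N n Y"
    "has_moment N p (\<lambda>\<omega>. \<Sum>i=1..n. a i * Y i \<omega>) \<longleftrightarrow> has_moment M p (\<lambda>\<omega>. \<Sum>i=1..n. a i * X i \<omega>)"
    "Lp_norm N p (\<lambda>\<omega>. \<Sum>i=1..n. a i * Y i \<omega>) = Lp_norm M p (\<lambda>\<omega>. \<Sum>i=1..n. a i * X i \<omega>)"
proof -
  have J: "joint n X \<in> measurable M (euclid n)"
    using X by (auto simp: log_concave_vector_def distributed_def)
  have app: "joint n X \<omega> i = X i \<omega>" if "i \<in> {1..n}" for i \<omega>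
    using that by (simp add: joint_def)
  have Ym: "Y i \<in> borel_measurable (euclid n)" if "i \<in> {1..n}" for i
    using measurable_component_singleton[OF that, of "\<lambda>_. lborel"] by (simp add: Y_def)
  have jm: "joint n (\<lambda>i \<omega>. \<eta> i * Y i \<omega>) \<in> measurable (euclid n) (euclid n)" for \<eta> :: "nat \<Rightarrow> real"
    unfolding joint_def using Ym by (intro measurable_restrict) (auto intro!: borel_measurable_times)
  have comp: "distr N (euclid n) (joint n (\<lambda>i \<omega>. \<eta> i * Y i \<omega>)) =
      distr M (euclid n) (joint n (\<lambda>i \<omega>. \<eta> i * X i \<omega>))" for \<eta>
    unfolding N_def
    by (subst distr_distr[OF jm J]) (intro distr_cong refl, auto simp: joint_def Y_def fun_eq_iff)
  have comp1: "distr N (euclid n) (joint n Y) = N"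
    using comp[of "\<lambda>_. 1"] by (simp add: N_def)
  have int: "(\<integral>\<omega>. g \<omega> \<partial>N) = (\<integral>\<omega>. g (joint n X \<omega>) \<partial>M)" if "g \<in> borel_measurable (euclid n)"
    for g :: "(nat \<Rightarrow> real) \<Rightarrow> real"
    unfolding N_def by (rule integral_distr[OF J that])
  have mean: "(\<integral>\<omega>. Y i \<omega> \<partial>N) = (\<integral>\<omega>. X i \<omega> \<partial>M)" if "i \<in> {1..n}" for i
    using int[OF Ym[OF that]] app[OF that] by (simp add: Y_def)
  have [measurable]: "(\<lambda>\<omega>. \<Sum>i=1..n. a i * Y i \<omega>) \<in> borel_measurable (euclid n)"
    using Ym by (intro borel_measurable_sum borel_measurable_times borel_measurable_const) auto
  have sm: "(\<lambda>\<omega>. \<bar>\<Sum>i=1..n. a i * Y i \<omega>\<bar> powr p) \<in> borel_measurable (euclid n)"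
    by measurable
  have s: "(\<Sum>i=1..n. a i * Y i (joint n X \<omega>)) = (\<Sum>i=1..n. a i * X i \<omega>)" for \<omega>
    by (intro sum.cong) (auto simp: Y_def app)
  show "prob_space N"
    unfolding N_def using assms(1) J by (rule prob_space.prob_space_distr)
  show "log_concave_vector N n Y"
    using X jm[of "\<lambda>_. 1"] comp1
    by (auto simp: log_concave_vector_def distributed_def N_def)
  have "joint n Y \<in> measurable N (euclid n)"
    using jm[of "\<lambda>_. 1"] by (simp add: N_def)
  then show "unconditional_vector N n Y"
    using assms(3) unfolding unconditional_vector_def comp comp1 by (simp only: N_def) blast
  show "isotropic_vector N n Y"
  proof -
    have "covariance N (Y i) (Y j) = covariance M (X i) (X j)"
      if "i \<in> {1..n}" "j \<in> {1..n}" for i j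
      unfolding covariance_def mean[OF that(1)] mean[OF that(2)]
      using Ym[OF that(1)] Ym[OF that(2)] app[OF that(1)] app[OF that(2)]
      by (subst int) (auto simp: Y_def intro!: borel_measurable_times borel_measurable_diff)
    then show ?thesis
      using assms(4) by (auto simp: isotropic_vector_def)
  qed
  show "has_moment N p (\<lambda>\<omega>. \<Sum>i=1..n. a i * Y i \<omega>) \<longleftrightarrow> has_moment M p (\<lambda>\<omega>. \<Sum>i=1..n. a i * X i \<omega>)"
    unfolding has_moment_def N_def integrable_distr_eq[OF J sm] s ..
  show "Lp_norm N p (\<lambda>\<omega>. \<Sum>i=1..n. a i * Y i \<omega>) = Lp_norm M p (\<lambda>\<omega>. \<Sum>i=1..n. a i * X i \<omega>)"
    unfolding Lp_norm_def int[OF sm] s ..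
qed

end

theory Submission
  imports Defs
begin

text \<open>
  The law of \<open>X\<close> does not change when coordinates change sign, so the sum of the \<open>a i * X i\<close> has the law
  of the sum of the \<open>\<epsilon> i * a i * X i\<close> with independent signs \<open>\<epsilon> i\<close>. Given \<open>X\<close>, Khinchine's
  inequality with the Gaussian constant bounds its \<open>p\<close>-norm by \<open>gaussian_norm p\<close> times the Euclidean norm
  \<open>N\<close> of the vector of the \<open>a i * X i\<close>, up to a multiple of their maximum
  (\<open>khinchine_gaussian_constant\<close>). Since \<open>gaussian_norm p\<close> is of order \<open>sqrt p\<close> and the second moment of
  \<open>N\<close> is \<open>A^2\<close> with \<open>A = L2_set a {1..n}\<close>, the theorem follows once the \<open>p\<close>-norm of the positive part of
  \<open>N - A\<close> is at most a multiple of \<open>p * ln n\<close> times the maximum of the \<open>\<bar>a i\<bar>\<close>.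
  
  Such an estimate is a consequence of a spectral gap of order \<open>1 / (ln n)^2\<close>. Here a weaker form of it,
  for the functional \<open>N\<close> only, is derived from the Prekopa-Leindler inequality. Let all
  \<open>\<bar>a i\<bar> \<le> 1\<close>, put \<open>s = 4 * ln n\<close> and cut every \<open>\<bar>X i\<bar>\<close> at \<open>s\<close>.
  
  \<^item> The excess over \<open>s\<close>: all \<open>\<bar>X i\<bar>\<close> exceed thresholds \<open>\<alpha> i\<close> simultaneously with probability at most
  \<open>exp (- (\<Sum>i. \<alpha> i) / 4)\<close>, as if they were independent exponential variables
  (\<open>exceeds_le_exp\<close>). This probability is a log-concave function of \<open>\<alpha>\<close>, so it suffices to know how it
  decays near \<open>\<alpha> = 0\<close>, and there the coordinates act additively. Hence the sum of all excesses
  over \<open>s\<close> has a bounded exponential moment (\<open>exp_total_excess\<close>).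
  \<^item> The truncated norm: the density at \<open>x\<close> decreases in every \<open>\<bar>x i\<bar>\<close>, so in the Prekopa-Leindler inequality
  the mean of \<open>x\<close> and \<open>y\<close> may be replaced by the smaller mean that is the midpoint in the coordinates
  \<open>sqrt \<bar>x i\<bar>\<close>. The Jacobian of these coordinates is strictly log-concave, and the gain pays for the
  oscillation of the truncated norm. This makes its upper deviations from \<open>A\<close> sub-Gaussian on the scale \<open>s\<close>
  (\<open>exp_moment_trunc_norm\<close>), so that their \<open>p\<close>-norm is of order \<open>sqrt p * ln n\<close>.
  
  Khinchine's inequality itself is proved for \<open>p \<ge> 3\<close> by exchanging signs for Gaussian variables one at a
  time, and for \<open>2 < p < 3\<close> by Fourier analysis, where the additional maximum appears; for \<open>p = 2\<close> both sides
  are the variance.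
\<close>

section \<open>Derivatives of powers of the absolute value\<close>

lemma sgn_powr_has_derivative_at_0:
  fixes p :: real
  assumes "1 < p"
  shows "((\<lambda>x. \<bar>x\<bar> powr p) has_real_derivative 0) (at 0)"
    and "((\<lambda>x. sgn x * \<bar>x\<bar> powr p) has_real_derivative 0) (at 0)"
proof -
  have lim: "((\<lambda>x::real. \<bar>x\<bar> powr (p - 1)) \<longlongrightarrow> 0) (at 0)"
  proof -
    have "((\<lambda>x::real. \<bar>x\<bar> powr (p - 1)) \<longlongrightarrow> \<bar>0\<bar> powr (p - 1)) (at 0)"
      using assms by (intro tendsto_powr' tendsto_intros) auto
    then show ?thesis by simp
  qed
  have eq: "\<bar>x\<bar> powr p / \<bar>x\<bar> = \<bar>x\<bar> powr (p - 1)" if "x \<noteq> 0" for x :: real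
    using that by (simp add: powr_diff)
  have 1: "((\<lambda>x. (\<bar>x\<bar> powr p) / x) \<longlongrightarrow> 0) (at 0)"
  proof (rule Lim_null_comparison[OF _ lim])
    show "\<forall>\<^sub>F x in at 0. norm ((\<bar>x\<bar> powr p) / x) \<le> \<bar>x\<bar> powr (p - 1)"
      using eq by (auto simp: eventually_at_filter)
  qed
  have 2: "((\<lambda>x. (sgn x * \<bar>x\<bar> powr p) / x) \<longlongrightarrow> 0) (at 0)"
  proof (rule Lim_null_comparison[OF _ lim])
    show "\<forall>\<^sub>F x in at 0. norm ((sgn x * \<bar>x\<bar> powr p) / x) \<le> \<bar>x\<bar> powr (p - 1)"
      using eq by (auto simp: eventually_at_filter abs_mult abs_sgn_eq)
  qed
  show "((\<lambda>x. \<bar>x\<bar> powr p) has_real_derivative 0) (at 0)"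
    "((\<lambda>x. sgn x * \<bar>x\<bar> powr p) has_real_derivative 0) (at 0)"
    using 1 2 assms by (simp_all add: DERIV_def)
qed

lemma DERIV_abs_powr:
  fixes p x :: real
  assumes "1 < p"
  shows "((\<lambda>x. \<bar>x\<bar> powr p) has_real_derivative p * (sgn x * \<bar>x\<bar> powr (p - 1))) (at x)"
    and "((\<lambda>x. sgn x * \<bar>x\<bar> powr p) has_real_derivative p * \<bar>x\<bar> powr (p - 1)) (at x)"
proof -
  consider "x = 0" | "x \<noteq> 0" by blast
  then have "((\<lambda>x. \<bar>x\<bar> powr p) has_real_derivative p * (sgn x * \<bar>x\<bar> powr (p - 1))) (at x) \<and>
    ((\<lambda>x. sgn x * \<bar>x\<bar> powr p) has_real_derivative p * \<bar>x\<bar> powr (p - 1)) (at x)"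
  proof cases
    case 1
    then show ?thesis using sgn_powr_has_derivative_at_0[OF assms] assms by simp
  next
    case 2
    define e where "e = sgn x"
    have e: "e * e = 1" "\<bar>x\<bar> = e * x" "0 < e * x" using 2 by (auto simp: e_def sgn_if)
    have d: "((\<lambda>y. (e * y) powr p) has_real_derivative p * (e * \<bar>x\<bar> powr (p - 1))) (at x)"
      using e by (auto intro!: derivative_eq_intros simp: powr_diff)
    have S: "open {y. 0 < e * y}" "x \<in> {y. 0 < e * y}"
      using e by (auto intro!: open_Collect_less continuous_intros)
    have loc: "\<bar>y\<bar> = e * y" "sgn y = e" if "0 < e * y" for y
      using that 2 by (auto simp: e_def sgn_if split: if_splits)
    have "((\<lambda>x. \<bar>x\<bar> powr p) has_real_derivative p * (e * \<bar>x\<bar> powr (p - 1))) (at x)"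
      by (rule has_field_derivative_transform_within_open[OF d S]) (simp add: loc)
    moreover have "((\<lambda>x. sgn x * \<bar>x\<bar> powr p) has_real_derivative e * (p * (e * \<bar>x\<bar> powr (p - 1)))) (at x)"
      by (rule has_field_derivative_transform_within_open[OF DERIV_cmult[OF d] S]) (simp add: loc)
    ultimately show ?thesis
      using e by (simp add: e_def[symmetric] mult.left_commute mult.assoc[symmetric])
  qed
  then show "((\<lambda>x. \<bar>x\<bar> powr p) has_real_derivative p * (sgn x * \<bar>x\<bar> powr (p - 1))) (at x)"
    "((\<lambda>x. sgn x * \<bar>x\<bar> powr p) has_real_derivative p * \<bar>x\<bar> powr (p - 1)) (at x)" by auto
qed

section \<open>The Prekopa-Leindler inequality on the line\<close>

text \<open>
  The proof of the Brunn-Minkowski inequality below needs a last point of \<open>A\<close>, which need not exist. It is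
  therefore carried out for the part of \<open>A\<close> up to one of its points, and this lemma is the passage to the limit.
\<close>

lemma emeasure_le_via_initial_segments:
  fixes A :: "real set" and d D :: ennreal
  assumes [measurable]: "A \<in> sets borel" and "A \<noteq> {}"
    and le: "\<And>a. a \<in> A \<Longrightarrow> emeasure lborel (A \<inter> {..a}) + d \<le> D"
  shows "emeasure lborel A + d \<le> D"
proof -
  \<comment> \<open>The cut points exhaust \<open>A\<close> up to the null set \<open>{s}\<close>, where \<open>s\<close> is the supremum of \<open>A\<close> if there is one.\<close>
  obtain u :: "nat \<Rightarrow> real" and s where u: "incseq u" "\<And>n. \<exists>a\<in>A. u n \<le> a"
    and cover: "A \<subseteq> insert s (\<Union>n. {..u n})"
  proof (cases "bdd_above A")
    case True
    let ?u = "\<lambda>n. Sup A - 1 / real (Suc n)"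
    have "\<exists>a\<in>A. ?u n \<le> a" for n
      using less_cSup_iff[OF \<open>A \<noteq> {}\<close> True, of "?u n"] by (auto intro: less_imp_le)
    moreover have "incseq ?u"
      by (auto simp: incseq_def field_simps)
    moreover have "A \<subseteq> insert (Sup A) (\<Union>n. {..?u n})"
    proof
      fix x assume x: "x \<in> A"
      show "x \<in> insert (Sup A) (\<Union>n. {..?u n})"
      proof (cases "x = Sup A")
        case False
        then have "0 < Sup A - x" using cSup_upper[OF x True] by simp
        then obtain n where "1 / real (Suc n) < Sup A - x" using nat_approx_posE by blast
        then have "x \<le> ?u n" by simp
        then show ?thesis by blast
      qed simp
    qed
    ultimately show ?thesis using that by blast
  next
    case False
    have "\<exists>a\<in>A. real n \<le> a" for n
      using False unfolding bdd_above_def by (meson linear)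
    moreover have "A \<subseteq> insert 0 (\<Union>n. {..real n})"
      using real_arch_simple by auto
    ultimately show ?thesis using that[of real 0] by (auto simp: incseq_def)
  qed
  have "emeasure lborel A \<le> emeasure lborel ({s} \<union> (\<Union>n. A \<inter> {..u n}))"
    using cover by (intro emeasure_mono) auto
  also have "\<dots> \<le> emeasure lborel {s} + emeasure lborel (\<Union>n. A \<inter> {..u n})"
    by (rule emeasure_subadditive) auto
  also have "\<dots> = (SUP n. emeasure lborel (A \<inter> {..u n}))"
    using u(1) by (subst SUP_emeasure_incseq) (auto simp: incseq_def intro: order_trans)
  finally have "emeasure lborel A + d \<le> (SUP n. emeasure lborel (A \<inter> {..u n})) + d"
    by (rule add_right_mono)
  also have "\<dots> = (SUP n. emeasure lborel (A \<inter> {..u n}) + d)"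
    by (simp add: ennreal_SUP_add_left)
  also have "\<dots> \<le> D"
  proof (rule SUP_least)
    fix n obtain a where a: "a \<in> A" "u n \<le> a" using u(2) by blast
    have "emeasure lborel (A \<inter> {..u n}) + d \<le> emeasure lborel (A \<inter> {..a}) + d"
      using a by (intro add_right_mono emeasure_mono) auto
    also have "\<dots> \<le> D" by (rule le[OF a(1)])
    finally show "emeasure lborel (A \<inter> {..u n}) + d \<le> D" .
  qed
  finally show ?thesis .
qed

lemma emeasure_affine_preimage:
  fixes A :: "real set"
  assumes [measurable]: "A \<in> sets borel" and "c \<noteq> 0"
  shows "emeasure lborel A = \<bar>c\<bar> * (\<integral>\<^sup>+x. indicator A (t + c * x) \<partial>lborel)"
  using nn_integral_real_affine[of "indicator A" c t] assms by simp

text \<open>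
  For \<open>a \<in> A\<close> and \<open>b \<in> B\<close> the set \<open>S\<close> contains the midpoints of \<open>b\<close> with all points of \<open>A\<close> up to \<open>a\<close>, and of
  \<open>a\<close> with all points of \<open>B\<close> from \<open>b\<close> on. These are scaled copies of the two pieces, and they
  meet only in the midpoint of \<open>a\<close> and \<open>b\<close>.
\<close>

theorem brunn_minkowski_midpoint:
  fixes A B S :: "real set"
  assumes [measurable]: "A \<in> sets borel" "B \<in> sets borel" "S \<in> sets borel"
    and "A \<noteq> {}" "B \<noteq> {}"
    and sub: "\<And>x y. x \<in> A \<Longrightarrow> y \<in> B \<Longrightarrow> (x + y) / 2 \<in> S"
  shows "emeasure lborel A + emeasure lborel B \<le> 2 * emeasure lborel S"
proof -
  have step: "emeasure lborel (A \<inter> {..a}) + emeasure lborel (B \<inter> {b..}) \<le> 2 * emeasure lborel S"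
    if a: "a \<in> A" and b: "b \<in> B" for a b
  proof -
    have "emeasure lborel (A \<inter> {..a}) + emeasure lborel (B \<inter> {b..}) =
      2 * (\<integral>\<^sup>+x. indicator (A \<inter> {..a}) (-b + 2 * x) \<partial>lborel) +
      2 * (\<integral>\<^sup>+x. indicator (B \<inter> {b..}) (-a + 2 * x) \<partial>lborel)"
      using emeasure_affine_preimage[of "A \<inter> {..a}" 2 "-b"]
        emeasure_affine_preimage[of "B \<inter> {b..}" 2 "-a"] by simp
    also have "\<dots> = 2 * (\<integral>\<^sup>+x. indicator (A \<inter> {..a}) (-b + 2 * x) + indicator (B \<inter> {b..}) (-a + 2 * x) \<partial>lborel)"
      by (subst nn_integral_add) (auto simp: distrib_left)
    also have "\<dots> \<le> 2 * (\<integral>\<^sup>+x. indicator S x + indicator {(a+b)/2} x \<partial>lborel)"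
    proof (intro mult_left_mono nn_integral_mono)
      fix x
      have 1: "x \<in> S" if "-b + 2 * x \<in> A" using sub[OF that b] by simp
      have 2: "x \<in> S" if "-a + 2 * x \<in> B" using sub[OF a that] by simp
      show "(indicator (A \<inter> {..a}) (-b + 2 * x) + indicator (B \<inter> {b..}) (-a + 2 * x) :: ennreal)
        \<le> indicator S x + indicator {(a+b)/2} x"
        using 1 2 by (auto simp: indicator_def)
    qed simp
    also have "\<dots> = 2 * emeasure lborel S"
      by (subst nn_integral_add) auto
    finally show ?thesis .
  qed
  have half: "emeasure lborel A + emeasure lborel (B \<inter> {b..}) \<le> 2 * emeasure lborel S" if "b \<in> B" for b
    using assms that by (intro emeasure_le_via_initial_segments[OF _ \<open>A \<noteq> {}\<close> step]) auto
  let ?B = "uminus -` B"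
  have refl: "emeasure lborel (uminus -` X) = emeasure lborel X" if [measurable]: "X \<in> sets borel" for X :: "real set"
  proof -
    have [measurable]: "uminus -` X \<in> sets borel"
      using measurable_sets[of uminus borel borel X] by simp
    have "emeasure lborel X = (\<integral>\<^sup>+x. indicator X (- x) \<partial>lborel)"
      using emeasure_affine_preimage[of X "-1" 0] by simp
    also have "\<dots> = (\<integral>\<^sup>+x. indicator (uminus -` X) x \<partial>lborel)"
      by (intro nn_integral_cong) (auto simp: indicator_def)
    finally show ?thesis by simp
  qed
  have "emeasure lborel ?B + emeasure lborel A \<le> 2 * emeasure lborel S"
  proof (rule emeasure_le_via_initial_segments)
    show "?B \<in> sets borel" using measurable_sets[of uminus borel borel B] by simp
    show "?B \<noteq> {}" 
    proof -
      obtain b where "b \<in> B" using \<open>B \<noteq> {}\<close> by blast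
      then have "- b \<in> ?B" by simp
      then show ?thesis by blast
    qed
    fix a assume "a \<in> ?B"
    then have "- a \<in> B" by simp
    have "?B \<inter> {..a} = uminus -` (B \<inter> {-a..})" by auto
    then show "emeasure lborel (?B \<inter> {..a}) + emeasure lborel A \<le> 2 * emeasure lborel S"
      using half[OF \<open>-a \<in> B\<close>] refl[of "B \<inter> {-a..}"] by (simp add: add.commute)
  qed
  then show ?thesis using refl[of B] by (simp add: add.commute)
qed

lemma nn_integral_layer_cake:
  fixes f :: "real \<Rightarrow> real"
  assumes [measurable]: "f \<in> borel_measurable borel" and "\<And>x. 0 \<le> f x"
  shows "(integral\<^sup>N lborel f) = (\<integral>\<^sup>+t. indicator {0..} t * emeasure lborel {x. t < f x} \<partial>lborel)"
proof -
  have "(integral\<^sup>N lborel f) = (\<integral>\<^sup>+x. (\<integral>\<^sup>+t. indicator {0..<f x} t \<partial>lborel) \<partial>lborel)"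
    using assms(2) by simp
  also have "\<dots> = (\<integral>\<^sup>+x. (\<integral>\<^sup>+t. indicator {0..} t * indicator {x. t < f x} x \<partial>lborel) \<partial>lborel)"
    by (intro nn_integral_cong) (auto simp: indicator_def)
  also have "\<dots> = (\<integral>\<^sup>+t. (\<integral>\<^sup>+x. indicator {0..} t * indicator {x. t < f x} x \<partial>lborel) \<partial>lborel)"
    by (rule lborel_pair.Fubini') measurable
  also have "\<dots> = (\<integral>\<^sup>+t. indicator {0..} t * emeasure lborel {x. t < f x} \<partial>lborel)"
    by (intro nn_integral_cong) (simp add: nn_integral_cmult)
  finally show ?thesis .
qed

lemma ennreal_am_gm:
  fixes a b :: ennreal
  shows "4 * (a * b) \<le> (a + b)^2"
proof (cases a b rule: ennreal2_cases)
  case (real_real r q)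
  have "4 * (r * q) \<le> (r + q)^2"
    using zero_le_power2[of "r - q"] by (simp add: power2_eq_square algebra_simps)
  then have "ennreal (4 * (r * q)) \<le> ennreal ((r + q)^2)" by (rule ennreal_leI)
  then show ?thesis using real_real
    by (simp add: ennreal_mult ennreal_power flip: ennreal_plus)
qed (auto simp: power2_eq_square ennreal_top_mult ennreal_mult_top)


text \<open>
  Functions with supremum 1 have nonempty level sets for every level below 1, so the Brunn-Minkowski
  inequality applies to all of them. Integration over the level bounds even the arithmetic mean of the two integrals.
\<close>

lemma prekopa_leindler_normalized:
  fixes u v w :: "real \<Rightarrow> real"
  assumes [measurable]: "u \<in> borel_measurable borel" "v \<in> borel_measurable borel" "w \<in> borel_measurable borel"
    and u: "\<And>x. 0 \<le> u x" "\<And>x. u x \<le> 1" "\<And>t. t < 1 \<Longrightarrow> \<exists>x. t < u x"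
    and v: "\<And>x. 0 \<le> v x" "\<And>x. v x \<le> 1" "\<And>t. t < 1 \<Longrightarrow> \<exists>x. t < v x"
    and w: "\<And>x. 0 \<le> w x"
    and le: "\<And>x y. u x * v y \<le> (w ((x + y) / 2))^2"
  shows "(integral\<^sup>N lborel u) * (integral\<^sup>N lborel v) \<le> (integral\<^sup>N lborel w)^2"
proof -
  let ?I = "\<lambda>u. \<integral>\<^sup>+x. ennreal (u x) \<partial>lborel"
  have level: "emeasure lborel {x. t < u x} + emeasure lborel {x. t < v x} \<le> 2 * emeasure lborel {x. t < w x}"
    if "0 \<le> t" for t
  proof (cases "t < 1")
    case True
    show ?thesis
    proof (rule brunn_minkowski_midpoint)
      show "{x. t < u x} \<noteq> {}" "{x. t < v x} \<noteq> {}" using u(3)[OF True] v(3)[OF True] by auto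
      fix x y assume "x \<in> {x. t < u x}" "y \<in> {x. t < v x}"
      then have "t * t < u x * v y" using that by (intro mult_strict_mono') auto
      with le[of x y] have "t^2 < (w ((x + y) / 2))^2" by (simp add: power2_eq_square)
      then show "(x + y) / 2 \<in> {x. t < w x}" using w by (auto intro: power2_less_imp_less)
    qed measurable
  next
    case False
    then have "\<not> t < u x" "\<not> t < v x" for x using u(2)[of x] v(2)[of x] by linarith+
    then have "{x. t < u x} = {}" "{x. t < v x} = {}" by simp_all
    then show ?thesis by simp
  qed
  have "?I u + ?I v = (\<integral>\<^sup>+t. indicator {0..} t * (emeasure lborel {x. t < u x} + emeasure lborel {x. t < v x}) \<partial>lborel)"
    using u(1) v(1) by (simp add: nn_integral_layer_cake nn_integral_add distrib_left)
  also have "\<dots> \<le> (\<integral>\<^sup>+t. 2 * (indicator {0..} t * emeasure lborel {x. t < w x}) \<partial>lborel)"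
    using level by (intro nn_integral_mono) (auto simp: indicator_def)
  also have "\<dots> = 2 * ?I w"
    using w by (simp add: nn_integral_layer_cake nn_integral_cmult)
  finally have sum: "?I u + ?I v \<le> 2 * ?I w" .
  have "4 * (?I u * ?I v) \<le> (?I u + ?I v)^2" by (rule ennreal_am_gm)
  also have "\<dots> \<le> (2 * ?I w)^2" using sum by (intro power_mono) auto
  also have "\<dots> = 4 * (?I w)^2" by (simp add: power_mult_distrib)
  finally show ?thesis by (simp add: ennreal_mult_le_mult_iff)
qed

lemma prekopa_leindler_bounded:
  fixes u v :: "real \<Rightarrow> real" and h :: "real \<Rightarrow> ennreal"
  assumes [measurable]: "u \<in> borel_measurable borel" "v \<in> borel_measurable borel" "h \<in> borel_measurable borel"
    and u: "\<And>x. 0 \<le> u x" "\<And>x. u x \<le> K" and v: "\<And>x. 0 \<le> v x" "\<And>x. v x \<le> K"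
    and le: "\<And>x y. ennreal (u x) * ennreal (v y) \<le> (h ((x + y) / 2))^2"
  shows "(integral\<^sup>N lborel u) * (integral\<^sup>N lborel v) \<le> (integral\<^sup>N lborel h)^2"
proof -
  have *: "(SUP x. r x) = 0 \<Longrightarrow> r x = 0" "r x \<le> (SUP x. r x)" "t < (SUP x. r x) \<Longrightarrow> \<exists>x. t < r x"
    if "\<And>x. 0 \<le> r x" "\<And>x. r x \<le> K" for r :: "real \<Rightarrow> real" and x t
  proof -
    have bdd: "bdd_above (range r)" using that(2) by (auto simp: bdd_above_def)
    show le: "r x \<le> (SUP x. r x)" using bdd by (rule cSUP_upper[rotated]) simp
    show "(SUP x. r x) = 0 \<Longrightarrow> r x = 0" using le that(1)[of x] by simp
    show "t < (SUP x. r x) \<Longrightarrow> \<exists>x. t < r x" using less_cSUP_iff[of UNIV r t] bdd by auto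
  qed
  define a where "a = (SUP x. u x)"
  define b where "b = (SUP x. v x)"
  show ?thesis
  proof (cases "a = 0 \<or> b = 0")
    case True
    then have "(\<forall>x. u x = 0) \<or> (\<forall>x. v x = 0)"
    proof
      assume "a = 0"
      then have "u x = 0" for x unfolding a_def by (rule *(1)[OF u])
      then show ?thesis by blast
    next
      assume "b = 0"
      then have "v x = 0" for x unfolding b_def by (rule *(1)[OF v])
      then show ?thesis by blast
    qed
    then show ?thesis by auto
  next
    case False
    have "0 \<le> a" using order_trans[OF u(1) *(2)[OF u, where x=0]] by (simp add: a_def)
    moreover have "0 \<le> b" using order_trans[OF v(1) *(2)[OF v, where x=0]] by (simp add: b_def)
    ultimately
 have ab: "0 < a" "0 < b" using False by auto
    \<comment> \<open>Dividing \<open>u\<close>, \<open>v\<close> by their suprema divides \<open>h\<close> by the geometric mean \<open>c\<close>, and then values of \<open>h\<close> above 1 can be cut off.\<close>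
    define c where "c = sqrt (a * b)"
    have c: "0 < c" "c^2 = a * b" using ab by (auto simp: c_def)
    define w where "w x = enn2real (min 1 (h x / c))" for x
    have w_le: "ennreal (w x) \<le> h x / c" and w0: "0 \<le> w x" for x
      by (auto simp: w_def min_def not_le less_top intro!: eq_refl ennreal_enn2real dest: less_trans[OF _ ennreal_one_less_top])
    have [measurable]: "w \<in> borel_measurable borel" unfolding w_def by measurable
    have main: "(\<integral>\<^sup>+x. ennreal (u x / a) \<partial>lborel) * (\<integral>\<^sup>+x. ennreal (v x / b) \<partial>lborel) \<le> (\<integral>\<^sup>+x. ennreal (w x) \<partial>lborel)^2"
    proof (rule prekopa_leindler_normalized)
      fix x y
      have u1: "u x / a \<le> 1" "v y / b \<le> 1" using *(2)[OF u, where x=x] *(2)[OF v, where x=y] ab by (simp_all add: a_def b_def)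
      show "u x / a \<le> 1" by fact
      show "v x / b \<le> 1" using *(2)[OF v, where x=x] ab by (simp add: b_def)
      show "(u x / a) * (v y / b) \<le> (w ((x + y) / 2))^2"
      proof (cases "1 \<le> h ((x + y)/2) / c")
        case True
        then have "w ((x + y) / 2) = 1" by (simp add: w_def min_def)
        then show ?thesis using u1 u(1)[of x] v(1)[of y] ab by (simp add: mult_mono)
      next
        case False
        then obtain r where r: "h ((x+y)/2) = ennreal r" "0 \<le> r"
          using c(1) by (cases "h ((x+y)/2)") (auto simp: ennreal_top_divide)
        with False have weq: "w ((x + y)/2) = r / c" using c(1) by (simp add: w_def min_def divide_ennreal)
        have "ennreal (u x * v y) \<le> ennreal (r^2)"
          using le[of x y] r u(1)[of x] v(1)[of y] by (simp add: ennreal_mult ennreal_power)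
        then have "u x * v y \<le> r^2" using r by (simp add: ennreal_le_iff)
        then show ?thesis using ab c by (simp add: weq power_divide divide_right_mono)
      qed
    next
      fix t :: real assume "t < 1"
      then have "t * a < a" "t * b < b" using ab by auto
      then show "\<exists>x. t < u x / a" "\<exists>x. t < v x / b"
        using *(3)[OF u, where t="t*a"] *(3)[OF v, where t="t*b"] ab by (auto simp: a_def[symmetric] b_def[symmetric] pos_less_divide_eq)
    qed (use u v ab w0 in auto)
    have "(integral\<^sup>N lborel u) * (integral\<^sup>N lborel v) =
      (\<integral>\<^sup>+x. ennreal a * ennreal (u x / a) \<partial>lborel) * (\<integral>\<^sup>+x. ennreal b * ennreal (v x / b) \<partial>lborel)"
      using ab by (simp flip: ennreal_mult')
    also have "\<dots> = ennreal (c^2) * ((\<integral>\<^sup>+x. ennreal (u x / a) \<partial>lborel) * (\<integral>\<^sup>+x. ennreal (v x / b) \<partial>lborel))"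
      using ab c by (simp add: nn_integral_cmult ennreal_mult ac_simps)
    also have "\<dots> \<le> ennreal (c^2) * (\<integral>\<^sup>+x. ennreal (w x) \<partial>lborel)^2"
      using main by (intro mult_left_mono) auto
    also have "\<dots> = (\<integral>\<^sup>+x. ennreal c * ennreal (w x) \<partial>lborel)^2"
      using c(1) by (simp add: nn_integral_cmult power_mult_distrib ennreal_power)
    also have "\<dots> \<le> (integral\<^sup>N lborel h)^2"
    proof (intro power_mono nn_integral_mono)
      fix x
      have "ennreal c * ennreal (w x) \<le> ennreal c * (h x / ennreal c)"
        by (intro mult_left_mono w_le) simp
      also have "\<dots> = h x" using c(1) by (subst mult.commute) (simp add: ennreal_divide_times mult_divide_eq_ennreal)
      finally show "ennreal c * ennreal (w x) \<le> h x" .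
    qed simp
    finally show ?thesis .
  qed
qed

theorem prekopa_leindler_midpoint:
  fixes f g h :: "real \<Rightarrow> ennreal"
  assumes [measurable]: "f \<in> borel_measurable borel" "g \<in> borel_measurable borel" "h \<in> borel_measurable borel"
    and le: "\<And>x y. f x * g y \<le> (h ((x + y) / 2))^2"
  shows "(integral\<^sup>N lborel f) * (integral\<^sup>N lborel g) \<le> (integral\<^sup>N lborel h)^2"
proof -
  define T :: "(real \<Rightarrow> ennreal) \<Rightarrow> nat \<Rightarrow> real \<Rightarrow> ennreal" where "T r n x = min (r x) (of_nat n)" for r n x
  have lim: "(SUP n. \<integral>\<^sup>+x. T r n x \<partial>lborel) = (integral\<^sup>N lborel r)"
    if [measurable]: "r \<in> borel_measurable borel" for r
  proof -
    have "(\<integral>\<^sup>+x. (SUP n. T r n x) \<partial>lborel) = (SUP n. \<integral>\<^sup>+x. T r n x \<partial>lborel)"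
    proof (rule nn_integral_monotone_convergence_SUP)
      show "incseq (T r)"
        by (auto simp: T_def incseq_def le_fun_def intro: min.coboundedI2)
    qed (auto simp: T_def)
    moreover have "(SUP n. T r n x) = r x" for x
    proof -
      have "(SUP n. inf (r x) (of_nat n)) = inf (r x) (SUP n. of_nat n)"
        by (rule inf_SUP[symmetric])
      then show ?thesis by (simp add: T_def inf_min ennreal_SUP_of_nat_eq_top)
    qed
    ultimately show ?thesis by simp
  qed
  have fin: "(\<integral>\<^sup>+x. T f n x \<partial>lborel) * (\<integral>\<^sup>+x. T g n' x \<partial>lborel) \<le> (integral\<^sup>N lborel h)^2" for n n'
  proof -
    have real: "ennreal (enn2real (T r m x)) = T r m x" "enn2real (T r m x) \<le> m" for r m x
    proof -
      have "T r m x \<le> ennreal m" by (simp add: T_def ennreal_of_nat_eq_real_of_nat)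
      then show "ennreal (enn2real (T r m x)) = T r m x" "enn2real (T r m x) \<le> m"
        by (auto intro: enn2real_leI simp: ennreal_enn2real_if top_unique)
    qed
    have "(\<integral>\<^sup>+x. enn2real (T f n x) \<partial>lborel) * (\<integral>\<^sup>+x. enn2real (T g n' x) \<partial>lborel) \<le> (integral\<^sup>N lborel h)^2"
    proof (rule prekopa_leindler_bounded[where K="max n n'"])
      show "(\<lambda>x. enn2real (T f n x)) \<in> borel_measurable borel" "(\<lambda>x. enn2real (T g n' x)) \<in> borel_measurable borel"
        unfolding T_def by measurable
      show "enn2real (T f n x) \<le> max n n'" "enn2real (T g n' x) \<le> max n n'" for x
        using real(2)[of f n x] real(2)[of g n' x] by auto
      fix x y
      have "T f n x * T g n' y \<le> f x * g y" by (intro mult_mono) (auto simp: T_def)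
      also note le[of x y]
      finally show "ennreal (enn2real (T f n x)) * ennreal (enn2real (T g n' y)) \<le> (h ((x + y) / 2))^2"
        by (simp add: real)
    qed auto
    then show ?thesis by (simp add: real)
  qed
  have "(integral\<^sup>N lborel f) * (integral\<^sup>N lborel g) =
     (SUP n. SUP n'. (\<integral>\<^sup>+x. T f n x \<partial>lborel) * (\<integral>\<^sup>+x. T g n' x \<partial>lborel))"
    by (simp add: SUP_mult_left_ennreal[symmetric] SUP_mult_right_ennreal[symmetric] lim)
  also have "\<dots> \<le> (integral\<^sup>N lborel h)^2"
    using fin by (intro SUP_least) auto
  finally show ?thesis .
qed

section \<open>Prekopa-Leindler inequalities on product spaces\<close>

text \<open>
  The hypothesis only sees absolute values, so each of the four products \<open>f (\<plusminus>x) * g (\<plusminus>y)\<close> is below the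
  square of the smaller of \<open>h z\<close> and \<open>h (- z)\<close>. Folding all functions to the half-line gives the claim.
\<close>

lemma prekopa_leindler_abs:
  fixes f g h :: "real \<Rightarrow> ennreal"
  assumes [measurable]: "f \<in> borel_measurable borel" "g \<in> borel_measurable borel" "h \<in> borel_measurable borel"
    and le: "\<And>x y z. \<bar>z\<bar> = (\<bar>x\<bar> + \<bar>y\<bar>) / 2 \<Longrightarrow> f x * g y \<le> (h z)^2"
  shows "(integral\<^sup>N lborel f) * (integral\<^sup>N lborel g) \<le> (integral\<^sup>N lborel h)^2"
proof -
  define E :: "(real \<Rightarrow> ennreal) \<Rightarrow> real \<Rightarrow> ennreal"
    where "E r x = (r x + r (- x)) * indicator {0..} x" for r x
  have [measurable]: "E r \<in> borel_measurable borel" if [measurable]: "r \<in> borel_measurable borel" for r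
    unfolding E_def by measurable
  have fold: "(\<integral>\<^sup>+x. E r x \<partial>lborel) = (integral\<^sup>N lborel r)"
    if [measurable]: "r \<in> borel_measurable borel" for r
  proof -
    have "(\<integral>\<^sup>+x. r (- x) * indicator {0..} x \<partial>lborel) = (\<integral>\<^sup>+x. r x * indicator {..0} x \<partial>lborel)"
      by (subst nn_integral_real_affine[where c="-1" and t=0]) (auto intro!: nn_integral_cong simp: indicator_def)
    then have "(\<integral>\<^sup>+x. E r x \<partial>lborel) = (\<integral>\<^sup>+x. r x * indicator {0..} x + r x * indicator {..0} x \<partial>lborel)"
      by (simp add: E_def distrib_right nn_integral_add)
    also have "\<dots> = (integral\<^sup>N lborel r)"
      by (intro nn_integral_cong_AE eventually_mono[OF AE_lborel_singleton[of 0]]) (auto simp: indicator_def)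
    finally show ?thesis .
  qed
  have "(\<integral>\<^sup>+x. E f x \<partial>lborel) * (\<integral>\<^sup>+x. E g x \<partial>lborel) \<le> (\<integral>\<^sup>+x. E h x \<partial>lborel)^2"
  proof (rule prekopa_leindler_midpoint)
    fix x y :: real
    let ?m = "(x + y) / 2"
    show "E f x * E g y \<le> (E h ?m)^2"
    proof (cases "0 \<le> x \<and> 0 \<le> y")
      case True
      let ?q = "min (h ?m) (h (- ?m))"
      have q: "f x' * g y' \<le> ?q^2" if "\<bar>x'\<bar> = x" "\<bar>y'\<bar> = y" for x' y'
        using le[of ?m x' y'] le[of "- ?m" x' y'] that True by (auto simp: min_def)
      have "(f x + f (- x)) * (g y + g (- y)) = (f x * g y + f x * g (- y)) + (f (- x) * g y + f (- x) * g (- y))"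
        by (simp add: distrib_left distrib_right ac_simps)
      also have "\<dots> \<le> (?q^2 + ?q^2) + (?q^2 + ?q^2)"
        using True by (intro add_mono q) auto
      also have "\<dots> = (?q + ?q)^2"
        by (simp add: power2_eq_square distrib_left distrib_right)
      also have "\<dots> \<le> (h ?m + h (- ?m))^2"
        by (intro power_mono add_mono) auto
      finally show ?thesis using True by (simp add: E_def)
    qed (auto simp: E_def)
  qed measurable
  then show ?thesis by (simp add: fold)
qed

lemma nn_integral_signed_square:
  fixes f :: "real \<Rightarrow> ennreal"
  assumes [measurable]: "f \<in> borel_measurable borel"
  shows "(integral\<^sup>N lborel f) = (\<integral>\<^sup>+w. f (w * \<bar>w\<bar>) * ennreal (2 * \<bar>w\<bar>) \<partial>lborel)"
proof -
  have deriv: "((\<lambda>w::real. w * \<bar>w\<bar>) has_real_derivative 2 * \<bar>w\<bar>) (at w)" for w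
  proof -
    have "(\<lambda>w::real. sgn w * \<bar>w\<bar> powr 2) = (\<lambda>w. w * \<bar>w\<bar>)"
      by (auto simp: fun_eq_iff sgn_if power2_eq_square)
    then show ?thesis using DERIV_abs_powr(2)[of 2 w] by simp
  qed
  have cut: "(\<integral>\<^sup>+x. f x * indicator {-(N * N)..N * N} x \<partial>lborel)
      = (\<integral>\<^sup>+w. f (w * \<bar>w\<bar>) * ennreal (2 * \<bar>w\<bar>) * indicator {-N..N} w \<partial>lborel)" if "0 < N" for N :: real
    using nn_integral_substitution_aux[of f "- N" "N" "\<lambda>w. w * \<bar>w\<bar>" "\<lambda>w. 2 * \<bar>w\<bar>"] deriv that
    by (simp add: continuous_intros)
  have exhaust: "(SUP n. \<integral>\<^sup>+x. r x * indicator {- a n..a n} x \<partial>lborel) = (integral\<^sup>N lborel r)"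
    if [measurable]: "r \<in> borel_measurable borel" and a: "incseq a" "\<And>n. real (Suc n) \<le> a n"
    for r :: "real \<Rightarrow> ennreal" and a :: "nat \<Rightarrow> real"
  proof -
    have "(\<integral>\<^sup>+x. (SUP n. r x * indicator {- a n..a n} x) \<partial>lborel) = (SUP n. \<integral>\<^sup>+x. r x * indicator {- a n..a n} x \<partial>lborel)"
    proof (rule nn_integral_monotone_convergence_SUP)
      show "incseq (\<lambda>n x. r x * indicator {- a n..a n} x)"
        using a(1) by (force simp: incseq_def le_fun_def indicator_def)
    qed measurable
    moreover have "(SUP n. r x * indicator {- a n..a n} x) = r x" for x
    proof (rule antisym)
      obtain n where "\<bar>x\<bar> \<le> real n" using real_arch_simple by blast
      then have "x \<in> {- a n..a n}" using a(2)[of n] by auto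
      then have "r x = r x * indicator {- a n..a n} x" by simp
      also have "\<dots> \<le> (SUP n. r x * indicator {- a n..a n} x)" by (rule SUP_upper) simp
      finally show "r x \<le> (SUP n. r x * indicator {- a n..a n} x)" .
    qed (auto intro!: SUP_least simp: indicator_def)
    ultimately show ?thesis by simp
  qed
  have "(integral\<^sup>N lborel f) = (SUP n. \<integral>\<^sup>+x. f x * indicator {-(real (Suc n) * real (Suc n))..real (Suc n) * real (Suc n)} x \<partial>lborel)"
    by (rule exhaust[symmetric]) (auto simp: incseq_def intro!: mult_mono)
  also have "\<dots> = (SUP n. \<integral>\<^sup>+w. f (w * \<bar>w\<bar>) * ennreal (2 * \<bar>w\<bar>) * indicator {-real (Suc n)..real (Suc n)} w \<partial>lborel)"
    by (intro SUP_cong refl cut) simp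
  also have "\<dots> = (\<integral>\<^sup>+w. f (w * \<bar>w\<bar>) * ennreal (2 * \<bar>w\<bar>) \<partial>lborel)"
    by (rule exhaust) (auto simp: incseq_def)
  finally show ?thesis .
qed

text \<open>
  The squared quotient of the arithmetic and the geometric mean of \<open>sqrt \<bar>x\<bar>\<close> and \<open>sqrt \<bar>y\<bar>\<close>.
\<close>

definition sqrt_gain :: "real \<Rightarrow> real \<Rightarrow> real" where
  "sqrt_gain x y = (sqrt \<bar>x\<bar> + sqrt \<bar>y\<bar>)^2 / (4 * sqrt \<bar>x\<bar> * sqrt \<bar>y\<bar>)"

text \<open>
  Zero is excluded because the gain is infinite there, whereas \<open>sqrt_gain\<close> would return the value 0 of a
  division by zero; the coordinate axes are null sets.
\<close>

definition sqrt_mean :: "real \<Rightarrow> real \<Rightarrow> real \<Rightarrow> bool" where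
  "sqrt_mean x y z \<longleftrightarrow> x \<noteq> 0 \<and> y \<noteq> 0 \<and> sqrt \<bar>z\<bar> = (sqrt \<bar>x\<bar> + sqrt \<bar>y\<bar>) / 2"

text \<open>
  In the coordinate \<open>w\<close> with \<open>x = w * \<bar>w\<bar>\<close> Lebesgue measure has the density \<open>2 * \<bar>w\<bar>\<close>. At a midpoint the
  square of this density exceeds the product of its values at the end points exactly by the factor \<open>sqrt_gain\<close>, so
  that the hypothesis may be weakened by that factor. All concentration below comes from this gain.
\<close>

lemma prekopa_leindler_sqrt:
  fixes f g h :: "real \<Rightarrow> ennreal"
  assumes [measurable]: "f \<in> borel_measurable borel" "g \<in> borel_measurable borel" "h \<in> borel_measurable borel"
    and le: "\<And>x y z. sqrt_mean x y z \<Longrightarrow> f x * g y \<le> ennreal (sqrt_gain x y) * (h z)^2"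
  shows "(integral\<^sup>N lborel f) * (integral\<^sup>N lborel g) \<le> (integral\<^sup>N lborel h)^2"
proof -
  let ?S = "\<lambda>r w. r (w * \<bar>w\<bar>) * ennreal (2 * \<bar>w\<bar>)"
  have "(\<integral>\<^sup>+w. ?S f w \<partial>lborel) * (\<integral>\<^sup>+w. ?S g w \<partial>lborel) \<le> (\<integral>\<^sup>+w. ?S h w \<partial>lborel)^2"
  proof (rule prekopa_leindler_abs)
    fix u v w :: real assume w: "\<bar>w\<bar> = (\<bar>u\<bar> + \<bar>v\<bar>) / 2"
    show "?S f u * ?S g v \<le> (?S h w)^2"
    proof (cases "u = 0 \<or> v = 0")
      case False
      have root: "sqrt \<bar>t * \<bar>t\<bar>\<bar> = \<bar>t\<bar>" for t :: real
        by (simp add: abs_mult flip: power2_eq_square)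
      let ?k = "sqrt_gain (u * \<bar>u\<bar>) (v * \<bar>v\<bar>)"
      have k: "?k = (\<bar>u\<bar> + \<bar>v\<bar>)^2 / (4 * \<bar>u\<bar> * \<bar>v\<bar>)" by (simp add: sqrt_gain_def root)
      have k0: "0 \<le> ?k" unfolding k by simp
      have "sqrt_mean (u * \<bar>u\<bar>) (v * \<bar>v\<bar>) (w * \<bar>w\<bar>)"
        using False w by (simp add: sqrt_mean_def root)
      then have main: "f (u * \<bar>u\<bar>) * g (v * \<bar>v\<bar>) \<le> ennreal ?k * (h (w * \<bar>w\<bar>))^2" by (rule le)
      have "?S f u * ?S g v = (f (u * \<bar>u\<bar>) * g (v * \<bar>v\<bar>)) * (ennreal (2 * \<bar>u\<bar>) * ennreal (2 * \<bar>v\<bar>))"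
        by (simp only: ac_simps)
      also have "\<dots> \<le> (ennreal ?k * (h (w * \<bar>w\<bar>))^2) * (ennreal (2 * \<bar>u\<bar>) * ennreal (2 * \<bar>v\<bar>))"
        using main by (rule mult_right_mono) simp
      also have "\<dots> = ennreal (?k * (2 * \<bar>u\<bar>) * (2 * \<bar>v\<bar>)) * (h (w * \<bar>w\<bar>))^2"
        using k0 by (simp only: ennreal_mult mult_nonneg_nonneg abs_ge_zero zero_le_numeral ac_simps)
      also have "?k * (2 * \<bar>u\<bar>) * (2 * \<bar>v\<bar>) = (2 * \<bar>w\<bar>)^2"
      proof -
        have "(a + b)^2 / (4 * a * b) * (2 * a) * (2 * b) = (a + b)^2" if "a \<noteq> 0" "b \<noteq> 0" for a b :: real
          using that by simp
        then have "?k * (2 * \<bar>u\<bar>) * (2 * \<bar>v\<bar>) = (\<bar>u\<bar> + \<bar>v\<bar>)^2" unfolding k using False by simp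
        then show ?thesis by (simp add: w)
      qed
      also have "ennreal ((2 * \<bar>w\<bar>)^2) * (h (w * \<bar>w\<bar>))^2 = (?S h w)^2"
        by (simp add: power_mult_distrib ennreal_power mult.commute)
      finally show ?thesis .
    qed auto
  qed measurable
  then show ?thesis by (simp only: nn_integral_signed_square[OF assms(1)] nn_integral_signed_square[OF assms(2)] nn_integral_signed_square[OF assms(3)])
qed

interpretation lborel_product: product_sigma_finite "\<lambda>_. lborel :: real measure"
  by standard

abbreviation Leb :: "'i set \<Rightarrow> ('i \<Rightarrow> real) measure" where
  "Leb I \<equiv> \<Pi>\<^sub>M i\<in>I. lborel"

text \<open>
  Induction on the dimension, as for the classical inequality. The mean is an arbitrary relation \<open>R\<close>
  with a weight \<open>k\<close>, so that the arithmetic mean and the mean in square root coordinates are treated at once.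
\<close>

theorem prekopa_leindler_tensor:
  fixes R :: "real \<Rightarrow> real \<Rightarrow> real \<Rightarrow> bool" and k :: "real \<Rightarrow> real \<Rightarrow> real"
    and F G H :: "('i \<Rightarrow> real) \<Rightarrow> ennreal"
  assumes one_dim: "\<And>f g h :: real \<Rightarrow> ennreal.
      f \<in> borel_measurable borel \<Longrightarrow> g \<in> borel_measurable borel \<Longrightarrow> h \<in> borel_measurable borel \<Longrightarrow>
      (\<And>x y z. R x y z \<Longrightarrow> f x * g y \<le> ennreal (k x y) * (h z)^2) \<Longrightarrow>
      (integral\<^sup>N lborel f) * (integral\<^sup>N lborel g) \<le> (integral\<^sup>N lborel h)^2"
    and k: "\<And>x y z. R x y z \<Longrightarrow> 0 \<le> k x y"
    and "finite I"
    and meas: "F \<in> borel_measurable (Leb I)" "G \<in> borel_measurable (Leb I)" "H \<in> borel_measurable (Leb I)"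
    and le: "\<And>x y z. \<lbrakk>x \<in> space (Leb I); y \<in> space (Leb I); z \<in> space (Leb I); \<And>i. i \<in> I \<Longrightarrow> R (x i) (y i) (z i)\<rbrakk>
      \<Longrightarrow> F x * G y \<le> ennreal (\<Prod>i\<in>I. k (x i) (y i)) * (H z)^2"
  shows "(integral\<^sup>N (Leb I) F) * (integral\<^sup>N (Leb I) G) \<le> (integral\<^sup>N (Leb I) H)^2"
  using \<open>finite I\<close> meas le
proof (induction I arbitrary: F G H rule: finite_induct)
  case empty
  then show ?case
    using empty.prems(4)[of "\<lambda>_. undefined" "\<lambda>_. undefined" "\<lambda>_. undefined"]
    by (simp add: lborel_product.nn_integral_empty space_PiM)
next
  case (insert i I)
  note [measurable] = insert.prems(1-3)
  have upd: "x(i := t) \<in> space (Leb (insert i I))" if "x \<in> space (Leb I)" for x :: "'i \<Rightarrow> real" and t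
    using that by (auto simp: space_PiM PiE_def extensional_def)
  have [measurable]: "(\<lambda>y. \<integral>\<^sup>+x. r (x(i := y)) \<partial>Leb I) \<in> borel_measurable borel"
      "\<And>t. (\<lambda>x. r (x(i := t))) \<in> borel_measurable (Leb I)"
    if [measurable]: "r \<in> borel_measurable (Leb (insert i I))" for r :: "('i \<Rightarrow> real) \<Rightarrow> ennreal"
  proof -
    interpret I: sigma_finite_measure "Leb I"
      using insert.hyps(1) by (rule lborel_product.sigma_finite)
    have "(\<lambda>y. \<integral>\<^sup>+x. r (x(i := y)) \<partial>Leb I) \<in> borel_measurable lborel"
      by measurable
    then show "(\<lambda>y. \<integral>\<^sup>+x. r (x(i := y)) \<partial>Leb I) \<in> borel_measurable borel" by simp
    show "(\<lambda>x. r (x(i := t))) \<in> borel_measurable (Leb I)" for t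
      by measurable
  qed
  have "(\<integral>\<^sup>+y. (\<integral>\<^sup>+x. F (x(i := y)) \<partial>Leb I) \<partial>lborel) * (\<integral>\<^sup>+y. (\<integral>\<^sup>+x. G (x(i := y)) \<partial>Leb I) \<partial>lborel)
      \<le> (\<integral>\<^sup>+y. (\<integral>\<^sup>+x. H (x(i := y)) \<partial>Leb I) \<partial>lborel)^2"
  proof (rule one_dim)
    fix s t u assume R: "R s t u"
    \<comment> \<open>The weight of the new coordinate is absorbed into \<open>H\<close>, which enters quadratically.\<close>
    let ?c = "ennreal (sqrt (k s t))"
    have c2: "?c^2 = ennreal (k s t)" using k[OF R] by (simp add: ennreal_power)
    have "(\<integral>\<^sup>+x. F (x(i := s)) \<partial>Leb I) * (\<integral>\<^sup>+x. G (x(i := t)) \<partial>Leb I) \<le> (\<integral>\<^sup>+x. ?c * H (x(i := u)) \<partial>Leb I)^2"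
    proof (rule insert.IH)
      fix x y z assume xyz: "x \<in> space (Leb I)" "y \<in> space (Leb I)" "z \<in> space (Leb I)"
        and R': "\<And>j. j \<in> I \<Longrightarrow> R (x j) (y j) (z j)"
      have "F (x(i := s)) * G (y(i := t)) \<le>
          ennreal (\<Prod>j\<in>insert i I. k ((x(i := s)) j) ((y(i := t)) j)) * (H (z(i := u)))^2"
        by (rule insert.prems(4)[OF upd upd upd]) (use xyz R R' in auto)
      also have "(\<Prod>j\<in>insert i I. k ((x(i := s)) j) ((y(i := t)) j)) = k s t * (\<Prod>j\<in>I. k (x j) (y j))"
        using insert.hyps by (subst prod.insert) (auto intro!: prod.cong)
      also have "ennreal (k s t * (\<Prod>j\<in>I. k (x j) (y j))) * (H (z(i := u)))^2 =
          ennreal (\<Prod>j\<in>I. k (x j) (y j)) * (?c * H (z(i := u)))^2"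
        using k[OF R] k[OF R'] by (simp add: ennreal_mult prod_nonneg power_mult_distrib c2 ac_simps)
      finally show "F (x(i := s)) * G (y(i := t)) \<le>
          ennreal (\<Prod>j\<in>I. k (x j) (y j)) * (?c * H (z(i := u)))^2" .
    qed measurable
    also have "\<dots> = ennreal (k s t) * (\<integral>\<^sup>+x. H (x(i := u)) \<partial>Leb I)^2"
      by (simp add: nn_integral_cmult power_mult_distrib c2)
    finally show "(\<integral>\<^sup>+x. F (x(i := s)) \<partial>Leb I) * (\<integral>\<^sup>+x. G (x(i := t)) \<partial>Leb I) \<le>
        ennreal (k s t) * (\<integral>\<^sup>+x. H (x(i := u)) \<partial>Leb I)^2" .
  qed measurable
  then show ?case
    by (simp add: lborel_product.product_nn_integral_insert_rev insert.hyps insert.prems(1-3))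
qed

lemma measurable_fun_upd_coordinate:
  assumes "i \<in> I" and [measurable]: "g \<in> borel_measurable (Leb I)"
  shows "(\<lambda>x. x(i := g x)) \<in> measurable (Leb I) (Leb I)"
proof -
  have "(\<lambda>x. x(i := g x)) \<in> measurable (Leb I) (Leb (insert i I))"
    by measurable
  then show ?thesis using assms(1) by (simp add: insert_absorb)
qed

lemma nn_integral_scale_coordinate:
  fixes F :: "('i \<Rightarrow> real) \<Rightarrow> ennreal"
  assumes "finite I" "i \<in> I" and F[measurable]: "F \<in> borel_measurable (Leb I)" and "c \<noteq> 0"
  shows "(integral\<^sup>N (Leb I) F) = ennreal \<bar>c\<bar> * (\<integral>\<^sup>+x. F (x(i := c * x i)) \<partial>Leb I)"
proof -
  obtain J where I: "I = insert i J" "finite J" "i \<notin> J"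
    using assms by (metis finite_insert mk_disjoint_insert)
  have [measurable]: "F \<in> borel_measurable (Leb (insert i J))" using F by (simp add: I)
  have "(\<integral>\<^sup>+x. F x \<partial>Leb (insert i J)) = (\<integral>\<^sup>+x. (\<integral>\<^sup>+y. F (x(i := y)) \<partial>lborel) \<partial>Leb J)"
    using I by (intro lborel_product.product_nn_integral_insert) auto
  also have "\<dots> = (\<integral>\<^sup>+x. ennreal \<bar>c\<bar> * (\<integral>\<^sup>+y. F (x(i := c * y)) \<partial>lborel) \<partial>Leb J)"
  proof (rule nn_integral_cong)
    fix x assume [measurable]: "x \<in> space (Leb J)"
    have "(\<lambda>y. F (x(i := y))) \<in> borel_measurable borel" by measurable
    from nn_integral_real_affine[OF this \<open>c \<noteq> 0\<close>, of 0]
    show "(\<integral>\<^sup>+y. F (x(i := y)) \<partial>lborel) = ennreal \<bar>c\<bar> * (\<integral>\<^sup>+y. F (x(i := c * y)) \<partial>lborel)" by simp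
  qed
  also have "\<dots> = ennreal \<bar>c\<bar> * (\<integral>\<^sup>+x. (\<integral>\<^sup>+y. F (x(i := c * y)) \<partial>lborel) \<partial>Leb J)"
    by (intro nn_integral_cmult) measurable
  also have "(\<integral>\<^sup>+x. (\<integral>\<^sup>+y. F (x(i := c * y)) \<partial>lborel) \<partial>Leb J) = (\<integral>\<^sup>+x. F (x(i := c * x i)) \<partial>Leb (insert i J))"
  proof -
    have "(\<lambda>x. x(i := c * x i)) \<in> measurable (Leb (insert i J)) (Leb (insert i J))"
      by (rule measurable_fun_upd_coordinate) auto
    then have "(\<lambda>x. F (x(i := c * x i))) \<in> borel_measurable (Leb (insert i J))" by measurable
    then show ?thesis
      using I(2,3) by (subst lborel_product.product_nn_integral_insert) auto
  qed
  finally show ?thesis by (simp add: I)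
qed

section \<open>Joint tails of unconditional log-concave vectors\<close>

text \<open>
  The single inequality \<open>density_midpoint\<close> contains all the geometry: with \<open>x = y\<close> it says that the density is
  even and decreasing in the modulus of every coordinate, and together with this it is log-concavity at midpoints.
\<close>

locale unconditional_log_concave =
  fixes I :: "nat set" and \<rho> :: "(nat \<Rightarrow> real) \<Rightarrow> ennreal"
  assumes finite_I [simp, intro]: "finite I"
    and density_measurable [measurable]: "\<rho> \<in> borel_measurable (Leb I)"
    and total_mass: "(integral\<^sup>N (Leb I) \<rho>) = 1"
    and variance_le_1: "\<And>i. i \<in> I \<Longrightarrow> (\<integral>\<^sup>+x. \<rho> x * ennreal ((x i)^2) \<partial>Leb I) \<le> 1"
    and density_midpoint: "\<And>x y z. \<lbrakk>x \<in> space (Leb I); y \<in> space (Leb I); z \<in> space (Leb I);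
      \<And>i. i \<in> I \<Longrightarrow> \<bar>z i\<bar> \<le> (\<bar>x i\<bar> + \<bar>y i\<bar>) / 2\<rbrakk> \<Longrightarrow> \<rho> x * \<rho> y \<le> (\<rho> z)^2"
begin

definition law :: "(nat \<Rightarrow> real) measure" where "law = density (Leb I) \<rho>"

lemma sets_law [measurable_cong, simp]: "sets law = sets (Leb I)"
  and space_law [simp]: "space law = space (Leb I)"
  by (simp_all add: law_def)

lemma prob_space_law: "prob_space law"
  by (rule prob_spaceI) (simp add: law_def emeasure_density total_mass cong: nn_integral_cong)

sublocale law: prob_space law by (rule prob_space_law)

lemma nn_integral_law:
  "f \<in> borel_measurable (Leb I) \<Longrightarrow> (integral\<^sup>N law f) = (\<integral>\<^sup>+x. \<rho> x * f x \<partial>Leb I)"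
  by (simp add: law_def nn_integral_density)

lemma density_antimono:
  assumes "x \<in> space (Leb I)" "z \<in> space (Leb I)" "\<And>i. i \<in> I \<Longrightarrow> \<bar>z i\<bar> \<le> \<bar>x i\<bar>"
  shows "\<rho> x \<le> \<rho> z"
proof -
  have "\<rho> x * \<rho> x \<le> (\<rho> z)^2" using assms by (intro density_midpoint) auto
  then show ?thesis
    by (cases "\<rho> x" "\<rho> z" rule: ennreal2_cases)
       (auto simp: ennreal_power top_unique ennreal_mult_top simp flip: power2_eq_square
          intro: power2_le_imp_le)
qed

lemma space_Leb_upd: "i \<in> I \<Longrightarrow> x \<in> space (Leb I) \<Longrightarrow> x(i := t) \<in> space (Leb I)"
  by (auto simp: space_PiM PiE_def extensional_def)

lemma measurable_scale [measurable]:
  "i \<in> I \<Longrightarrow> (\<lambda>x. x(i := c * x i)) \<in> measurable (Leb I) (Leb I)"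
  by (rule measurable_fun_upd_coordinate) auto

lemma nn_integral_flip:
  assumes "i \<in> I" and f[measurable]: "f \<in> borel_measurable (Leb I)"
  shows "(\<integral>\<^sup>+x. f (x(i := - x i)) \<partial>law) = (integral\<^sup>N law f)"
proof -
  note [measurable] = measurable_scale[OF assms(1), of "-1", simplified]
  have "(integral\<^sup>N law f) = (\<integral>\<^sup>+x. \<rho> (x(i := - x i)) * f (x(i := - x i)) \<partial>Leb I)"
    using nn_integral_scale_coordinate[OF finite_I assms(1), of "\<lambda>x. \<rho> x * f x" "-1"]
    by (simp add: nn_integral_law)
  also have "\<dots> = (\<integral>\<^sup>+x. \<rho> x * f (x(i := - x i)) \<partial>Leb I)"
    using assms(1) space_Leb_upd[OF assms(1)]
    by (intro nn_integral_cong arg_cong2[where f="(*)"] antisym density_antimono) auto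
  finally show ?thesis by (simp add: nn_integral_law)
qed

text \<open>
  Stretching the \<open>i\<close>-th coordinate multiplies volume by \<open>c\<close> and does not increase the density.
\<close>

lemma measure_dilation_le:
  assumes "i \<in> I" "1 \<le> c" and [measurable]: "Measurable.pred (Leb I) B"
    and indep: "\<And>x t. B (x(i := t)) \<longleftrightarrow> B x"
  shows "law.prob {x\<in>space (Leb I). \<bar>x i\<bar> < c * \<tau> \<and> B x} \<le> c * law.prob {x\<in>space (Leb I). \<bar>x i\<bar> < \<tau> \<and> B x}"
proof -
  note [measurable] = measurable_scale[OF assms(1)]
  have [measurable]: "(\<lambda>x. x i) \<in> borel_measurable (Leb I)" using assms(1) by measurable
  let ?A = "\<lambda>\<tau>. {x\<in>space (Leb I). \<bar>x i\<bar> < \<tau> \<and> B x}"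
  have "emeasure law (?A (c * \<tau>)) = (\<integral>\<^sup>+x. \<rho> x * indicator (?A (c * \<tau>)) x \<partial>Leb I)"
    by (simp add: law_def emeasure_density)
  also have "\<dots> = ennreal c * (\<integral>\<^sup>+x. \<rho> (x(i := c * x i)) * indicator (?A (c * \<tau>)) (x(i := c * x i)) \<partial>Leb I)"
    using assms(2) by (subst nn_integral_scale_coordinate[OF finite_I assms(1), where c=c]) auto
  also have "\<dots> \<le> ennreal c * (\<integral>\<^sup>+x. \<rho> x * indicator (?A \<tau>) x \<partial>Leb I)"
  proof (intro mult_left_mono nn_integral_mono mult_mono)
    fix x assume x: "x \<in> space (Leb I)"
    have "\<bar>t\<bar> \<le> \<bar>c * t\<bar>" for t using assms(2) by (simp add: abs_mult mult_le_cancel_right1)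
    then show "\<rho> (x(i := c * x i)) \<le> \<rho> x"
      using x space_Leb_upd[OF assms(1)] by (intro density_antimono) auto
    have "\<bar>c * x i\<bar> < c * \<tau> \<longleftrightarrow> \<bar>x i\<bar> < \<tau>" using assms(2) by (simp add: abs_mult)
    then show "(indicator (?A (c * \<tau>)) (x(i := c * x i)) :: ennreal) \<le> indicator (?A \<tau>) x"
      using indep[of x] x by (simp add: indicator_def)
  qed auto
  also have "\<dots> = ennreal c * emeasure law (?A \<tau>)"
    by (simp add: law_def emeasure_density)
  finally show ?thesis
    using assms(2) by (simp add: law.emeasure_eq_measure flip: ennreal_mult)
qed

definition exceeds :: "(nat \<Rightarrow> real) \<Rightarrow> (nat \<Rightarrow> real) set" where
  "exceeds \<alpha> = {x\<in>space (Leb I). \<forall>i\<in>I. \<alpha> i \<le> \<bar>x i\<bar>}"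

lemma exceeds_measurable [measurable]: "exceeds \<alpha> \<in> sets (Leb I)"
  unfolding exceeds_def by measurable

text \<open>
  If \<open>\<bar>x i\<bar> \<ge> \<alpha> i\<close>, then the mean of \<open>\<bar>x i\<bar>\<close> and any \<open>\<bar>y i\<bar>\<close> is at least \<open>\<alpha> i / 2\<close>. So the Prekopa-Leindler
  inequality compares the density on the event, the whole density, and the density on the halved event.
\<close>

lemma exceeds_halve: "law.prob (exceeds \<alpha>) \<le> (law.prob (exceeds (\<lambda>i. \<alpha> i / 2)))^2"
proof -
  let ?E = "\<lambda>\<alpha> x. \<rho> x * indicator (exceeds \<alpha>) x"
  have "(\<integral>\<^sup>+x. ?E \<alpha> x \<partial>Leb I) * (integral\<^sup>N (Leb I) \<rho>) \<le> (\<integral>\<^sup>+x. ?E (\<lambda>i. \<alpha> i / 2) x \<partial>Leb I)^2"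
  proof (rule prekopa_leindler_tensor[where R="\<lambda>x y z. \<bar>z\<bar> = (\<bar>x\<bar> + \<bar>y\<bar>) / 2" and k="\<lambda>x y. 1"])
    fix f g h :: "real \<Rightarrow> ennreal"
    assume "f \<in> borel_measurable borel" "g \<in> borel_measurable borel" "h \<in> borel_measurable borel"
      and "\<And>x y z. \<bar>z\<bar> = (\<bar>x\<bar> + \<bar>y\<bar>) / 2 \<Longrightarrow> f x * g y \<le> ennreal 1 * (h z)^2"
    then show "(integral\<^sup>N lborel f) * (integral\<^sup>N lborel g) \<le> (integral\<^sup>N lborel h)^2"
      by (intro prekopa_leindler_abs) auto
  next
    fix x y z assume xyz: "x \<in> space (Leb I)" "y \<in> space (Leb I)" "z \<in> space (Leb I)"
      and mid: "\<And>i. i \<in> I \<Longrightarrow> \<bar>z i\<bar> = (\<bar>x i\<bar> + \<bar>y i\<bar>) / 2"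
    show "?E \<alpha> x * \<rho> y \<le> ennreal (\<Prod>i\<in>I. 1) * (?E (\<lambda>i. \<alpha> i / 2) z)^2"
    proof (cases "x \<in> exceeds \<alpha>")
      case True
      have "\<alpha> i / 2 \<le> \<bar>z i\<bar>" if "i \<in> I" for i
        using True that mid[OF that] by (auto simp: exceeds_def)
      then have "z \<in> exceeds (\<lambda>i. \<alpha> i / 2)" using xyz by (auto simp: exceeds_def)
      moreover have "\<rho> x * \<rho> y \<le> (\<rho> z)^2" using xyz mid by (intro density_midpoint) auto
      ultimately show ?thesis using True by simp
    qed simp
  qed auto
  then have "emeasure law (exceeds \<alpha>) \<le> (emeasure law (exceeds (\<lambda>i. \<alpha> i / 2)))^2"
    by (simp add: total_mass law_def emeasure_density)
  then show ?thesis by (simp add: law.emeasure_eq_measure ennreal_power)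
qed

lemma exceeds_halve_iterated:
  "law.prob (exceeds \<alpha>) \<le> (law.prob (exceeds (\<lambda>i. \<alpha> i / 2 ^ k))) ^ (2 ^ k)"
proof (induction k)
  case (Suc k)
  have "law.prob (exceeds (\<lambda>i. \<alpha> i / 2 ^ k)) \<le> (law.prob (exceeds (\<lambda>i. \<alpha> i / 2 ^ Suc k)))^2"
    using exceeds_halve[of "\<lambda>i. \<alpha> i / 2 ^ k"] by (simp add: mult.commute)
  then have "(law.prob (exceeds (\<lambda>i. \<alpha> i / 2 ^ k))) ^ (2 ^ k) \<le>
      ((law.prob (exceeds (\<lambda>i. \<alpha> i / 2 ^ Suc k)))^2) ^ (2 ^ k)"
    by (intro power_mono) auto
  with Suc show ?case by (simp flip: power_mult)
qed simp

lemma chebyshev_2: "i \<in> I \<Longrightarrow> law.prob {x\<in>space (Leb I). 2 \<le> \<bar>x i\<bar>} \<le> 1 / 4"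
proof -
  assume i: "i \<in> I"
  then have [measurable]: "(\<lambda>x. x i) \<in> borel_measurable (Leb I)" by measurable
  have "emeasure law {x\<in>space (Leb I). 2 \<le> \<bar>x i\<bar>} = (\<integral>\<^sup>+x. indicator {x\<in>space (Leb I). 2 \<le> \<bar>x i\<bar>} x \<partial>law)"
    by simp
  also have "\<dots> \<le> (\<integral>\<^sup>+x. ennreal (1/4) * ennreal ((x i)^2) \<partial>law)"
  proof (intro nn_integral_mono)
    fix x :: "nat \<Rightarrow> real"
    have "1 \<le> 1/4 * (x i)^2" if "2 \<le> \<bar>x i\<bar>"
      using power_mono[OF that, where n=2] by simp
    then show "indicator {x\<in>space (Leb I). 2 \<le> \<bar>x i\<bar>} x \<le> ennreal (1/4) * ennreal ((x i)^2)"
      by (auto simp: indicator_def simp flip: ennreal_mult)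
  qed
  also have "\<dots> \<le> ennreal (1/4) * 1"
    using mult_left_mono[OF variance_le_1[OF i], of "ennreal (1/4)"]
    by (simp add: nn_integral_cmult nn_integral_law)
  finally show ?thesis by (simp add: law.emeasure_eq_measure)
qed

text \<open>
  The complement of the event contains the disjoint events \<open>D i\<close> that only coordinate \<open>i\<close> stays below its
  threshold. Stretching that coordinate by \<open>2 / \<alpha> i\<close> turns \<open>D i\<close> into an event which fails only if
  \<open>\<bar>x i\<bar> \<ge> 2\<close> or some other coordinate is small, hence has probability at least \<open>1 / 2\<close>. So the losses
  of the coordinates add up, with constants that do not depend on the number of coordinates.
\<close>

lemma exceeds_infinitesimal:
  assumes \<alpha>: "\<And>i. i \<in> I \<Longrightarrow> 0 \<le> \<alpha> i \<and> \<alpha> i \<le> 2" and large: "3/4 \<le> law.prob (exceeds \<alpha>)"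
  shows "law.prob (exceeds \<alpha>) \<le> exp (- (\<Sum>i\<in>I. \<alpha> i) / 4)"
proof -
  have [measurable]: "\<And>i. i \<in> I \<Longrightarrow> (\<lambda>x. x i) \<in> borel_measurable (Leb I)" by measurable
  define D where "D i = {x\<in>space (Leb I). \<bar>x i\<bar> < \<alpha> i \<and> (\<forall>j\<in>I-{i}. \<alpha> j \<le> \<bar>x j\<bar>)}" for i
  have [measurable]: "D i \<in> sets (Leb I)" if "i \<in> I" for i
    unfolding D_def using that by measurable
  have D: "\<alpha> i / 4 \<le> law.prob (D i)" if i: "i \<in> I" for i
  proof (cases "\<alpha> i = 0")
    case False
    then have pos: "0 < \<alpha> i" "1 \<le> 2 / \<alpha> i" using \<alpha>[OF i] by auto
    let ?B = "\<lambda>x. \<forall>j\<in>I-{i}. \<alpha> j \<le> \<bar>x j\<bar>"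
    have "law.prob (exceeds \<alpha>) \<le>
        law.prob ({x\<in>space (Leb I). \<bar>x i\<bar> < 2 \<and> ?B x} \<union> {x\<in>space (Leb I). 2 \<le> \<bar>x i\<bar>})"
      using i by (intro law.finite_measure_mono) (auto simp: exceeds_def)
    also have "\<dots> \<le> law.prob {x\<in>space (Leb I). \<bar>x i\<bar> < 2 \<and> ?B x} + law.prob {x\<in>space (Leb I). 2 \<le> \<bar>x i\<bar>}"
      using i by (intro measure_Un_le) auto
    finally have "1/2 \<le> law.prob {x\<in>space (Leb I). \<bar>x i\<bar> < 2 \<and> ?B x}"
      using large chebyshev_2[OF i] by simp
    also have "\<dots> \<le> 2 / \<alpha> i * law.prob (D i)"
      using measure_dilation_le[OF i pos(2), of ?B "\<alpha> i"] pos(1) by (simp add: D_def)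
    finally show ?thesis using pos(1) by (simp add: field_simps)
  qed simp
  have disj: "disjoint_family_on D I"
    unfolding disjoint_family_on_def
  proof (intro ballI impI)
    fix m n assume mn: "m \<in> I" "n \<in> I" "m \<noteq> n"
    have "\<bar>x n\<bar> < \<alpha> n" "\<alpha> n \<le> \<bar>x n\<bar>" if "x \<in> D m" "x \<in> D n" for x
      using that mn by (auto simp: D_def)
    then show "D m \<inter> D n = {}" by fastforce
  qed
  have "law.prob (exceeds \<alpha>) + (\<Sum>i\<in>I. law.prob (D i)) = law.prob (exceeds \<alpha>) + law.prob (\<Union>i\<in>I. D i)"
    using disj by (subst law.finite_measure_finite_Union) auto
  also have "\<dots> = law.prob (exceeds \<alpha> \<union> (\<Union>i\<in>I. D i))"
    by (rule law.finite_measure_Union[symmetric]) (auto simp: exceeds_def D_def)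
  also have "\<dots> \<le> 1" by simp
  finally have "law.prob (exceeds \<alpha>) \<le> 1 - (\<Sum>i\<in>I. law.prob (D i))" by simp
  also have "\<dots> \<le> 1 + - (\<Sum>i\<in>I. \<alpha> i) / 4"
    using sum_mono[of I "\<lambda>i. \<alpha> i / 4" "\<lambda>i. law.prob (D i)"] D by (simp add: sum_divide_distrib)
  also have "\<dots> \<le> exp (- (\<Sum>i\<in>I. \<alpha> i) / 4)" by (rule exp_ge_add_one_self)
  finally show ?thesis .
qed

text \<open>
  Repeated halving bounds the probability by the \<open>2 ^ k\<close>-th power of the probability for the thresholds
  \<open>\<alpha> i / 2 ^ k\<close>. If it is not 0, this forces the probability for the halved thresholds to tend to 1, and then the estimate
  for infinitesimal thresholds applies.
\<close>

theorem exceeds_le_exp: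
  assumes \<alpha>: "\<And>i. i \<in> I \<Longrightarrow> 0 \<le> \<alpha> i"
  shows "law.prob (exceeds \<alpha>) \<le> exp (- (\<Sum>i\<in>I. \<alpha> i) / 4)"
proof (cases "law.prob (exceeds \<alpha>) = 0")
  case False
  then have pos: "0 < law.prob (exceeds \<alpha>)" by (simp add: zero_less_measure_iff)
  have "(\<lambda>k. (3/4::real) ^ k) \<longlonglongrightarrow> 0" by (rule LIMSEQ_power_zero) simp
  then have 1: "\<forall>\<^sub>F k in sequentially. (3/4::real) ^ k < law.prob (exceeds \<alpha>)"
    using pos by (rule order_tendstoD)
  have "(\<lambda>k. \<alpha> i * (1/2) ^ k) \<longlonglongrightarrow> \<alpha> i * 0" for i
    by (intro tendsto_intros LIMSEQ_power_zero) simp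
  then have "\<forall>\<^sub>F k in sequentially. \<alpha> i * (1/2) ^ k < 2" for i
    by (rule order_tendstoD(2)) simp
  then have 2: "\<forall>\<^sub>F k in sequentially. \<forall>i\<in>I. \<alpha> i * (1/2) ^ k < 2"
    by (simp add: eventually_ball_finite)
  obtain k where k: "(3/4::real) ^ k < law.prob (exceeds \<alpha>)" "\<And>i. i \<in> I \<Longrightarrow> \<alpha> i / 2 ^ k < 2"
    using eventually_happens'[OF _ eventually_conj[OF 1 2]] by (auto simp: power_divide)
  let ?\<beta> = "\<lambda>i. \<alpha> i / 2 ^ k"
  have "3/4 \<le> law.prob (exceeds ?\<beta>)"
  proof (rule ccontr)
    assume "\<not> 3/4 \<le> law.prob (exceeds ?\<beta>)"
    then have "law.prob (exceeds \<alpha>) \<le> (3/4) ^ (2 ^ k)"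
      by (intro order_trans[OF exceeds_halve_iterated[of \<alpha> k]] power_mono) auto
    also have "\<dots> \<le> (3/4) ^ k"
      by (intro power_decreasing) (auto intro: less_imp_le less_exp)
    finally show False using k(1) by simp
  qed
  then have "law.prob (exceeds ?\<beta>) \<le> exp (- (\<Sum>i\<in>I. ?\<beta> i) / 4)"
    using \<alpha> k(2) by (intro exceeds_infinitesimal) (auto intro: less_imp_le)
  then have "(law.prob (exceeds ?\<beta>)) ^ (2 ^ k) \<le> (exp (- (\<Sum>i\<in>I. ?\<beta> i) / 4)) ^ (2 ^ k)"
    by (intro power_mono) auto
  also have "\<dots> = exp (- (\<Sum>i\<in>I. \<alpha> i) / 4)"
    by (simp add: sum_divide_distrib[symmetric] flip: exp_of_nat_mult)
  finally show ?thesis using exceeds_halve_iterated[of \<alpha> k] by linarith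
qed simp

end

section \<open>Exponential moments of the excess and the cost of the truncated norm\<close>

lemma layer_cake_exp:
  fixes s t :: real
  assumes "0 \<le> s"
  shows "ennreal (exp (max 0 (t - s) / 8)) =
    1 + (\<integral>\<^sup>+\<beta>. ennreal (exp ((\<beta> - s) / 8) / 8) * indicator {s..t} \<beta> \<partial>lborel)"
proof (cases "s \<le> t")
  case True
  have "(\<integral>\<^sup>+\<beta>. ennreal (exp ((\<beta> - s) / 8) / 8) * indicator {s..t} \<beta> \<partial>lborel)
      = ennreal (exp ((t - s) / 8) - exp ((s - s) / 8))"
    by (rule nn_integral_FTC_Icc) (use True in \<open>auto intro!: derivative_eq_intros\<close>)
  then show ?thesis using True by (simp add: max_def flip: ennreal_1 ennreal_plus)
next
  case False
  then have "{s..t} = {}" by simp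
  with False show ?thesis by (simp add: max_def)
qed

lemma exponential_tail_integral:
  fixes s :: real
  shows "(\<integral>\<^sup>+\<beta>. ennreal (exp ((\<beta> - s) / 8) / 8) * indicator {s..} \<beta> * ennreal (exp (- \<beta> / 4)) \<partial>lborel)
    = ennreal (exp (- s / 4))"
proof -
  have "(\<integral>\<^sup>+\<beta>. ennreal (exp ((\<beta> - s) / 8) / 8) * indicator {s..} \<beta> * ennreal (exp (- \<beta> / 4)) \<partial>lborel)
     = (\<integral>\<^sup>+\<beta>. ennreal (exp (- (\<beta> + s) / 8) / 8) * indicator {s..} \<beta> \<partial>lborel)"
    by (intro nn_integral_cong)
       (auto simp: indicator_def field_simps simp flip: ennreal_mult exp_add)
  also have "\<dots> = ennreal (0 - (- exp (- (s + s) / 8)))"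
  proof (rule nn_integral_FTC_atLeast[where F="\<lambda>\<beta>. - exp (- (\<beta> + s) / 8)"])
    have "filterlim (\<lambda>\<beta>. - (\<beta> + s) / 8) at_bot at_top"
      unfolding filterlim_at_bot
    proof
      fix Z
      show "\<forall>\<^sub>F \<beta> in at_top. - (\<beta> + s) / 8 \<le> Z"
        using eventually_ge_at_top[of "- 8 * Z - s"] by eventually_elim simp
    qed
    then have "((\<lambda>\<beta>. - exp (- (\<beta> + s) / 8)) \<longlongrightarrow> - 0) at_top"
      by (intro tendsto_minus filterlim_compose[OF exp_at_bot])
    then show "((\<lambda>\<beta>. - exp (- (\<beta> + s) / 8)) \<longlongrightarrow> 0) at_top" by simp
  qed (auto intro!: derivative_eq_intros)
  finally show ?thesis by simp
qed

context unconditional_log_concave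
begin

lemma measurable_coordinate: "i \<in> I \<Longrightarrow> (\<lambda>x. x i) \<in> borel_measurable (Leb I)"
  by measurable

text \<open>
  The bound for simultaneous thresholds, with the indicators of the coordinates in \<open>J\<close> replaced by exponentials.
  In the induction step the exponential of coordinate \<open>i\<close> is a mixture of indicators of thresholds \<open>\<beta>\<close>
  (\<open>layer_cake_exp\<close>), and the induction hypothesis for \<open>\<alpha>(i := \<beta>)\<close> supplies the factor \<open>exp (- \<beta> / 4)\<close>.
  This is decay at twice the rate \<open>1 / 8\<close> of the exponential.
\<close>

lemma exp_excess_on_exceeds:
  assumes s: "0 \<le> s" and "J \<subseteq> I" and "\<And>i. i \<in> I \<Longrightarrow> 0 \<le> \<alpha> i"
  shows "(\<integral>\<^sup>+x. (\<Prod>i\<in>J. ennreal (exp (max 0 (\<bar>x i\<bar> - s) / 8))) * indicator {x. \<forall>i\<in>I-J. \<alpha> i \<le> \<bar>x i\<bar>} x \<partial>law)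
    \<le> ennreal ((1 + exp (- s / 4)) ^ card J * exp (- (\<Sum>i\<in>I-J. \<alpha> i) / 4))"
proof -
  have "finite J" using assms(2) finite_I by (rule finite_subset)
  then show ?thesis using assms(2,3)
  proof (induction J arbitrary: \<alpha> rule: finite_induct)
    case empty
    have "(\<integral>\<^sup>+x. indicator {x. \<forall>i\<in>I. \<alpha> i \<le> \<bar>x i\<bar>} x \<partial>law) = (\<integral>\<^sup>+x. indicator (exceeds \<alpha>) x \<partial>law)"
      by (intro nn_integral_cong) (auto simp: exceeds_def indicator_def)
    also have "\<dots> = ennreal (law.prob (exceeds \<alpha>))" by (simp add: law.emeasure_eq_measure)
    finally show ?case using exceeds_le_exp[OF empty.prems(2)] by simp
  next
    case (insert i J)
    have J: "J \<subseteq> I" "i \<in> I" "i \<notin> J" "finite J" using insert by auto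
    have I: "I - J = insert i (I - insert i J)" using J by auto
    define \<phi> where "\<phi> j x = ennreal (exp (max 0 (\<bar>x j\<bar> - s) / 8))" for j and x :: "nat \<Rightarrow> real"
    define T where "T x = (\<Prod>j\<in>J. \<phi> j x) * indicator {x. \<forall>j\<in>I-insert i J. \<alpha> j \<le> \<bar>x j\<bar>} x" for x
    define \<psi> where "\<psi> \<beta> = ennreal (exp ((\<beta> - s) / 8) / 8)" for \<beta>
    define K where "K = (1 + exp (- s / 4)) ^ card J * exp (- (\<Sum>j\<in>I - insert i J. \<alpha> j) / 4)"
    have K: "0 \<le> K" by (simp add: K_def)
    have [measurable]: "\<psi> \<in> borel_measurable borel" unfolding \<psi>_def by measurable
    have tail_meas: "(\<lambda>\<beta>. \<psi> \<beta> * indicator {s..} \<beta> * ennreal (exp (- \<beta> / 4))) \<in> borel_measurable lborel"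
      by measurable
    have [measurable]: "\<phi> j \<in> borel_measurable (Leb I)" if "j \<in> I" for j
      using measurable_coordinate[OF that] unfolding \<phi>_def by measurable
    have P[measurable]: "Measurable.pred (Leb I) (\<lambda>x. \<forall>j\<in>I-insert i J. \<alpha> j \<le> \<bar>x j\<bar>)" by measurable
    have [measurable]: "(\<lambda>x. \<Prod>j\<in>J. \<phi> j x) \<in> borel_measurable (Leb I)"
      using J(1) by (intro borel_measurable_prod_ennreal) auto
    have [measurable]: "T \<in> borel_measurable (Leb I)" unfolding T_def by measurable
    have [measurable]: "(\<lambda>x. x i) \<in> borel_measurable (Leb I)" using J(2) by measurable
    have IH: "(\<integral>\<^sup>+x. T x * indicator {b. b \<le> \<bar>x i\<bar>} \<beta> \<partial>law) \<le> ennreal K * ennreal (exp (- \<beta> / 4))" if "0 \<le> \<beta>" for \<beta>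
    proof -
      have "(\<Sum>j\<in>I - J. (\<alpha>(i := \<beta>)) j) = \<beta> + (\<Sum>j\<in>I - insert i J. \<alpha> j)"
        unfolding I by (subst sum.insert) (auto intro: sum.cong)
      then have "(1 + exp (- s / 4)) ^ card J * exp (- (\<Sum>j\<in>I - J. (\<alpha>(i := \<beta>)) j) / 4) = K * exp (- \<beta> / 4)"
      proof -
        assume "(\<Sum>j\<in>I - J. (\<alpha>(i := \<beta>)) j) = \<beta> + (\<Sum>j\<in>I - insert i J. \<alpha> j)"
        then have "- (\<Sum>j\<in>I - J. (\<alpha>(i := \<beta>)) j) / 4 = - (\<Sum>j\<in>I - insert i J. \<alpha> j) / 4 + - \<beta> / 4" by simp
        then show ?thesis unfolding K_def by (simp only: exp_add mult.assoc)
      qed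
      then have "(\<integral>\<^sup>+x. (\<Prod>j\<in>J. \<phi> j x) * indicator {x. \<forall>j\<in>I-J. (\<alpha>(i := \<beta>)) j \<le> \<bar>x j\<bar>} x \<partial>law) \<le> ennreal K * ennreal (exp (- \<beta> / 4))"
        using insert.IH[of "\<alpha>(i := \<beta>)"] insert.prems that J(1) K by (simp add: ennreal_mult \<phi>_def)
      also have "(\<lambda>x. (\<Prod>j\<in>J. \<phi> j x) * indicator {x. \<forall>j\<in>I-J. (\<alpha>(i := \<beta>)) j \<le> \<bar>x j\<bar>} x) =
          (\<lambda>x. T x * indicator {b. b \<le> \<bar>x i\<bar>} \<beta>)"
      proof
        fix x :: "nat \<Rightarrow> real"
        have "(\<forall>j\<in>I-J. (\<alpha>(i := \<beta>)) j \<le> \<bar>x j\<bar>) \<longleftrightarrow> \<beta> \<le> \<bar>x i\<bar> \<and> (\<forall>j\<in>I-insert i J. \<alpha> j \<le> \<bar>x j\<bar>)"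
          unfolding I by auto
        then show "(\<Prod>j\<in>J. \<phi> j x) * indicator {x. \<forall>j\<in>I-J. (\<alpha>(i := \<beta>)) j \<le> \<bar>x j\<bar>} x = T x * indicator {b. b \<le> \<bar>x i\<bar>} \<beta>"
          by (simp add: T_def indicator_def)
      qed
      finally show ?thesis .
    qed
    let ?F = "\<lambda>x. (\<Prod>j\<in>insert i J. \<phi> j x) * indicator {x. \<forall>j\<in>I-insert i J. \<alpha> j \<le> \<bar>x j\<bar>} x"
    let ?U = "\<lambda>x \<beta>. T x * indicator {b. b \<le> \<bar>x i\<bar>} \<beta>" and ?W = "\<lambda>\<beta>. \<psi> \<beta> * indicator {s..} \<beta>"
    have "(integral\<^sup>N law ?F)
      = (\<integral>\<^sup>+x. ?U x 0 + (\<integral>\<^sup>+\<beta>. ?U x \<beta> * ?W \<beta> \<partial>lborel) \<partial>law)"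
    proof (intro nn_integral_cong)
      fix x
      have "(\<integral>\<^sup>+\<beta>. ?U x \<beta> * ?W \<beta> \<partial>lborel) =
          (\<integral>\<^sup>+\<beta>. T x * (\<psi> \<beta> * indicator {s..\<bar>x i\<bar>} \<beta>) \<partial>lborel)"
        by (intro nn_integral_cong) (auto simp: indicator_def)
      also have "\<dots> = T x * (\<integral>\<^sup>+\<beta>. \<psi> \<beta> * indicator {s..\<bar>x i\<bar>} \<beta> \<partial>lborel)"
        by (rule nn_integral_cmult) auto
      finally have "?U x 0 + (\<integral>\<^sup>+\<beta>. ?U x \<beta> * ?W \<beta> \<partial>lborel) = T x * \<phi> i x"
        unfolding \<phi>_def layer_cake_exp[OF s] by (simp add: distrib_left \<psi>_def)
      then show "?F x =
          ?U x 0 + (\<integral>\<^sup>+\<beta>. ?U x \<beta> * ?W \<beta> \<partial>lborel)"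
        using J(3,4) by (simp add: T_def ac_simps)
    qed
    also have "\<dots> = (\<integral>\<^sup>+x. ?U x 0 \<partial>law) + (\<integral>\<^sup>+x. \<integral>\<^sup>+\<beta>. ?U x \<beta> * ?W \<beta> \<partial>lborel \<partial>law)"
      by (rule nn_integral_add) measurable
    finally have split: "(integral\<^sup>N law ?F) = \<dots>" .
    have "(\<integral>\<^sup>+x. \<integral>\<^sup>+\<beta>. ?U x \<beta> * ?W \<beta> \<partial>lborel \<partial>law)
        = (\<integral>\<^sup>+\<beta>. \<integral>\<^sup>+x. ?U x \<beta> * ?W \<beta> \<partial>law \<partial>lborel)"
    proof -
      interpret pair_sigma_finite lborel law ..
      show ?thesis by (rule Fubini') measurable
    qed
    also have "\<dots> = (\<integral>\<^sup>+\<beta>. (\<integral>\<^sup>+x. ?U x \<beta> \<partial>law) * ?W \<beta> \<partial>lborel)"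
      by (intro nn_integral_cong nn_integral_multc) measurable
    also have "\<dots> \<le> (\<integral>\<^sup>+\<beta>. ennreal K * (\<psi> \<beta> * indicator {s..} \<beta> * ennreal (exp (- \<beta> / 4))) \<partial>lborel)"
    proof (intro nn_integral_mono)
      fix \<beta>
      show "(\<integral>\<^sup>+x. ?U x \<beta> \<partial>law) * ?W \<beta>
          \<le> ennreal K * (\<psi> \<beta> * indicator {s..} \<beta> * ennreal (exp (- \<beta> / 4)))"
        using mult_right_mono[OF IH[of \<beta>], of "\<psi> \<beta>"] s by (cases "s \<le> \<beta>") (auto simp: ac_simps)
    qed
    also have "\<dots> = ennreal K * ennreal (exp (- s / 4))"
    proof -
      show ?thesis using tail_meas
        by (simp only: nn_integral_cmult exponential_tail_integral[of s, folded \<psi>_def])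
    qed
    finally have "(integral\<^sup>N law ?F)
      \<le> ennreal K + ennreal K * ennreal (exp (- s / 4))"
      unfolding split using IH[of 0] by (intro add_mono) simp_all
    also have "\<dots> = ennreal ((1 + exp (- s / 4)) ^ card (insert i J) * exp (- (\<Sum>j\<in>I - insert i J. \<alpha> j) / 4))"
      using K J by (simp add: K_def algebra_simps flip: ennreal_mult ennreal_plus)
    finally show ?case unfolding \<phi>_def .
  qed
qed

theorem exp_total_excess:
  assumes "0 \<le> s"
  shows "(\<integral>\<^sup>+x. ennreal (exp ((\<Sum>i\<in>I. max 0 (\<bar>x i\<bar> - s)) / 8)) \<partial>law) \<le> ennreal ((1 + exp (- s / 4)) ^ card I)"
  using exp_excess_on_exceeds[OF assms order_refl, of "\<lambda>_. 0"]
  by (simp add: sum_divide_distrib exp_sum prod_ennreal)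

end

text \<open>
  With \<open>r = sqrt (\<bar>y\<bar> / \<bar>x\<bar>) < 1\<close> the relative decrease is \<open>\<delta> = 1 - r^2 \<le> 2 * (1 - r)\<close>, and the gain is
  \<open>1 + (1 - r)^2 / (4 * r) \<ge> 1 + \<delta>^2 / 16\<close>.
\<close>

lemma sqrt_gain_ge:
  assumes "x \<noteq> 0" "y \<noteq> 0"
  shows "exp ((max 0 (\<bar>x\<bar> - \<bar>y\<bar>) / \<bar>x\<bar>)^2 / 32) \<le> sqrt_gain x y"
proof -
  define a where "a = sqrt \<bar>x\<bar>"
  define b where "b = sqrt \<bar>y\<bar>"
  have ab: "0 < a" "0 < b" "\<bar>x\<bar> = a^2" "\<bar>y\<bar> = b^2" using assms by (auto simp: a_def b_def)
  have gain: "sqrt_gain x y = (a + b)^2 / (4 * a * b)" by (simp add: sqrt_gain_def a_def b_def)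
  show ?thesis
  proof (cases "b < a")
    case False
    then have "b^2 \<ge> a^2" using ab by (intro power_mono) auto
    moreover have "4 * a * b \<le> (a + b)^2" 
      using zero_le_power2[of "a - b"] by (simp add: power2_eq_square algebra_simps)
    ultimately show ?thesis using ab by (simp add: gain)
  next
    case True
    define r where "r = b / a"
    have r: "0 < r" "r < 1" using ab True by (auto simp: r_def)
    have b: "b = r * a" using ab by (simp add: r_def)
    define \<delta> where "\<delta> = max 0 (\<bar>x\<bar> - \<bar>y\<bar>) / \<bar>x\<bar>"
    have "b^2 < a^2" using True ab by (intro power_strict_mono) auto
    then have "\<delta> = (a^2 - b^2) / a^2" using ab by (simp add: \<delta>_def)
    then have \<delta>: "\<delta> = 1 - r^2" using ab by (simp add: b power_mult_distrib diff_divide_distrib)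
    have \<delta>01: "0 \<le> \<delta>" "\<delta> \<le> 1" using r by (auto simp: \<delta> power_le_one)
    then have "\<delta>^2 \<le> 1" by (simp add: power_le_one)
    then have "exp (\<delta>^2 / 32) \<le> 1 + \<delta>^2 / 32 + (\<delta>^2 / 32)^2"
      by (intro exp_bound) auto
    also have "(\<delta>^2 / 32)^2 \<le> \<delta>^2 / 32 * 1"
      unfolding power2_eq_square[of "\<delta>^2 / 32"] using \<open>\<delta>^2 \<le> 1\<close> by (intro mult_left_mono) auto
    also have "1 + \<delta>^2 / 32 + \<delta>^2 / 32 * 1 \<le> 1 + (1 - r)^2 / 4"
    proof -
      have "\<delta> = (1 - r) * (1 + r)" by (simp add: \<delta> power2_eq_square algebra_simps)
      also have "\<dots> \<le> (1 - r) * 2" using r by (intro mult_left_mono) auto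
      finally have "\<delta>^2 \<le> ((1 - r) * 2)^2" using \<delta>01 by (intro power_mono)
      then have "\<delta>^2 \<le> (1 - r)^2 * 4" unfolding power_mult_distrib by simp
      then show ?thesis by simp
    qed
    also have "(1 - r)^2 / 4 \<le> (1 - r)^2 / (4 * r)" using r by (intro divide_left_mono) auto
    also have "1 + (1 - r)^2 / (4 * r) = (1 + r)^2 / (4 * r)"
      using r by (simp add: power2_eq_square field_simps)
    also have "\<dots> = sqrt_gain x y"
      using r ab by (simp add: gain b power2_eq_square field_simps)
    finally show ?thesis by (simp add: \<delta>_def)
  qed
qed

text \<open>
  By the Cauchy-Schwarz inequality the truncated norm \<open>f\<close> drops from \<open>x\<close> to \<open>y\<close> by at most the sum of the
  \<open>w i * \<delta> i\<close>, where \<open>\<delta> i\<close> is the relative decrease of \<open>\<bar>x i\<bar>\<close> and \<open>w i\<close> is the derivative of \<open>f\<close> under a relative change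
  of the \<open>i\<close>-th truncated coordinate. The truncation gives \<open>(\<Sum>i\<in>I. (w i)^2) \<le> s^2\<close>, and the claim is Young's inequality.
\<close>

lemma truncated_norm_cost:
  fixes a x y :: "'i \<Rightarrow> real"
  assumes f_def: "\<And>x. f x = L2_set (\<lambda>i. a i * min \<bar>x i\<bar> s) I"
    and "finite I" "0 \<le> s" and a: "\<And>i. i \<in> I \<Longrightarrow> \<bar>a i\<bar> \<le> 1"
    and x: "\<And>i. i \<in> I \<Longrightarrow> x i \<noteq> 0" and "0 \<le> l"
  shows "l * (f x - f y) \<le> 8 * l^2 * s^2 + (\<Sum>i\<in>I. (max 0 (\<bar>x i\<bar> - \<bar>y i\<bar>) / \<bar>x i\<bar>)^2 / 32)"
proof (cases "f x = 0")
  case True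
  have "l * (f x - f y) \<le> 0" using True \<open>0 \<le> l\<close> by (simp add: f_def)
  moreover have "0 \<le> 8 * l^2 * s^2 + (\<Sum>i\<in>I. (max 0 (\<bar>x i\<bar> - \<bar>y i\<bar>) / \<bar>x i\<bar>)^2 / 32)"
    by (intro add_nonneg_nonneg sum_nonneg) auto
  ultimately show ?thesis by linarith
next
  case False
  then have f: "0 < f x" using L2_set_nonneg[of _ I] by (simp add: f_def order_less_le)
  define c where "c i = min \<bar>x i\<bar> s" for i
  define d where "d i = min \<bar>y i\<bar> s" for i
  define \<delta> where "\<delta> i = max 0 (\<bar>x i\<bar> - \<bar>y i\<bar>) / \<bar>x i\<bar>" for i
  define w where "w i = (a i * c i)^2 / f x" for i
  have cd: "0 \<le> c i" "c i \<le> s" "0 \<le> d i" for i using \<open>0 \<le> s\<close> by (auto simp: c_def d_def)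
  have f2: "(\<Sum>i\<in>I. (a i * c i)^2) = (f x)^2"
    by (simp add: f_def L2_set_def c_def sum_nonneg)
  have drop: "c i - d i \<le> c i * \<delta> i" if "i \<in> I" for i
  proof (cases "\<bar>y i\<bar> < \<bar>x i\<bar>")
    case True
    let ?t = "\<bar>y i\<bar> / \<bar>x i\<bar>"
    have t: "0 \<le> ?t" "?t \<le> 1" using True by auto
    have "c i * ?t \<le> \<bar>x i\<bar> * ?t" using t by (intro mult_right_mono) (auto simp: c_def)
    moreover have "c i * ?t \<le> s * 1" using t cd \<open>0 \<le> s\<close> by (intro mult_mono) auto
    ultimately have "c i * ?t \<le> d i" using x[OF that] by (simp add: d_def)
    moreover have "\<delta> i = 1 - ?t" using True x[OF that] by (simp add: \<delta>_def diff_divide_distrib)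
    ultimately show ?thesis by (simp add: right_diff_distrib)
  next
    case False
    then have "\<delta> i = 0" "c i \<le> d i" by (auto simp: \<delta>_def c_def d_def)
    then show ?thesis by simp
  qed
  have "f x * f y \<ge> (\<Sum>i\<in>I. \<bar>a i * c i\<bar> * \<bar>a i * d i\<bar>)"
    unfolding f_def c_def d_def by (rule L2_set_mult_ineq)
  moreover have "(\<Sum>i\<in>I. \<bar>a i * c i\<bar> * \<bar>a i * d i\<bar>) = (\<Sum>i\<in>I. (a i)^2 * (c i * d i))"
    using cd by (intro sum.cong) (auto simp: abs_mult power2_eq_square ac_simps)
  moreover have "f x * (f x - f y) = (\<Sum>i\<in>I. (a i * c i)^2) - f x * f y"
    unfolding f2 by (simp only: power2_eq_square right_diff_distrib)
  ultimately have "f x * (f x - f y) \<le> (\<Sum>i\<in>I. (a i * c i)^2) - (\<Sum>i\<in>I. (a i)^2 * (c i * d i))"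
    by linarith
  also have "\<dots> = (\<Sum>i\<in>I. (a i)^2 * (c i * (c i - d i)))"
    by (simp add: sum_subtractf[symmetric] power2_eq_square algebra_simps)
  also have "\<dots> \<le> (\<Sum>i\<in>I. (a i)^2 * (c i * (c i * \<delta> i)))"
    using drop cd by (intro sum_mono mult_left_mono) auto
  also have "\<dots> = f x * (\<Sum>i\<in>I. w i * \<delta> i)"
    using f by (simp add: w_def sum_distrib_left power2_eq_square ac_simps)
  finally have "f x - f y \<le> (\<Sum>i\<in>I. w i * \<delta> i)" using f by simp
  then have "l * (f x - f y) \<le> (\<Sum>i\<in>I. l * w i * \<delta> i)"
    using \<open>0 \<le> l\<close> by (simp add: sum_distrib_left[symmetric] mult.assoc mult_left_mono)
  also have "\<dots> \<le> (\<Sum>i\<in>I. 8 * l^2 * (w i)^2 + (\<delta> i)^2 / 32)"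
  proof (intro sum_mono)
    fix i
    have "0 \<le> (\<delta> i - 16 * l * w i)^2 / 32" by simp
    then show "l * w i * \<delta> i \<le> 8 * l^2 * (w i)^2 + (\<delta> i)^2 / 32"
      by (simp add: power2_eq_square algebra_simps)
  qed
  also have "\<dots> = 8 * l^2 * (\<Sum>i\<in>I. (w i)^2) + (\<Sum>i\<in>I. (\<delta> i)^2 / 32)"
    by (simp add: sum.distrib sum_distrib_left)
  also have "(\<Sum>i\<in>I. (w i)^2) \<le> (\<Sum>i\<in>I. s^2 * ((a i * c i)^2 / (f x)^2))"
  proof (intro sum_mono)
    fix i assume i: "i \<in> I"
    have "\<bar>a i * c i\<bar> \<le> 1 * s" unfolding abs_mult using a[OF i] cd[of i] by (intro mult_mono) auto
    then have "(a i * c i)^2 \<le> s^2" using \<open>0 \<le> s\<close> by (simp add: abs_le_square_iff[symmetric])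
    then have "(a i * c i)^2 * ((a i * c i)^2 / (f x)^2) \<le> s^2 * ((a i * c i)^2 / (f x)^2)"
      by (intro mult_right_mono) auto
    then show "(w i)^2 \<le> s^2 * ((a i * c i)^2 / (f x)^2)"
      by (simp add: w_def power_divide power2_eq_square)
  qed
  also have "\<dots> = s^2"
    using f by (simp add: sum_distrib_left[symmetric] sum_divide_distrib[symmetric] f2)
  finally show ?thesis by (simp add: \<delta>_def mult_left_mono)
qed

section \<open>Moments of the Euclidean norm\<close>

lemma powr_le_exp:
  fixes p \<kappa> y :: real
  assumes "0 < p" "0 < \<kappa>" "0 \<le> y"
  shows "y powr p \<le> (p / \<kappa>) powr p * exp (\<kappa> * y)"
proof -
  have "\<kappa> * y / p \<le> exp (\<kappa> * y / p)" using exp_ge_add_one_self[of "\<kappa> * y / p"] by linarith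
  then have "y \<le> p / \<kappa> * exp (\<kappa> * y / p)" using assms by (simp add: field_simps)
  then have "y powr p \<le> (p / \<kappa> * exp (\<kappa> * y / p)) powr p" using assms by (intro powr_mono2) auto
  also have "\<dots> = (p / \<kappa>) powr p * exp (\<kappa> * y)"
    using assms by (subst powr_mult) (auto simp: exp_powr_real)
  finally show ?thesis .
qed

lemma powr_convex_combination:
  fixes u v \<theta> p :: real
  assumes "1 \<le> p" "0 \<le> u" "0 \<le> v" "0 < \<theta>" "\<theta> < 1"
  shows "(\<theta> * u + (1 - \<theta>) * v) powr p \<le> \<theta> * u powr p + (1 - \<theta>) * v powr p"
proof -
  have shrink: "(t * w) powr p \<le> t * w powr p" if "0 < t" "t < 1" "0 \<le> w" for t w :: real
  proof -
    have "t powr p \<le> t powr 1" using that assms(1) by (intro powr_mono') auto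
    then show ?thesis using that by (simp add: powr_mult mult_right_mono)
  qed
  consider "u = 0" | "v = 0" | "0 < u" "0 < v" using assms by linarith
  then show ?thesis
  proof cases
    case 1
    then show ?thesis using shrink[of "1 - \<theta>" v] assms by simp
  next
    case 2
    then show ?thesis using shrink[of \<theta> u] assms by simp
  next
    case 3
    then show ?thesis
      using convex_onD[OF powr_convex[OF assms(1)], of "1 - \<theta>" u v] assms by simp
  qed
qed

text \<open>
  Minkowski's inequality, in terms of bounds \<open>B\<close>, \<open>D\<close> for the two norms: apply convexity of the power to
  \<open>f / B\<close> and \<open>g / D\<close> with the weights \<open>B / (B + D)\<close> and \<open>D / (B + D)\<close>.
\<close>

lemma nn_integral_powr_add_le:
  fixes f g :: "'a \<Rightarrow> real"
  assumes [measurable]: "f \<in> borel_measurable M" "g \<in> borel_measurable M"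
    and p: "1 \<le> p" and B: "0 < B" "0 < D" and nonneg: "\<And>x. x \<in> space M \<Longrightarrow> 0 \<le> f x" "\<And>x. x \<in> space M \<Longrightarrow> 0 \<le> g x"
    and f: "(\<integral>\<^sup>+x. ennreal (f x powr p) \<partial>M) \<le> ennreal (B powr p)"
    and g: "(\<integral>\<^sup>+x. ennreal (g x powr p) \<partial>M) \<le> ennreal (D powr p)"
  shows "(\<integral>\<^sup>+x. ennreal ((f x + g x) powr p) \<partial>M) \<le> ennreal ((B + D) powr p)"
proof -
  define \<theta> where "\<theta> = B / (B + D)"
  have \<theta>: "0 < \<theta>" "0 < 1 - \<theta>" "1 - \<theta> = D / (B + D)" using B by (auto simp: \<theta>_def field_simps)
  define u where "u = (B + D) powr p * \<theta> / B powr p"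
  define v where "v = (B + D) powr p * (1 - \<theta>) / D powr p"
  have u: "0 \<le> u" unfolding u_def using \<theta>(1) by (intro divide_nonneg_nonneg mult_nonneg_nonneg) auto
  have v: "0 \<le> v" unfolding v_def using \<theta>(2) by (intro divide_nonneg_nonneg mult_nonneg_nonneg powr_ge_zero) linarith
  note uv = u v
  have pointwise: "(f x + g x) powr p \<le> u * f x powr p + v * g x powr p" if "x \<in> space M" for x
  proof -
    note nn = nonneg[OF that]
    have "f x + g x = (B + D) * (\<theta> * (f x / B) + (1 - \<theta>) * (g x / D))"
      using B by (simp add: \<theta>(3) distrib_left) (simp add: \<theta>_def)
    then have "(f x + g x) powr p = (B + D) powr p * (\<theta> * (f x / B) + (1 - \<theta>) * (g x / D)) powr p"
      using B \<theta> nn by (simp add: powr_mult)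
    also have "(\<theta> * (f x / B) + (1 - \<theta>) * (g x / D)) powr p \<le> \<theta> * (f x / B) powr p + (1 - \<theta>) * (g x / D) powr p"
      using powr_convex_combination[OF p, of "f x / B" "g x / D" \<theta>] \<theta> nn B by simp
    finally show ?thesis
      using B nn by (simp add: u_def v_def powr_divide distrib_left mult_left_mono)
  qed
  have "(\<integral>\<^sup>+x. ennreal ((f x + g x) powr p) \<partial>M) \<le> (\<integral>\<^sup>+x. ennreal u * ennreal (f x powr p) + ennreal v * ennreal (g x powr p) \<partial>M)"
    using pointwise uv by (intro nn_integral_mono) (simp flip: ennreal_mult ennreal_plus)
  also have "\<dots> = ennreal u * (\<integral>\<^sup>+x. ennreal (f x powr p) \<partial>M) + ennreal v * (\<integral>\<^sup>+x. ennreal (g x powr p) \<partial>M)"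
    by (simp add: nn_integral_add nn_integral_cmult)
  also have "\<dots> \<le> ennreal u * ennreal (B powr p) + ennreal v * ennreal (D powr p)"
    by (intro add_mono mult_left_mono f g) auto
  also have "\<dots> = ennreal (u * B powr p + v * D powr p)"
    using uv by (simp add: ennreal_mult)
  also have "u * B powr p + v * D powr p = (B + D) powr p"
    using B by (simp add: u_def v_def flip: distrib_left)
  finally show ?thesis .
qed

context unconditional_log_concave
begin

definition trunc_norm :: "(nat \<Rightarrow> real) \<Rightarrow> real \<Rightarrow> (nat \<Rightarrow> real) \<Rightarrow> real" where
  "trunc_norm a s x = L2_set (\<lambda>i. a i * min \<bar>x i\<bar> s) I"

definition total_excess :: "real \<Rightarrow> (nat \<Rightarrow> real) \<Rightarrow> real" where
  "total_excess s x = (\<Sum>i\<in>I. max 0 (\<bar>x i\<bar> - s))"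

lemma trunc_norm_measurable [measurable]: "trunc_norm a s \<in> borel_measurable (Leb I)"
  unfolding trunc_norm_def[abs_def] L2_set_def
  using measurable_coordinate by measurable

lemma total_excess_measurable [measurable]: "total_excess s \<in> borel_measurable (Leb I)"
  unfolding total_excess_def[abs_def]
  using measurable_coordinate by measurable

text \<open>
  The Prekopa-Leindler inequality in square root coordinates for the density multiplied by
  \<open>exp (l * f - 8 * l^2 * s^2)\<close> and by \<open>exp (- l * f)\<close>: the product of these factors at \<open>x\<close> and \<open>y\<close> is at most the gain.
\<close>

lemma exp_trunc_norm_product_le_1:
  assumes a: "\<And>i. i \<in> I \<Longrightarrow> \<bar>a i\<bar> \<le> 1" and s: "0 \<le> s" and l: "0 \<le> l"
  shows "(\<integral>\<^sup>+x. ennreal (exp (l * trunc_norm a s x - 8 * l^2 * s^2)) \<partial>law) *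
    (\<integral>\<^sup>+x. ennreal (exp (- l * trunc_norm a s x)) \<partial>law) \<le> 1"
proof -
  let ?f = "trunc_norm a s"
  have "(\<integral>\<^sup>+x. \<rho> x * ennreal (exp (l * ?f x - 8 * l^2 * s^2)) \<partial>Leb I) *
    (\<integral>\<^sup>+x. \<rho> x * ennreal (exp (- l * ?f x)) \<partial>Leb I) \<le> (integral\<^sup>N (Leb I) \<rho>)^2"
  proof (rule prekopa_leindler_tensor[where R=sqrt_mean and k=sqrt_gain])
    fix f g h :: "real \<Rightarrow> ennreal"
    assume "f \<in> borel_measurable borel" "g \<in> borel_measurable borel" "h \<in> borel_measurable borel"
      and "\<And>x y z. sqrt_mean x y z \<Longrightarrow> f x * g y \<le> ennreal (sqrt_gain x y) * (h z)^2"
    then show "(integral\<^sup>N lborel f) * (integral\<^sup>N lborel g) \<le> (integral\<^sup>N lborel h)^2"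
      by (rule prekopa_leindler_sqrt)
  next
    fix x y z assume xyz: "x \<in> space (Leb I)" "y \<in> space (Leb I)" "z \<in> space (Leb I)"
      and mean: "\<And>i. i \<in> I \<Longrightarrow> sqrt_mean (x i) (y i) (z i)"
    have nz: "x i \<noteq> 0" "y i \<noteq> 0" if "i \<in> I" for i using mean[OF that] by (auto simp: sqrt_mean_def)
    have "\<bar>z i\<bar> \<le> (\<bar>x i\<bar> + \<bar>y i\<bar>) / 2" if "i \<in> I" for i
    proof -
      have "\<bar>z i\<bar> = ((sqrt \<bar>x i\<bar> + sqrt \<bar>y i\<bar>) / 2)^2"
        using mean[OF that] by (metis sqrt_mean_def abs_ge_zero real_sqrt_pow2)
      also have "\<dots> \<le> ((sqrt \<bar>x i\<bar>)^2 + (sqrt \<bar>y i\<bar>)^2) / 2"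
        using zero_le_power2[of "sqrt \<bar>x i\<bar> - sqrt \<bar>y i\<bar>"]
        by (simp only: power2_sum power2_diff power_divide) simp
      finally show ?thesis by simp
    qed
    then have \<rho>: "\<rho> x * \<rho> y \<le> (\<rho> z)^2" using xyz by (intro density_midpoint) auto
    let ?\<delta> = "\<lambda>i. (max 0 (\<bar>x i\<bar> - \<bar>y i\<bar>) / \<bar>x i\<bar>)^2 / 32"
    have "l * (?f x - ?f y) \<le> 8 * l^2 * s^2 + (\<Sum>i\<in>I. ?\<delta> i)"
      using a s l nz(1) by (intro truncated_norm_cost[where a=a and f="?f"]) (auto simp: trunc_norm_def)
    then have "exp (l * ?f x - 8 * l^2 * s^2) * exp (- l * ?f y) \<le> exp (\<Sum>i\<in>I. ?\<delta> i)"
      by (simp add: algebra_simps flip: exp_add)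
    also have "\<dots> = (\<Prod>i\<in>I. exp (?\<delta> i))" by (simp add: exp_sum)
    also have "\<dots> \<le> (\<Prod>i\<in>I. sqrt_gain (x i) (y i))"
      using sqrt_gain_ge nz by (intro prod_mono) auto
    finally have gain: "exp (l * ?f x - 8 * l^2 * s^2) * exp (- l * ?f y) \<le> (\<Prod>i\<in>I. sqrt_gain (x i) (y i))" .
    have "\<rho> x * ennreal (exp (l * ?f x - 8 * l^2 * s^2)) * (\<rho> y * ennreal (exp (- l * ?f y)))
      = ennreal (exp (l * ?f x - 8 * l^2 * s^2) * exp (- l * ?f y)) * (\<rho> x * \<rho> y)"
      by (simp add: ennreal_mult ac_simps)
    also have "\<dots> \<le> ennreal (\<Prod>i\<in>I. sqrt_gain (x i) (y i)) * (\<rho> z)^2"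
      using gain by (intro mult_mono \<rho> ennreal_leI) auto
    finally show "\<rho> x * ennreal (exp (l * ?f x - 8 * l^2 * s^2)) * (\<rho> y * ennreal (exp (- l * ?f y)))
      \<le> ennreal (\<Prod>i\<in>I. sqrt_gain (x i) (y i)) * (\<rho> z)^2" .
  qed (auto simp: sqrt_gain_def)
  then show ?thesis by (simp add: nn_integral_law total_mass)
qed

lemma trunc_norm_second_moment:
  assumes "0 \<le> s"
  shows "(\<integral>\<^sup>+x. ennreal ((trunc_norm a s x)^2) \<partial>law) \<le> ennreal ((L2_set a I)^2)"
proof -
  have [measurable]: "(\<lambda>x. x i) \<in> borel_measurable (Leb I)" if "i \<in> I" for i
    using that by (rule measurable_coordinate)
  have "(\<integral>\<^sup>+x. ennreal ((trunc_norm a s x)^2) \<partial>law) \<le> (\<integral>\<^sup>+x. (\<Sum>i\<in>I. ennreal ((a i)^2) * ennreal ((x i)^2)) \<partial>law)"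
  proof (intro nn_integral_mono)
    fix x
    have "(trunc_norm a s x)^2 = (\<Sum>i\<in>I. (a i * min \<bar>x i\<bar> s)^2)"
      by (simp add: trunc_norm_def L2_set_def sum_nonneg)
    also have "\<dots> \<le> (\<Sum>i\<in>I. (a i)^2 * (x i)^2)"
    proof (intro sum_mono)
      fix i
      have "(min \<bar>x i\<bar> s)^2 \<le> \<bar>x i\<bar>^2" using assms by (intro power_mono) auto
      then show "(a i * min \<bar>x i\<bar> s)^2 \<le> (a i)^2 * (x i)^2"
        by (simp add: power_mult_distrib mult_left_mono)
    qed
    finally show "ennreal ((trunc_norm a s x)^2) \<le> (\<Sum>i\<in>I. ennreal ((a i)^2) * ennreal ((x i)^2))"
      by (simp add: sum_nonneg flip: ennreal_mult)
  qed
  also have "\<dots> = (\<Sum>i\<in>I. ennreal ((a i)^2) * (\<integral>\<^sup>+x. ennreal ((x i)^2) \<partial>law))"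
    by (subst nn_integral_sum) (auto intro!: sum.cong nn_integral_cmult)
  also have "\<dots> \<le> (\<Sum>i\<in>I. ennreal ((a i)^2) * 1)"
    using variance_le_1 by (intro sum_mono mult_left_mono) (auto simp: nn_integral_law)
  also have "\<dots> = ennreal ((L2_set a I)^2)"
    by (simp add: L2_set_def sum_nonneg)
  finally show ?thesis .
qed

text \<open>
  Jensen's inequality. As only the second moment of \<open>f\<close> is under control, the tangent of the exponential at \<open>A\<close> is
  combined with \<open>f - A \<le> (f^2 - A^2) / (2 * A)\<close>.
\<close>

lemma laplace_transform_trunc_norm_ge:
  assumes "0 \<le> s" "0 \<le> l" and A: "0 < A" "A = L2_set a I"
  shows "ennreal (exp (- l * A)) \<le> (\<integral>\<^sup>+x. ennreal (exp (- l * trunc_norm a s x)) \<partial>law)"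
proof -
  let ?f = "trunc_norm a s" and ?c = "exp (- l * A)"
  define d where "d = ?c * (l / (2 * A))"
  have d: "0 \<le> d" using assms by (simp add: d_def)
  have pointwise: "?c + d * A^2 \<le> exp (- l * ?f x) + d * (?f x)^2" for x
  proof -
    have "?c * (1 + (- l * (?f x - A))) \<le> ?c * exp (- l * (?f x - A))"
      by (intro mult_left_mono exp_ge_add_one_self) auto
    also have "\<dots> = exp (- l * ?f x)" by (simp add: algebra_simps flip: exp_add)
    finally have 1: "?c - ?c * l * (?f x - A) \<le> exp (- l * ?f x)" by (simp add: algebra_simps)
    have "2 * A * (?f x - A) \<le> (?f x)^2 - A^2"
      using zero_le_power2[of "?f x - A"] by (simp add: power2_eq_square algebra_simps)
    then have "d * (2 * A * (?f x - A)) \<le> d * ((?f x)^2 - A^2)" using d by (rule mult_left_mono)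
    moreover have "d * (2 * A * (?f x - A)) = ?c * l * (?f x - A)" using A by (simp add: d_def)
    ultimately show ?thesis using 1 by (simp add: right_diff_distrib)
  qed
  have "ennreal ?c + ennreal (d * A^2) = (\<integral>\<^sup>+x. ennreal (?c + d * A^2) \<partial>law)"
    using d by (simp add: law.emeasure_space_1[simplified])
  also have "\<dots> \<le> (\<integral>\<^sup>+x. ennreal (exp (- l * ?f x)) + ennreal d * ennreal ((?f x)^2) \<partial>law)"
    using pointwise d by (intro nn_integral_mono) (simp flip: ennreal_mult ennreal_plus)
  also have "\<dots> = (\<integral>\<^sup>+x. ennreal (exp (- l * ?f x)) \<partial>law) + ennreal d * (\<integral>\<^sup>+x. ennreal ((?f x)^2) \<partial>law)"
    by (subst nn_integral_add) (auto simp: nn_integral_cmult)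
  also have "\<dots> \<le> (\<integral>\<^sup>+x. ennreal (exp (- l * ?f x)) \<partial>law) + ennreal d * ennreal (A^2)"
    using trunc_norm_second_moment[OF assms(1), of a] A by (intro add_left_mono mult_left_mono) auto
  finally show ?thesis using d by (auto simp: ennreal_mult ennreal_mult_eq_top_iff)
qed

lemma exp_moment_trunc_norm:
  assumes a: "\<And>i. i \<in> I \<Longrightarrow> \<bar>a i\<bar> \<le> 1" and s: "0 \<le> s" and l: "0 \<le> l" and A: "0 < A" "A = L2_set a I"
  shows "(\<integral>\<^sup>+x. ennreal (exp (l * (trunc_norm a s x - A))) \<partial>law) \<le> ennreal (exp (8 * l^2 * s^2))"
proof -
  let ?f = "trunc_norm a s"
  let ?X = "\<integral>\<^sup>+x. ennreal (exp (l * ?f x - 8 * l^2 * s^2)) \<partial>law"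
  have "(\<integral>\<^sup>+x. ennreal (exp (l * (?f x - A))) \<partial>law) =
      (\<integral>\<^sup>+x. ennreal (exp (8 * l^2 * s^2) * exp (- l * A)) * ennreal (exp (l * ?f x - 8 * l^2 * s^2)) \<partial>law)"
    by (intro nn_integral_cong) (simp add: algebra_simps flip: ennreal_mult exp_add)
  also have "\<dots> = ennreal (exp (8 * l^2 * s^2)) * (?X * ennreal (exp (- l * A)))"
    by (simp add: nn_integral_cmult ennreal_mult ac_simps)
  also have "?X * ennreal (exp (- l * A)) \<le> 1"
    using exp_trunc_norm_product_le_1[OF a s l] mult_left_mono[OF laplace_transform_trunc_norm_ge[OF s l A], of ?X]
    by (meson order_trans zero_le)
  finally show ?thesis by (simp add: mult_left_mono)
qed

text \<open>
  The level \<open>4 * ln n\<close> makes each of the \<open>n\<close> factors in \<open>exp_total_excess\<close> equal to \<open>1 + 1 / n\<close>, so that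
  their product stays below \<open>exp 1 \<le> 3\<close>.
\<close>

lemma total_excess_moment:
  assumes "0 < card I" "1 \<le> p"
  shows "(\<integral>\<^sup>+x. ennreal (total_excess (4 * ln (card I)) x powr p) \<partial>law) \<le> ennreal ((24 * p) powr p)"
proof -
  let ?n = "real (card I)" and ?R = "total_excess (4 * ln (card I))"
  have n: "1 \<le> ?n" using assms(1) by simp
  have "(\<integral>\<^sup>+x. ennreal (?R x powr p) \<partial>law) \<le> (\<integral>\<^sup>+x. ennreal ((8 * p) powr p) * ennreal (exp (?R x / 8)) \<partial>law)"
  proof (intro nn_integral_mono)
    fix x
    have "0 \<le> ?R x" by (simp add: total_excess_def sum_nonneg)
    then show "ennreal (?R x powr p) \<le> ennreal ((8 * p) powr p) * ennreal (exp (?R x / 8))"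
      using powr_le_exp[of p "1/8" "?R x"] assms(2) by (simp add: mult.commute flip: ennreal_mult)
  qed
  also have "\<dots> = ennreal ((8 * p) powr p) * (\<integral>\<^sup>+x. ennreal (exp (?R x / 8)) \<partial>law)"
    by (simp add: nn_integral_cmult)
  also have "\<dots> \<le> ennreal ((8 * p) powr p) * ennreal ((1 + exp (- (4 * ln ?n) / 4)) ^ card I)"
    using exp_total_excess[of "4 * ln ?n"] n by (intro mult_left_mono) (auto simp: total_excess_def)
  also have "\<dots> \<le> ennreal ((8 * p) powr p) * ennreal (3 powr p)"
  proof (intro mult_left_mono ennreal_leI)
    have "(1 + exp (- (4 * ln ?n) / 4)) ^ card I \<le> (exp (1 / ?n)) ^ card I"
      using n exp_ge_add_one_self[of "1 / ?n"] by (intro power_mono) (auto simp: exp_minus field_simps)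
    also have "\<dots> = exp 1" using assms(1) by (auto simp flip: exp_of_nat_mult)
    also have "\<dots> \<le> 3 powr 1" using exp_le by simp
    also have "\<dots> \<le> 3 powr p" using assms(2) by (intro powr_mono) auto
    finally show "(1 + exp (- (4 * ln ?n) / 4)) ^ card I \<le> 3 powr p" .
  qed simp
  also have "\<dots> = ennreal ((24 * p) powr p)"
    using assms(2) by (simp add: powr_mult[symmetric] flip: ennreal_mult)
  finally show ?thesis .
qed

lemma trunc_norm_deviation_moment:
  assumes a: "\<And>i. i \<in> I \<Longrightarrow> \<bar>a i\<bar> \<le> 1" and s: "0 < s" and p: "1 \<le> p" and A: "0 < A" "A = L2_set a I"
  shows "(\<integral>\<^sup>+x. ennreal (max 0 (trunc_norm a s x - A) powr p) \<partial>law) \<le> ennreal ((exp 9 * sqrt p * s) powr p)"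
proof -
  let ?f = "trunc_norm a s"
  \<comment> \<open>This choice balances the factor \<open>p / l\<close> against the sub-Gaussian bound \<open>exp (8 * l^2 * s^2) = exp (8 * p)\<close>.\<close>
  define l where "l = sqrt p / s"
  have "p = sqrt p * sqrt p" using p by simp
  then have l: "0 < l" "p / l = sqrt p * s" "l^2 * s^2 = p"
    using s p by (auto simp: l_def power_divide field_simps)
  have "(\<integral>\<^sup>+x. ennreal (max 0 (?f x - A) powr p) \<partial>law) \<le>
      (\<integral>\<^sup>+x. ennreal ((sqrt p * s) powr p) * (1 + ennreal (exp (l * (?f x - A)))) \<partial>law)"
  proof (intro nn_integral_mono)
    fix x
    have "max 0 (?f x - A) powr p \<le> (sqrt p * s) powr p * exp (l * max 0 (?f x - A))"
      using powr_le_exp[of p l "max 0 (?f x - A)"] l p by simp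
    also have "\<dots> \<le> (sqrt p * s) powr p * (1 + exp (l * (?f x - A)))"
      by (intro mult_left_mono) (auto simp: max_def)
    finally show "ennreal (max 0 (?f x - A) powr p) \<le> ennreal ((sqrt p * s) powr p) * (1 + ennreal (exp (l * (?f x - A))))"
      by (simp flip: ennreal_mult ennreal_plus ennreal_1)
  qed
  also have "\<dots> = ennreal ((sqrt p * s) powr p) * (1 + (\<integral>\<^sup>+x. ennreal (exp (l * (?f x - A))) \<partial>law))"
    by (simp add: nn_integral_cmult nn_integral_add law.emeasure_space_1[simplified])
  also have "\<dots> \<le> ennreal ((sqrt p * s) powr p) * (1 + ennreal (exp (8 * l^2 * s^2)))"
    using exp_moment_trunc_norm[OF a less_imp_le[OF s] less_imp_le[OF l(1)] A] by (intro mult_left_mono add_left_mono) auto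
  also have "\<dots> = ennreal ((sqrt p * s) powr p * (1 + exp (8 * p)))"
    using l(3) by (simp add: mult.assoc flip: ennreal_mult ennreal_plus ennreal_1)
  also have "\<dots> \<le> ennreal ((sqrt p * s) powr p * exp 9 powr p)"
  proof (intro ennreal_leI mult_left_mono)
    have "2 \<le> exp p" using exp_ge_add_one_self[of p] p by linarith
    then have "2 * exp (8 * p) \<le> exp p * exp (8 * p)" by (intro mult_right_mono) auto
    also have "\<dots> = exp 9 powr p" by (simp add: exp_powr_real mult.commute flip: exp_add)
    finally show "1 + exp (8 * p) \<le> exp 9 powr p" using p one_le_exp_iff[of "8 * p"] by linarith
  qed simp
  also have "(sqrt p * s) powr p * exp 9 powr p = (exp 9 * sqrt p * s) powr p"
    using p s by (simp add: powr_mult ac_simps)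
  finally show ?thesis .
qed

text \<open>
  The norm is at most \<open>A\<close>, plus the deviation of the truncated norm above \<open>A\<close>, plus the total excess. Minkowski's
  inequality keeps the coefficient 1 of \<open>A\<close>.
\<close>

theorem euclidean_norm_moment:
  assumes n: "2 \<le> card I" and a: "\<And>i. i \<in> I \<Longrightarrow> \<bar>a i\<bar> \<le> 1" and p: "1 \<le> p" and A: "0 < A" "A = L2_set a I"
  shows "(\<integral>\<^sup>+x. ennreal (L2_set (\<lambda>i. a i * x i) I powr p) \<partial>law)
    \<le> ennreal ((A + exp 9 * sqrt p * (4 * ln (card I)) + 24 * p) powr p)"
proof -
  define s where "s = 4 * ln (card I)"
  have s: "0 < s" using n by (simp add: s_def)
  let ?f = "trunc_norm a s" and ?R = "total_excess s"
  have pointwise: "L2_set (\<lambda>i. a i * x i) I \<le> (A + max 0 (?f x - A)) + ?R x" for x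
  proof -
    have "L2_set (\<lambda>i. a i * x i) I = L2_set (\<lambda>i. \<bar>a i * x i\<bar>) I" by (simp add: L2_set_def)
    also have "\<dots> \<le> L2_set (\<lambda>i. \<bar>a i * min \<bar>x i\<bar> s\<bar> + max 0 (\<bar>x i\<bar> - s)) I"
    proof (rule L2_set_mono)
      fix i assume i: "i \<in> I"
      have "\<bar>a i * x i\<bar> = \<bar>a i\<bar> * min \<bar>x i\<bar> s + \<bar>a i\<bar> * max 0 (\<bar>x i\<bar> - s)"
        by (simp add: abs_mult min_def max_def algebra_simps)
      also have "\<dots> \<le> \<bar>a i\<bar> * min \<bar>x i\<bar> s + 1 * max 0 (\<bar>x i\<bar> - s)"
        using a[OF i] by (intro add_left_mono mult_right_mono) auto
      finally show "\<bar>a i * x i\<bar> \<le> \<bar>a i * min \<bar>x i\<bar> s\<bar> + max 0 (\<bar>x i\<bar> - s)"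
        using s by (simp add: abs_mult)
    qed auto
    also have "\<dots> \<le> L2_set (\<lambda>i. \<bar>a i * min \<bar>x i\<bar> s\<bar>) I + L2_set (\<lambda>i. max 0 (\<bar>x i\<bar> - s)) I"
      by (rule L2_set_triangle_ineq)
    also have "L2_set (\<lambda>i. max 0 (\<bar>x i\<bar> - s)) I \<le> ?R x"
      unfolding total_excess_def by (rule L2_set_le_sum) auto
    also have "L2_set (\<lambda>i. \<bar>a i * min \<bar>x i\<bar> s\<bar>) I = ?f x" by (simp add: trunc_norm_def L2_set_def)
    finally show ?thesis by linarith
  qed
  have "(\<integral>\<^sup>+x. ennreal (L2_set (\<lambda>i. a i * x i) I powr p) \<partial>law) \<le> (\<integral>\<^sup>+x. ennreal (((A + max 0 (?f x - A)) + ?R x) powr p) \<partial>law)"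
    using pointwise p by (intro nn_integral_mono ennreal_leI powr_mono2) auto
  also have "\<dots> \<le> ennreal (((A + exp 9 * sqrt p * s) + 24 * p) powr p)"
  proof (rule nn_integral_powr_add_le[OF _ _ p])
    show "(\<integral>\<^sup>+x. ennreal ((A + max 0 (?f x - A)) powr p) \<partial>law) \<le> ennreal ((A + exp 9 * sqrt p * s) powr p)"
      using trunc_norm_deviation_moment[OF a s p A] s p A(1)
      by (intro nn_integral_powr_add_le[OF _ _ p]) (auto simp: law.emeasure_space_1[simplified])
    show "(\<integral>\<^sup>+x. ennreal (?R x powr p) \<partial>law) \<le> ennreal ((24 * p) powr p)"
      unfolding s_def using n p by (intro total_excess_moment) auto
    show "0 < A + exp 9 * sqrt p * s" using A(1) s p by (intro add_pos_pos mult_pos_pos) auto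
  qed (use A(1) p in \<open>auto simp: total_excess_def sum_nonneg\<close>)
  finally show ?thesis by (simp add: s_def)
qed

theorem shifted_excess_moment:
  assumes n: "2 \<le> card I" and p: "1 \<le> p"
  shows "(\<integral>\<^sup>+x. ennreal ((4 * ln (card I) + total_excess (4 * ln (card I)) x) powr p) \<partial>law)
    \<le> ennreal ((4 * ln (card I) + 24 * p) powr p)"
  using total_excess_moment[of p] n p
  by (intro nn_integral_powr_add_le[OF _ _ p])
     (auto simp: total_excess_def sum_nonneg law.emeasure_space_1[simplified])

end

section \<open>Gaussian averages and sign averages\<close>

text \<open>
  The mean of \<open>\<phi>\<close> at \<open>s\<close> plus a sum of the entries of the list with independent uniform signs.
\<close>

primrec rademacher_mean :: "(real \<Rightarrow> real) \<Rightarrow> real list \<Rightarrow> real \<Rightarrow> real" where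
  "rademacher_mean \<phi> [] s = \<phi> s"
| "rademacher_mean \<phi> (b # bs) s = (rademacher_mean \<phi> bs (s + b) + rademacher_mean \<phi> bs (s - b)) / 2"

abbreviation sum_squares :: "real list \<Rightarrow> real" where
  "sum_squares bs \<equiv> (\<Sum>b\<leftarrow>bs. b^2)"

lemma rademacher_mean_nonneg: "(\<And>x. 0 \<le> \<phi> x) \<Longrightarrow> 0 \<le> rademacher_mean \<phi> bs s"
  by (induction bs arbitrary: s) auto

lemma sum_squares_nonneg: "0 \<le> sum_squares bs"
  by (induction bs) auto

abbreviation standard_gaussian :: "real measure" ("\<gamma>") where
  "\<gamma> \<equiv> std_normal_distribution"

interpretation std_normal: real_distribution \<gamma>
  by (rule real_dist_normal_dist)

lemma emeasure_std_normal_UNIV [simp]: "emeasure \<gamma> UNIV = 1"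
  using std_normal.emeasure_space_1 by simp

lemma nn_integral_std_normal:
  "f \<in> borel_measurable borel \<Longrightarrow>
    (\<integral>\<^sup>+g. f g \<partial>\<gamma>) = (\<integral>\<^sup>+g. ennreal (std_normal_density g) * f g \<partial>lborel)"
  by (simp add: nn_integral_density)

lemma nn_integral_std_normal_scaled:
  assumes [measurable]: "f \<in> borel_measurable borel" and "0 < \<sigma>"
  shows "(\<integral>\<^sup>+g. f (\<sigma> * g) \<partial>\<gamma>) = (\<integral>\<^sup>+x. ennreal (normal_density 0 \<sigma> x) * f x \<partial>lborel)"
proof -
  have d: "normal_density 0 \<sigma> (\<sigma> * g) = std_normal_density g / \<sigma>" for g
    using \<open>0 < \<sigma>\<close> by (simp add: normal_density_def power_mult_distrib real_sqrt_mult)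
  have "(\<integral>\<^sup>+x. ennreal (normal_density 0 \<sigma> x) * f x \<partial>lborel) =
      ennreal \<sigma> * (\<integral>\<^sup>+g. ennreal (normal_density 0 \<sigma> (\<sigma> * g)) * f (\<sigma> * g) \<partial>lborel)"
    using \<open>0 < \<sigma>\<close> by (subst nn_integral_real_affine[where c=\<sigma> and t=0]) auto
  also have "\<dots> = (\<integral>\<^sup>+g. ennreal \<sigma> * (ennreal (normal_density 0 \<sigma> (\<sigma> * g)) * f (\<sigma> * g)) \<partial>lborel)"
    by (rule nn_integral_cmult[symmetric]) measurable
  also have "\<dots> = (\<integral>\<^sup>+g. ennreal (std_normal_density g) * f (\<sigma> * g) \<partial>lborel)"
    using \<open>0 < \<sigma>\<close> unfolding d
    by (intro nn_integral_cong) (simp add: mult.assoc[symmetric] flip: ennreal_mult)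
  finally show ?thesis by (simp add: nn_integral_std_normal)
qed

lemma nn_integral_std_normal_flip:
  assumes [measurable]: "f \<in> borel_measurable borel"
  shows "(\<integral>\<^sup>+g. f (- g) \<partial>\<gamma>) = (\<integral>\<^sup>+g. f g \<partial>\<gamma>)"
  by (simp add: nn_integral_std_normal, subst (2) nn_integral_real_affine[where c="-1" and t=0])
     (auto simp: normal_density_def)

lemma std_normal_convolution:
  assumes f[measurable]: "f \<in> borel_measurable borel" and "0 \<le> \<sigma>" "0 \<le> \<tau>"
  shows "(\<integral>\<^sup>+g. (\<integral>\<^sup>+h. f (\<sigma> * g + \<tau> * h) \<partial>\<gamma>) \<partial>\<gamma>)
    = (\<integral>\<^sup>+g. f (sqrt (\<sigma>^2 + \<tau>^2) * g) \<partial>\<gamma>)"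
proof (cases "\<sigma> = 0 \<or> \<tau> = 0")
  case True
  then show ?thesis using assms by auto
next
  case False
  with assms have pos: "0 < \<sigma>" "0 < \<tau>" "0 < sqrt (\<sigma>^2 + \<tau>^2)" by (auto simp: add_pos_pos)
  let ?n = "\<lambda>\<sigma> x. ennreal (normal_density 0 \<sigma> x)"
  have "(\<integral>\<^sup>+g. (\<integral>\<^sup>+h. f (\<sigma> * g + \<tau> * h) \<partial>\<gamma>) \<partial>\<gamma>) =
      (\<integral>\<^sup>+g. (\<integral>\<^sup>+y. ?n \<tau> y * f (\<sigma> * g + y) \<partial>lborel) \<partial>\<gamma>)"
    using nn_integral_std_normal_scaled[OF _ pos(2), of "\<lambda>y. f (_ + y)"] by simp
  also have "\<dots> = (\<integral>\<^sup>+x. ?n \<sigma> x * (\<integral>\<^sup>+y. ?n \<tau> y * f (x + y) \<partial>lborel) \<partial>lborel)"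
    by (rule nn_integral_std_normal_scaled[OF _ pos(1), of "\<lambda>x. \<integral>\<^sup>+y. ?n \<tau> y * f (x + y) \<partial>lborel"]) measurable
  also have "\<dots> = (\<integral>\<^sup>+x. \<integral>\<^sup>+z. ?n \<sigma> x * (?n \<tau> (z - x) * f z) \<partial>lborel \<partial>lborel)"
  proof (intro nn_integral_cong)
    fix x
    have "(\<integral>\<^sup>+y. ?n \<tau> y * f (x + y) \<partial>lborel) = (\<integral>\<^sup>+z. ?n \<tau> (z - x) * f z \<partial>lborel)"
      by (subst nn_integral_real_affine[where c=1 and t="-x"]) (auto simp: algebra_simps)
    then show "?n \<sigma> x * (\<integral>\<^sup>+y. ?n \<tau> y * f (x + y) \<partial>lborel) = (\<integral>\<^sup>+z. ?n \<sigma> x * (?n \<tau> (z - x) * f z) \<partial>lborel)"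
      by (simp add: nn_integral_cmult)
  qed
  also have "\<dots> = (\<integral>\<^sup>+z. \<integral>\<^sup>+x. ?n \<sigma> x * (?n \<tau> (z - x) * f z) \<partial>lborel \<partial>lborel)"
    by (rule lborel_pair.Fubini') measurable
  also have "\<dots> = (\<integral>\<^sup>+z. ?n (sqrt (\<sigma>^2 + \<tau>^2)) z * f z \<partial>lborel)"
  proof (intro nn_integral_cong)
    fix z
    have "(\<integral>\<^sup>+x. ?n \<sigma> x * (?n \<tau> (z - x) * f z) \<partial>lborel) =
        (\<integral>\<^sup>+x. ennreal (normal_density 0 \<tau> (z - x) * normal_density 0 \<sigma> x) * f z \<partial>lborel)"
      by (intro nn_integral_cong) (simp add: ennreal_mult ac_simps)
    also have "\<dots> = (\<integral>\<^sup>+x. ennreal (normal_density 0 \<tau> (z - x) * normal_density 0 \<sigma> x) \<partial>lborel) * f z"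
      by (rule nn_integral_multc) measurable
    also have "(\<integral>\<^sup>+x. ennreal (normal_density 0 \<tau> (z - x) * normal_density 0 \<sigma> x) \<partial>lborel) = ?n (sqrt (\<sigma>^2 + \<tau>^2)) z"
      using fun_cong[OF conv_normal_density_zero_mean[OF pos(2,1)], of z] by (simp add: add.commute)
    finally show "(\<integral>\<^sup>+x. ?n \<sigma> x * (?n \<tau> (z - x) * f z) \<partial>lborel) = ?n (sqrt (\<sigma>^2 + \<tau>^2)) z * f z" .
  qed
  also have "\<dots> = (\<integral>\<^sup>+g. f (sqrt (\<sigma>^2 + \<tau>^2) * g) \<partial>\<gamma>)"
    by (rule nn_integral_std_normal_scaled[OF f pos(3), symmetric])
  finally show ?thesis .
qed

lemma nn_integral_std_normal_square: "(\<integral>\<^sup>+g. ennreal (g^2) \<partial>\<gamma>) = 1"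
proof -
  have "integrable \<gamma> (\<lambda>g. g^2)"
    using integrable_std_normal_moment[of 2] by (subst integrable_density) auto
  then have "(\<integral>\<^sup>+g. ennreal (g^2) \<partial>\<gamma>) = ennreal (\<integral>g. g^2 \<partial>\<gamma>)"
    by (rule nn_integral_eq_integral) simp
  also have "(\<integral>g. g^2 \<partial>\<gamma>) = 1"
    using std_normal_distribution_even_moments(1)[of 1] by simp
  finally show ?thesis by simp
qed

section \<open>Comparison of signs with Gaussians for exponents at least 3\<close>

lemma symmetric_abs_powr_mono:
  fixes m s r t :: real
  assumes "1 \<le> m" "0 \<le> r" "r \<le> t"
  shows "\<bar>s + r\<bar> powr m + \<bar>s - r\<bar> powr m \<le> \<bar>s + t\<bar> powr m + \<bar>s - t\<bar> powr m"
proof (cases "r = t")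
  case False
  then have t: "0 < t" using assms by simp
  define \<theta> where "\<theta> = (1 + r / t) / 2"
  have rt: "0 \<le> r / t" "r / t < 1" using t assms False by auto
  have \<theta>: "0 < \<theta>" "\<theta> < 1" using rt by (auto simp: \<theta>_def)
  have r: "r = (2 * \<theta> - 1) * t" using t by (simp add: \<theta>_def field_simps)
  have conv: "\<bar>\<theta> * u + (1 - \<theta>) * v\<bar> powr m \<le> \<theta> * \<bar>u\<bar> powr m + (1 - \<theta>) * \<bar>v\<bar> powr m" for u v
  proof -
    have "\<bar>\<theta> * u + (1 - \<theta>) * v\<bar> \<le> \<theta> * \<bar>u\<bar> + (1 - \<theta>) * \<bar>v\<bar>"
      using abs_triangle_ineq[of "\<theta> * u" "(1 - \<theta>) * v"] \<theta> by (simp add: abs_mult)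
    then have "\<bar>\<theta> * u + (1 - \<theta>) * v\<bar> powr m \<le> (\<theta> * \<bar>u\<bar> + (1 - \<theta>) * \<bar>v\<bar>) powr m"
      using assms(1) by (intro powr_mono2) auto
    also have "\<dots> \<le> \<theta> * \<bar>u\<bar> powr m + (1 - \<theta>) * \<bar>v\<bar> powr m"
      using assms(1) \<theta> by (intro powr_convex_combination) auto
    finally show ?thesis .
  qed
  have comb: "s + r = \<theta> * (s + t) + (1 - \<theta>) * (s - t)" "s - r = \<theta> * (s - t) + (1 - \<theta>) * (s + t)"
    by (simp_all add: r algebra_simps)
  have "\<bar>s + r\<bar> powr m \<le> \<theta> * \<bar>s + t\<bar> powr m + (1 - \<theta>) * \<bar>s - t\<bar> powr m"
    unfolding comb(1) by (rule conv)
  moreover have "\<bar>s - r\<bar> powr m \<le> \<theta> * \<bar>s - t\<bar> powr m + (1 - \<theta>) * \<bar>s + t\<bar> powr m"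
    unfolding comb(2) by (rule conv)
  ultimately show ?thesis by (simp add: left_diff_distrib)
qed simp

text \<open>
  For \<open>p \<ge> 3\<close> the function \<open>D\<close> is convex as a function of \<open>r^2\<close>: its derivative \<open>Q\<close> in \<open>r\<close> vanishes at 0 and
  has the increasing derivative \<open>q\<close>, so \<open>Q r / r\<close> is increasing. The parabola touches \<open>D\<close> at \<open>b\<close>.
\<close>

lemma supporting_parabola:
  fixes p s b :: real
  assumes p: "3 \<le> p" and b: "0 < b"
  defines "D \<equiv> \<lambda>r. (\<bar>s + r\<bar> powr p + \<bar>s - r\<bar> powr p) / 2"
  obtains c where "0 \<le> c" "\<And>r. 0 \<le> r \<Longrightarrow> D b + c * (r^2 - b^2) \<le> D r"
proof -
  define \<phi> where "\<phi> x = sgn x * \<bar>x\<bar> powr (p - 1)" for x :: real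
  define Q where "Q r = p * (\<phi> (s + r) - \<phi> (s - r)) / 2" for r
  define q where "q r = p * (p - 1) * (\<bar>s + r\<bar> powr (p - 2) + \<bar>s - r\<bar> powr (p - 2)) / 2" for r
  have shift: "((\<lambda>r. f (s + r)) has_real_derivative f' (s + r)) (at r)"
      "((\<lambda>r. f (s - r)) has_real_derivative - f' (s - r)) (at r)"
    if "\<And>x. (f has_real_derivative f' x) (at x)" for f f' :: "real \<Rightarrow> real" and r
  proof -
    have 1: "((\<lambda>r. s + r) has_real_derivative 1) (at r)" by (auto intro!: derivative_eq_intros)
    have 2: "((\<lambda>r. s - r) has_real_derivative - 1) (at r)" by (auto intro!: derivative_eq_intros)
    show "((\<lambda>r. f (s + r)) has_real_derivative f' (s + r)) (at r)"
      using DERIV_chain2[OF that 1] by simp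
    show "((\<lambda>r. f (s - r)) has_real_derivative - f' (s - r)) (at r)"
      using DERIV_chain2[OF that 2] by simp
  qed
  have d1: "((\<lambda>x. \<bar>x\<bar> powr p) has_real_derivative p * \<phi> x) (at x)" for x
    using DERIV_abs_powr(1)[of p x] p by (simp add: \<phi>_def)
  have d2: "(\<phi> has_real_derivative (p - 1) * \<bar>x\<bar> powr (p - 2)) (at x)" for x
    using DERIV_abs_powr(2)[of "p - 1" x] p by (simp add: \<phi>_def[abs_def])
  have DD: "(D has_real_derivative Q r) (at r)" for r
    unfolding D_def Q_def using DERIV_cdivide[OF DERIV_add[OF shift(1)[OF d1] shift(2)[OF d1]], where c=2]
    by (simp add: right_diff_distrib)
  have DQ: "(Q has_real_derivative q r) (at r)" for r
    unfolding Q_def q_def using DERIV_cdivide[OF DERIV_cmult[OF DERIV_diff[OF shift(1)[OF d2] shift(2)[OF d2]], where c=p], where c=2]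
    by (simp add: algebra_simps)
  have q_mono: "q r \<le> q t" if "0 \<le> r" "r \<le> t" for r t
    unfolding q_def using symmetric_abs_powr_mono[of "p - 2" r t s] that p
    by (intro divide_right_mono mult_left_mono) auto
  have Q0: "Q 0 = 0" by (simp add: Q_def)
  have slope: "t * Q r \<le> r * Q t" if rt: "0 \<le> r" "r \<le> t" for r t
  proof -
    consider "r = 0" | "r = t" | "0 < r" "r < t" using rt by linarith
    then show ?thesis
    proof cases
      case 3
      obtain \<xi> where \<xi>: "0 < \<xi>" "\<xi> < r" "Q r - Q 0 = (r - 0) * q \<xi>"
        using MVT2[of 0 r Q q] DQ 3 by auto
      obtain \<zeta> where \<zeta>: "r < \<zeta>" "\<zeta> < t" "Q t - Q r = (t - r) * q \<zeta>"
        using MVT2[of r t Q q] DQ 3 by auto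
      have "q \<xi> \<le> q \<zeta>" using \<xi> \<zeta> by (intro q_mono) auto
      then have "r * ((t - r) * q \<xi>) \<le> r * ((t - r) * q \<zeta>)" using 3 by (intro mult_left_mono) auto
      moreover have "t * Q r = r * Q r + r * ((t - r) * q \<xi>)" using \<xi>(3) Q0 by (simp add: algebra_simps)
      moreover have "r * Q t = r * Q r + r * ((t - r) * q \<zeta>)"
        unfolding distrib_left[symmetric] using \<zeta>(3) by simp
      ultimately show ?thesis by simp
    qed (auto simp: Q0)
  qed
  define c where "c = Q b / (2 * b)"
  define E where "E r = D r - c * r^2" for r
  have DE: "(E has_real_derivative Q r - 2 * c * r) (at r)" for r
    unfolding E_def by (auto intro!: derivative_eq_intros DD)
  have cb: "b * (Q x - 2 * c * x) = b * Q x - x * Q b" for x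
    using b by (simp add: c_def right_diff_distrib)
  have "E b \<le> E r" if r: "0 \<le> r" for r
  proof (cases "r \<le> b")
    case True
    show ?thesis
    proof (rule DERIV_nonpos_imp_nonincreasing[OF True])
      fix x assume x: "r \<le> x" "x \<le> b"
      have "b * (Q x - 2 * c * x) \<le> 0" unfolding cb using slope[of x b] x r by simp
      then have "Q x - 2 * c * x \<le> 0" using b by (simp add: mult_le_0_iff)
      then show "\<exists>y. (E has_real_derivative y) (at x) \<and> y \<le> 0" using DE by blast
    qed
  next
    case False
    then have "b \<le> r" by simp
    then show ?thesis
    proof (rule DERIV_nonneg_imp_nondecreasing)
      fix x assume x: "b \<le> x" "x \<le> r"
      have "0 \<le> b * (Q x - 2 * c * x)" unfolding cb using slope[of b x] x b by simp
      then have "0 \<le> Q x - 2 * c * x" using b by (simp add: zero_le_mult_iff)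
      then show "\<exists>y. (E has_real_derivative y) (at x) \<and> 0 \<le> y" using DE by blast
    qed
  qed
  then have "D b + c * (r^2 - b^2) \<le> D r" if "0 \<le> r" for r
    using that by (simp add: E_def algebra_simps)
  moreover have "0 \<le> c"
  proof -
    have "0 \<le> q x" for x using p by (simp add: q_def)
    then have "Q 0 \<le> Q b"
      using b by (intro DERIV_nonneg_imp_nondecreasing[of 0 b Q]) (auto intro: DQ)
    then show ?thesis using b by (simp add: c_def Q0)
  qed
  ultimately show ?thesis using that by blast
qed

lemma ennreal_half_sum:
  assumes "0 \<le> x" "0 \<le> y"
  shows "ennreal ((x + y) / 2) = ennreal (1 / 2) * (ennreal x + ennreal y)"
proof -
  have "ennreal (1 / 2) * (ennreal x + ennreal y) = ennreal (1 / 2) * ennreal (x + y)"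
    using assms by simp
  also have "\<dots> = ennreal (1 / 2 * (x + y))" by (rule ennreal_mult[symmetric]) (use assms in auto)
  finally show ?thesis by simp
qed

text \<open>
  Average the supporting parabola over \<open>r = b * \<bar>g\<bar>\<close> with a standard Gaussian \<open>g\<close>. Its non-constant part has mean 0,
  because \<open>g\<close> has the same variance as a sign.
\<close>

lemma sign_average_le_gaussian_average:
  fixes p s b :: real
  assumes p: "3 \<le> p" and b: "0 \<le> b"
  shows "ennreal ((\<bar>s + b\<bar> powr p + \<bar>s - b\<bar> powr p) / 2) \<le> (\<integral>\<^sup>+g. ennreal (\<bar>s + b * g\<bar> powr p) \<partial>\<gamma>)"
proof (cases "b = 0")
  case False
  with b have b: "0 < b" by simp
  let ?N = \<gamma>
  define D where "D r = (\<bar>s + r\<bar> powr p + \<bar>s - r\<bar> powr p) / 2" for r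
  let ?X = "\<integral>\<^sup>+g. ennreal (\<bar>s + b * g\<bar> powr p) \<partial>?N"
  obtain c where c: "0 \<le> c" "\<And>r. 0 \<le> r \<Longrightarrow> D b + c * (r^2 - b^2) \<le> D r"
    unfolding D_def using supporting_parabola[OF p b, of s] by blast
  have D0: "0 \<le> D r" for r by (simp add: D_def)
  have [measurable]: "D \<in> borel_measurable borel" unfolding D_def by measurable
  have pointwise: "D b + c * b^2 * g^2 \<le> D (b * g) + c * b^2" for g
  proof -
    have "D (b * \<bar>g\<bar>) = D (b * g)" by (cases "0 \<le> g") (auto simp: D_def)
    then show ?thesis using c(2)[of "b * \<bar>g\<bar>"] b by (simp add: power_mult_distrib right_diff_distrib)
  qed
  have flip: "(\<integral>\<^sup>+g. ennreal (\<bar>s - b * g\<bar> powr p) \<partial>?N) = ?X"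
    using nn_integral_std_normal_flip[of "\<lambda>g. ennreal (\<bar>s + b * g\<bar> powr p)"] by simp
  have avg: "(\<integral>\<^sup>+g. ennreal (D (b * g)) \<partial>?N) = ?X"
  proof -
    have "(\<integral>\<^sup>+g. ennreal (D (b * g)) \<partial>?N) =
      (\<integral>\<^sup>+g. ennreal (1/2) * ennreal (\<bar>s + b * g\<bar> powr p) + ennreal (1/2) * ennreal (\<bar>s - b * g\<bar> powr p) \<partial>?N)"
      unfolding D_def by (intro nn_integral_cong) (simp only: ennreal_half_sum powr_ge_zero distrib_left)
    also have "\<dots> = ennreal (1/2) * ?X + ennreal (1/2) * ?X"
      by (subst nn_integral_add) (simp_all add: nn_integral_cmult flip)
    also have "\<dots> = ?X"
    proof -
      have "ennreal (1/2) + ennreal (1/2) = 1" by (subst ennreal_plus[symmetric]) auto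
      then show ?thesis by (simp only: distrib_right[symmetric] mult_1)
    qed
    finally show ?thesis .
  qed
  have "ennreal (D b) + ennreal (c * b^2) = (\<integral>\<^sup>+g. ennreal (D b) + ennreal (c * b^2) * ennreal (g^2) \<partial>?N)"
    by (subst nn_integral_add) (simp_all add: nn_integral_cmult nn_integral_std_normal_square)
  also have "\<dots> \<le> (\<integral>\<^sup>+g. ennreal (D (b * g)) + ennreal (c * b^2) \<partial>?N)"
    using pointwise c(1) D0 by (intro nn_integral_mono) (simp flip: ennreal_mult ennreal_plus)
  also have "\<dots> = ?X + ennreal (c * b^2)"
    by (subst nn_integral_add) (simp_all add: avg)
  finally show ?thesis by (auto simp: D_def add.commute[of _ "ennreal (c * b^2)"])
qed simp

text \<open>
  Signs are exchanged for Gaussians one at a time, and independent Gaussians merge into a single one.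
\<close>

theorem khinchine_ge_3:
  fixes p s :: real
  assumes p: "3 \<le> p"
  shows "ennreal (rademacher_mean (\<lambda>x. \<bar>x\<bar> powr p) bs s) \<le>
    (\<integral>\<^sup>+g. ennreal (\<bar>s + sqrt (sum_squares bs) * g\<bar> powr p) \<partial>\<gamma>)"
proof (induction bs arbitrary: s)
  case Nil
  then show ?case by simp
next
  case (Cons b bs)
  let ?N = \<gamma> and ?\<sigma> = "sqrt (sum_squares bs)"
  let ?r = "rademacher_mean (\<lambda>x. \<bar>x\<bar> powr p) bs"
  have r0: "0 \<le> ?r t" for t by (rule rademacher_mean_nonneg) simp
  have "ennreal (rademacher_mean (\<lambda>x. \<bar>x\<bar> powr p) (b # bs) s) = ennreal (1/2) * (ennreal (?r (s + b)) + ennreal (?r (s - b)))"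
    using r0 by (simp only: rademacher_mean.simps ennreal_half_sum)
  also have "\<dots> \<le> ennreal (1/2) * ((\<integral>\<^sup>+g. ennreal (\<bar>(s + b) + ?\<sigma> * g\<bar> powr p) \<partial>?N) + (\<integral>\<^sup>+g. ennreal (\<bar>(s - b) + ?\<sigma> * g\<bar> powr p) \<partial>?N))"
    by (intro mult_left_mono add_mono Cons.IH) simp
  also have "\<dots> = (\<integral>\<^sup>+g. ennreal (1/2) * (ennreal (\<bar>(s + b) + ?\<sigma> * g\<bar> powr p) + ennreal (\<bar>(s - b) + ?\<sigma> * g\<bar> powr p)) \<partial>?N)"
    by (subst nn_integral_cmult) (auto simp: nn_integral_add)
  also have "\<dots> = (\<integral>\<^sup>+g. ennreal ((\<bar>(s + ?\<sigma> * g) + \<bar>b\<bar>\<bar> powr p + \<bar>(s + ?\<sigma> * g) - \<bar>b\<bar>\<bar> powr p) / 2) \<partial>?N)"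
    by (intro nn_integral_cong) (cases "0 \<le> b"; simp only: ennreal_half_sum powr_ge_zero abs_if; simp add: algebra_simps)
  also have "\<dots> \<le> (\<integral>\<^sup>+g. (\<integral>\<^sup>+h. ennreal (\<bar>(s + ?\<sigma> * g) + \<bar>b\<bar> * h\<bar> powr p) \<partial>?N) \<partial>?N)"
    by (intro nn_integral_mono sign_average_le_gaussian_average p) simp
  also have "\<dots> = (\<integral>\<^sup>+g. ennreal (\<bar>s + sqrt (?\<sigma>^2 + \<bar>b\<bar>^2) * g\<bar> powr p) \<partial>?N)"
    using std_normal_convolution[of "\<lambda>x. ennreal (\<bar>s + x\<bar> powr p)" ?\<sigma> "\<bar>b\<bar>"] sum_squares_nonneg[of bs]
    by (simp add: add.assoc)
  also have "?\<sigma>^2 + \<bar>b\<bar>^2 = sum_squares (b # bs)"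
    using sum_squares_nonneg[of bs] by simp
  finally show ?case .
qed

section \<open>The remaining exponents by Fourier analysis\<close>

text \<open>
  The Taylor remainder of the cosine. Up to a constant, its integral over \<open>t > 0\<close> at \<open>t * x\<close> with the weight
  \<open>t powr (- p - 1)\<close> is \<open>\<bar>x\<bar> powr p\<close>, for \<open>2 < p < 4\<close>.
\<close>

definition cos_excess :: "real \<Rightarrow> real" where
  "cos_excess u = cos u - 1 + u^2 / 2"

lemma cos_excess_measurable [measurable]: "cos_excess \<in> borel_measurable borel"
  unfolding cos_excess_def by measurable

lemma cos_excess_nonneg [simp]: "0 \<le> cos_excess u"
proof -
  have "\<bar>sin (u/2)\<bar>^2 \<le> \<bar>u/2\<bar>^2" by (intro power_mono abs_sin_x_le_abs_x) auto
  moreover have "cos u = 1 - 2 * (sin (u/2))^2" using cos_double_sin[of "u/2"] by simp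
  ultimately show ?thesis by (simp add: cos_excess_def power_divide)
qed

lemma cos_excess_le_square: "cos_excess u \<le> u^2 / 2"
  by (simp add: cos_excess_def)

lemma cos_excess_le_fourth: "cos_excess u \<le> u^4"
proof -
  obtain t where "cos u = (\<Sum>m<4. cos_coeff m * u ^ m) + (cos (t + 1/2 * real 4 * pi) / fact 4) * u ^ 4"
    using Maclaurin_cos_expansion[of u 4] by auto
  moreover have "(\<Sum>m<4. cos_coeff m * u ^ m) = 1 - (u^2) / 2"
  proof -
    have "{..<4::nat} = {0, 1, 2, 3}" by auto
    then show ?thesis by (simp add: cos_coeff_def fact_numeral)
  qed
  ultimately have "cos_excess u = (cos (t + 1/2 * real 4 * pi) / fact 4) * u ^ 4"
    by (simp add: cos_excess_def)
  also have "cos (t + 1/2 * real 4 * pi) / fact 4 \<le> 1"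
    by (simp add: fact_numeral) (use cos_le_one[of t] in linarith)
  then have "(cos (t + 1/2 * real 4 * pi) / fact 4) * u ^ 4 \<le> 1 * u^4" by (rule mult_right_mono) simp
  finally show ?thesis by simp
qed

lemma cos_1_gt_half: "1 / 2 < cos (1::real)"
proof -
  have "cos (pi / 3) < cos (1::real)"
    using pi_gt3 by (intro cos_monotone_0_pi) auto
  then show ?thesis by (simp add: cos_60)
qed

lemma cos_excess_ge:
  assumes "1 \<le> u"
  shows "cos 1 - 1 / 2 \<le> cos_excess u"
proof -
  have "cos_excess 1 \<le> cos_excess u"
  proof (rule DERIV_nonneg_imp_nondecreasing[OF assms])
    fix x :: real assume "1 \<le> x"
    then have "0 \<le> x - sin x" using sin_x_le_x[of x] by simp
    moreover have "(cos_excess has_real_derivative x - sin x) (at x)"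
      unfolding cos_excess_def[abs_def] by (auto intro!: derivative_eq_intros)
    ultimately show "\<exists>y. (cos_excess has_real_derivative y) (at x) \<and> 0 \<le> y" by blast
  qed
  then show ?thesis by (simp add: cos_excess_def)
qed

lemma cos_le_gaussian:
  fixes u :: real
  assumes "\<bar>u\<bar> \<le> 1"
  shows "cos u \<le> exp (- (u^2) / 2)"
proof -
  have *: "cos u \<le> exp (- (u^2) / 2)" if "0 \<le> u" "u \<le> 1" for u :: real
  proof -
    have neg: "x * cos x - sin x \<le> 0" if "0 \<le> x" "x \<le> 1" for x :: real
    proof -
      have "x * cos x - sin x \<le> 0 * cos 0 - sin 0"
      proof (rule DERIV_nonpos_imp_nonincreasing[OF that(1)])
        fix y :: real assume y: "0 \<le> y" "y \<le> x"
        have "0 \<le> sin y" using y that pi_gt3 by (intro sin_ge_zero) auto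
        moreover have "((\<lambda>x. x * cos x - sin x) has_real_derivative - (y * sin y)) (at y)"
          by (auto intro!: derivative_eq_intros)
        ultimately show "\<exists>d. ((\<lambda>x. x * cos x - sin x) has_real_derivative d) (at y) \<and> d \<le> 0"
          using y by (intro exI[of _ "- (y * sin y)"]) simp
      qed
      then show ?thesis by simp
    qed
    have "cos u * exp (u^2 / 2) \<le> cos 0 * exp (0^2 / 2)"
    proof (rule DERIV_nonpos_imp_nonincreasing[OF that(1)])
      fix x assume x: "0 \<le> x" "x \<le> u"
      have "((\<lambda>u. cos u * exp (u^2 / 2)) has_real_derivative (x * cos x - sin x) * exp (x^2 / 2)) (at x)"
        by (auto intro!: derivative_eq_intros simp: algebra_simps)
      moreover have "(x * cos x - sin x) * exp (x^2 / 2) \<le> 0"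
        using neg[of x] x that(2) by (simp add: mult_le_0_iff)
      ultimately show "\<exists>d. ((\<lambda>u. cos u * exp (u^2 / 2)) has_real_derivative d) (at x) \<and> d \<le> 0" by blast
    qed
    then have "cos u * exp (u^2 / 2) * exp (- (u^2) / 2) \<le> 1 * exp (- (u^2) / 2)"
      by (intro mult_right_mono) auto
    then show ?thesis by (simp add: mult.assoc flip: exp_add)
  qed
  show ?thesis using *[of "\<bar>u\<bar>"] assms by simp
qed

lemma rademacher_mean_cos_excess:
  "rademacher_mean (\<lambda>x. cos_excess (t * x)) bs s =
    cos (t * s) * (\<Prod>b\<leftarrow>bs. cos (t * b)) - 1 + t^2 * (s^2 + sum_squares bs) / 2"
proof (induction bs arbitrary: s)
  case Nil
  then show ?case by (simp add: cos_excess_def power_mult_distrib)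
next
  case (Cons b bs)
  have c: "cos (t * (s + b)) + cos (t * (s - b)) = 2 * (cos (t * s) * cos (t * b))"
    by (simp add: distrib_left right_diff_distrib cos_add cos_diff)
  have q: "(s + b)^2 + (s - b)^2 = 2 * (s^2 + b^2)" by (simp add: power2_eq_square algebra_simps)
  have "rademacher_mean (\<lambda>x. cos_excess (t * x)) (b # bs) s =
      (cos (t * (s + b)) + cos (t * (s - b))) * (\<Prod>b\<leftarrow>bs. cos (t * b)) / 2 - 1
      + t^2 * (((s + b)^2 + (s - b)^2) / 2 + sum_squares bs) / 2"
  proof -
    have "((X * P - 1 + T * (a + S) / 2) + (Y * P - 1 + T * (b + S) / 2)) / 2 = (X + Y) * P / 2 - 1 + T * ((a + b) / 2 + S) / 2"
      for X Y P T a b S :: real by (simp add: field_simps)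
    then show ?thesis by (simp only: rademacher_mean.simps Cons.IH)
  qed
  also have "\<dots> = cos (t * s) * (\<Prod>b\<leftarrow>b # bs. cos (t * b)) - 1 + t^2 * (s^2 + sum_squares (b # bs)) / 2"
    unfolding c q by (simp add: field_simps)
  finally show ?case .
qed

lemma gaussian_mean_cos_excess:
  "(\<integral>\<^sup>+g. ennreal (cos_excess (a * g)) \<partial>\<gamma>) = ennreal (exp (- (a^2) / 2) - 1 + a^2 / 2)"
proof -
  let ?N = \<gamma>
  have iexp: "complex_integrable ?N (\<lambda>g. iexp (a * g))"
    by (rule std_normal.integrable_iexp) auto
  have int_cos: "integrable ?N (\<lambda>g. cos (a * g))"
    using integrable_Re[OF iexp] by (simp add: Re_exp)
  have "(\<integral>g. cos (a * g) \<partial>?N) = Re (char ?N a)"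
    unfolding char_def using integral_Re[OF iexp] by (simp add: Re_exp)
  then have cos: "(\<integral>g. cos (a * g) \<partial>?N) = exp (- (a^2) / 2)"
    by (simp add: char_std_normal_distribution)
  have int_sq: "integrable ?N (\<lambda>g. g^2)"
    using integrable_std_normal_moment[of 2] by (subst integrable_density) auto
  have sq: "(\<integral>g. g^2 \<partial>?N) = 1"
    using std_normal_distribution_even_moments(1)[of 1] by simp
  have form: "cos_excess (a * g) = cos (a * g) - 1 + a^2 / 2 * g^2" for g
    by (simp add: cos_excess_def power_mult_distrib)
  have "(\<integral>\<^sup>+g. ennreal (cos_excess (a * g)) \<partial>?N) = ennreal (\<integral>g. cos_excess (a * g) \<partial>?N)"
    unfolding form using int_cos int_sq cos_excess_nonneg[of "a * _", unfolded form]
    by (intro nn_integral_eq_integral) auto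
  also have "(\<integral>g. cos_excess (a * g) \<partial>?N) = exp (- (a^2) / 2) - 1 + a^2 / 2"
    unfolding form using int_cos int_sq
    by (simp add: cos sq std_normal.prob_space[simplified])
  finally show ?thesis .
qed

definition riesz_weight :: "real \<Rightarrow> real \<Rightarrow> ennreal" where
  "riesz_weight p t = ennreal (t powr (- p - 1)) * indicator {0<..} t"

lemma riesz_weight_measurable [measurable]: "riesz_weight p \<in> borel_measurable borel"
  unfolding riesz_weight_def by measurable

definition riesz_constant :: "real \<Rightarrow> ennreal" where
  "riesz_constant p = (\<integral>\<^sup>+t. ennreal (cos_excess t) * riesz_weight p t \<partial>lborel)"

text \<open>
  Substitute \<open>u = t * \<bar>x\<bar>\<close>. The constant may be infinite here; only \<open>riesz_constant_finite\<close> makes the formula useful.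
\<close>

lemma abs_powr_eq_riesz_integral:
  assumes "0 < p"
  shows "(\<integral>\<^sup>+t. ennreal (cos_excess (t * x)) * riesz_weight p t \<partial>lborel) = ennreal (\<bar>x\<bar> powr p) * riesz_constant p"
proof (cases "x = 0")
  case True
  then show ?thesis using assms by (simp add: cos_excess_def)
next
  case False
  have even: "cos_excess (t * x) = cos_excess (t * \<bar>x\<bar>)" for t
    by (cases "0 \<le> x") (auto simp: cos_excess_def)
  have "(\<integral>\<^sup>+t. ennreal (cos_excess (t * x)) * riesz_weight p t \<partial>lborel) =
      ennreal (1 / \<bar>x\<bar>) * (\<integral>\<^sup>+u. ennreal (cos_excess (1 / \<bar>x\<bar> * u * \<bar>x\<bar>)) * riesz_weight p (1 / \<bar>x\<bar> * u) \<partial>lborel)"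
    unfolding even using False
    by (subst nn_integral_real_affine[where c="1 / \<bar>x\<bar>" and t=0]) auto
  also have "\<dots> = (\<integral>\<^sup>+u. ennreal (1 / \<bar>x\<bar>) * (ennreal (cos_excess (1 / \<bar>x\<bar> * u * \<bar>x\<bar>)) * riesz_weight p (1 / \<bar>x\<bar> * u)) \<partial>lborel)"
    by (rule nn_integral_cmult[symmetric]) measurable
  also have "\<dots> = (\<integral>\<^sup>+u. ennreal (\<bar>x\<bar> powr p) * (ennreal (cos_excess u) * riesz_weight p u) \<partial>lborel)"
  proof (intro nn_integral_cong)
    fix u
    show "ennreal (1 / \<bar>x\<bar>) * (ennreal (cos_excess (1 / \<bar>x\<bar> * u * \<bar>x\<bar>)) * riesz_weight p (1 / \<bar>x\<bar> * u)) =
        ennreal (\<bar>x\<bar> powr p) * (ennreal (cos_excess u) * riesz_weight p u)"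
    proof (cases "0 < u")
      case True
      have "1 / \<bar>x\<bar> * (1 / \<bar>x\<bar> * u) powr (- p - 1) = 1 / \<bar>x\<bar> * (u powr (- p - 1) / \<bar>x\<bar> powr (- p - 1))"
        using True False by (simp add: powr_divide)
      also have "\<dots> = \<bar>x\<bar> powr p * u powr (- p - 1)"
        using False by (simp add: powr_diff powr_minus field_simps)
      finally have w: "1 / \<bar>x\<bar> * (1 / \<bar>x\<bar> * u) powr (- p - 1) = \<bar>x\<bar> powr p * u powr (- p - 1)" .
      have "ennreal (1 / \<bar>x\<bar>) * (ennreal (cos_excess (1 / \<bar>x\<bar> * u * \<bar>x\<bar>)) * riesz_weight p (1 / \<bar>x\<bar> * u)) =
          ennreal (cos_excess u) * ennreal (1 / \<bar>x\<bar> * (1 / \<bar>x\<bar> * u) powr (- p - 1))"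
        using True False by (subst ennreal_mult) (auto simp: riesz_weight_def ac_simps)
      also have "\<dots> = ennreal (\<bar>x\<bar> powr p) * (ennreal (cos_excess u) * riesz_weight p u)"
        unfolding w using True by (subst ennreal_mult) (auto simp: riesz_weight_def ac_simps)
      finally show ?thesis .
    next
      case u: False
      then have "\<not> 0 < 1 / \<bar>x\<bar> * u" by (simp add: not_less divide_nonpos_nonneg)
      with u have "riesz_weight p u = 0" "riesz_weight p (1 / \<bar>x\<bar> * u) = 0"
        by (simp_all add: riesz_weight_def indicator_def)
      then show ?thesis by (simp only: mult_zero_right)
    qed
  qed
  also have "\<dots> = ennreal (\<bar>x\<bar> powr p) * riesz_constant p"
    unfolding riesz_constant_def by (rule nn_integral_cmult) measurable
  finally show ?thesis .
qed

lemma riesz_tail: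
  assumes "0 < q" "0 < a"
  shows "(\<integral>\<^sup>+t. ennreal (t powr (- q - 1)) * indicator {a..} t \<partial>lborel) = ennreal (a powr (- q) / q)"
proof -
  have "(\<integral>\<^sup>+t. ennreal (t powr (- q - 1)) * indicator {a..} t \<partial>lborel) = ennreal (0 - (- (a powr (- q) / q)))"
  proof (rule nn_integral_FTC_atLeast[where F="\<lambda>t. - (t powr (- q) / q)"])
    show "((\<lambda>t. - (t powr (- q) / q)) has_real_derivative t powr (- q - 1)) (at t)" if "a \<le> t" for t
      using that assms by (auto intro!: derivative_eq_intros)
    have "((\<lambda>t. - (t powr (- q) / q)) \<longlongrightarrow> - (0 / q)) at_top"
      using assms by (intro tendsto_intros tendsto_neg_powr filterlim_ident) auto
    then show "((\<lambda>t. - (t powr (- q) / q)) \<longlongrightarrow> 0) at_top" by simp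
  qed auto
  then show ?thesis by simp
qed

text \<open>
  Near 0 the remainder is of fourth order, at infinity it grows quadratically.
\<close>

lemma riesz_constant_finite:
  assumes "2 < p" "p \<le> 3"
  shows "riesz_constant p < \<infinity>"
proof -
  have "riesz_constant p \<le> (\<integral>\<^sup>+t. indicator {0..1} t + ennreal (t powr (- (p - 2) - 1)) * indicator {1..} t \<partial>lborel)"
    unfolding riesz_constant_def
  proof (intro nn_integral_mono)
    fix t :: real
    consider "t \<le> 0" | "0 < t" "t \<le> 1" | "1 < t" by linarith
    then show "ennreal (cos_excess t) * riesz_weight p t \<le> indicator {0..1} t + ennreal (t powr (- (p - 2) - 1)) * indicator {1..} t"
    proof cases
      case 2
      have "cos_excess t * t powr (- p - 1) \<le> t^4 * t powr (- p - 1)"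
        by (intro mult_right_mono cos_excess_le_fourth) auto
      also have "\<dots> = t powr 4 * t powr (- p - 1)" using 2 by (simp add: powr_numeral)
      also have "\<dots> = t powr (3 - p)" by (simp flip: powr_add)
      also have "\<dots> \<le> 1" using powr_mono2[of "3 - p" t 1] 2 assms by simp
      finally have "ennreal (cos_excess t * t powr (- p - 1)) \<le> 1" by simp
      then have "ennreal (cos_excess t) * riesz_weight p t \<le> indicator {0..1} t"
        using 2 by (simp add: riesz_weight_def ennreal_mult)
      then show ?thesis by (rule order_trans) simp
    next
      case 3
      have "cos_excess t * t powr (- p - 1) \<le> t^2 * t powr (- p - 1)"
        using cos_excess_le_square[of t] zero_le_power2[of t] by (intro mult_right_mono) (linarith, simp)
      also have "\<dots> = t powr 2 * t powr (- p - 1)" using 3 by (simp add: powr_numeral)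
      also have "\<dots> = t powr (- (p - 2) - 1)" by (simp flip: powr_add)
      finally have "ennreal (cos_excess t * t powr (- p - 1)) \<le> ennreal (t powr (- (p - 2) - 1))"
        by (rule ennreal_leI)
      then show ?thesis using 3 by (simp add: riesz_weight_def ennreal_mult)
    qed (auto simp: riesz_weight_def)
  qed
  also have "\<dots> = 1 + ennreal (1 / (p - 2))"
    using riesz_tail[of "p - 2" 1] assms by (subst nn_integral_add) auto
  also have "\<dots> < \<infinity>" by (simp add: less_top[symmetric])
  finally show ?thesis .
qed

text \<open>
  The lower bound is uniform in \<open>p\<close>. It is what makes the error in Khinchine's inequality bounded.
\<close>

lemma riesz_constant_ge:
  assumes "0 < p" "p \<le> 3"
  shows "ennreal ((cos 1 - 1/2) / 16) \<le> riesz_constant p"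
proof -
  have "ennreal ((cos 1 - 1/2) / 16) = (\<integral>\<^sup>+t. ennreal ((cos 1 - 1/2) / 16) * indicator {1..2::real} t \<partial>lborel)"
    by (subst nn_integral_cmult) auto
  also have "\<dots> \<le> riesz_constant p"
    unfolding riesz_constant_def
  proof (intro nn_integral_mono)
    fix t :: real
    show "ennreal ((cos 1 - 1/2) / 16) * indicator {1..2} t \<le> ennreal (cos_excess t) * riesz_weight p t"
    proof (cases "t \<in> {1..2}")
      case True
      have "(1/16::real) = 2 powr (- 4)" by (simp add: powr_minus powr_numeral)
      also have "\<dots> \<le> 2 powr (- p - 1)" using assms by (intro powr_mono) auto
      also have "\<dots> \<le> t powr (- p - 1)" using True assms by (intro powr_mono2') auto
      finally have "(cos 1 - 1/2) * (1/16) \<le> cos_excess t * t powr (- p - 1)"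
        using True cos_1_gt_half by (intro mult_mono cos_excess_ge) auto
      then have "ennreal ((cos 1 - 1/2) / 16) \<le> ennreal (cos_excess t * t powr (- p - 1))"
        by (intro ennreal_leI) simp
      then show ?thesis using True by (simp add: riesz_weight_def ennreal_mult)
    qed auto
  qed
  finally show ?thesis .
qed

lemma rademacher_mean_riesz:
  assumes "0 < p"
  shows "ennreal (rademacher_mean (\<lambda>x. \<bar>x\<bar> powr p) bs s) * riesz_constant p =
    (\<integral>\<^sup>+t. ennreal (rademacher_mean (\<lambda>x. cos_excess (t * x)) bs s) * riesz_weight p t \<partial>lborel)"
proof (induction bs arbitrary: s)
  case Nil
  then show ?case by (simp add: abs_powr_eq_riesz_integral[OF assms])
next
  case (Cons b bs)
  let ?r = "rademacher_mean (\<lambda>x. \<bar>x\<bar> powr p) bs" and ?c = "\<lambda>t. rademacher_mean (\<lambda>x. cos_excess (t * x)) bs"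
  have meas[measurable]: "(\<lambda>t. ?c t s) \<in> borel_measurable borel" for s
    by (induction bs arbitrary: s) simp_all
  have "0 \<le> ?r s" "0 \<le> ?c t s" for s t by (auto intro: rademacher_mean_nonneg)
  note half = ennreal_half_sum[OF this(1) this(1)] ennreal_half_sum[OF this(2) this(2)]
  have "ennreal (rademacher_mean (\<lambda>x. \<bar>x\<bar> powr p) (b # bs) s) * riesz_constant p =
      ennreal (1/2) * (ennreal (?r (s + b)) * riesz_constant p + ennreal (?r (s - b)) * riesz_constant p)"
    by (simp only: rademacher_mean.simps half distrib_right mult.assoc)
  also have "\<dots> = (\<integral>\<^sup>+t. ennreal (1/2) * (ennreal (?c t (s + b)) * riesz_weight p t + ennreal (?c t (s - b)) * riesz_weight p t) \<partial>lborel)"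
    unfolding Cons.IH by (subst nn_integral_cmult) (auto simp: nn_integral_add)
  also have "\<dots> = (\<integral>\<^sup>+t. ennreal (rademacher_mean (\<lambda>x. cos_excess (t * x)) (b # bs) s) * riesz_weight p t \<partial>lborel)"
    by (simp only: rademacher_mean.simps half distrib_right mult.assoc)
  finally show ?case .
qed

lemma gaussian_mean_riesz:
  assumes "0 < p"
  shows "(\<integral>\<^sup>+g. ennreal (\<bar>\<sigma> * g\<bar> powr p) \<partial>\<gamma>) * riesz_constant p =
    (\<integral>\<^sup>+t. ennreal (exp (- ((t * \<sigma>)^2) / 2) - 1 + (t * \<sigma>)^2 / 2) * riesz_weight p t \<partial>lborel)"
proof -
  have "(\<integral>\<^sup>+g. ennreal (\<bar>\<sigma> * g\<bar> powr p) \<partial>\<gamma>) * riesz_constant p =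
      (\<integral>\<^sup>+g. (\<integral>\<^sup>+t. ennreal (cos_excess (t * (\<sigma> * g))) * riesz_weight p t \<partial>lborel) \<partial>\<gamma>)"
    by (simp add: abs_powr_eq_riesz_integral[OF assms] nn_integral_multc)
  also have "\<dots> = (\<integral>\<^sup>+t. (\<integral>\<^sup>+g. ennreal (cos_excess (t * (\<sigma> * g))) * riesz_weight p t \<partial>\<gamma>) \<partial>lborel)"
  proof -
    interpret pair_sigma_finite lborel \<gamma> ..
    show ?thesis by (rule Fubini') measurable
  qed
  also have "\<dots> = (\<integral>\<^sup>+t. (\<integral>\<^sup>+g. ennreal (cos_excess ((t * \<sigma>) * g)) \<partial>\<gamma>) * riesz_weight p t \<partial>lborel)"
    by (intro nn_integral_cong) (simp add: nn_integral_multc mult.assoc)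
  finally show ?thesis by (simp only: gaussian_mean_cos_excess)
qed

text \<open>
  Up to \<open>t = 1 / B\<close> every factor lies in the range where the cosine is positive and below the Gaussian; beyond, the
  product is bounded by 1.
\<close>

lemma prod_cos_le:
  assumes "\<And>b. b \<in> set bs \<Longrightarrow> \<bar>b\<bar> \<le> B" "0 < t"
  shows "(\<Prod>b\<leftarrow>bs. cos (t * b)) \<le> exp (- (t^2 * sum_squares bs) / 2) + indicator {1 / B..} t"
proof (cases "0 < B \<and> 1 / B \<le> t")
  case True
  have "\<bar>\<Prod>b\<leftarrow>bs. cos (t * b)\<bar> \<le> 1"
    by (induction bs) (auto simp: abs_mult intro!: mult_le_one)
  with True show ?thesis by (simp add: indicator_def) (smt (verit) exp_gt_zero)
next
  case False
  have small: "\<bar>t * b\<bar> \<le> 1" if "b \<in> set bs" for b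
  proof -
    have b: "\<bar>b\<bar> \<le> B" using assms(1)[OF that] .
    show ?thesis
    proof (cases "0 < B")
      case True
      with False have "t * B \<le> 1" by (simp add: field_simps)
      moreover have "\<bar>t * b\<bar> \<le> t * B" using b assms(2) by (simp add: abs_mult)
      ultimately show ?thesis by linarith
    next
      case False
      with b have "b = 0" by linarith
      then show ?thesis by simp
    qed
  qed
  then have "0 \<le> (\<Prod>b\<leftarrow>bs. cos (t * b)) \<and> (\<Prod>b\<leftarrow>bs. cos (t * b)) \<le> exp (- (t^2 * sum_squares bs) / 2)"
  proof (induction bs)
    case (Cons b bs)
    have "0 \<le> cos (t * b)"
      using Cons.prems[of b] pi_gt3 by (intro cos_ge_zero) auto
    moreover have "cos (t * b) \<le> exp (- ((t * b)^2) / 2)" using Cons.prems[of b] by (intro cos_le_gaussian) auto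
    moreover have "exp (- (t^2 * sum_squares (b # bs)) / 2) = exp (- ((t * b)^2) / 2) * exp (- (t^2 * sum_squares bs) / 2)"
      by (simp add: power_mult_distrib distrib_left diff_divide_distrib flip: exp_add)
    ultimately show ?case using Cons.IH Cons.prems by (auto intro!: mult_mono)
  qed simp
  then show ?thesis by (simp add: indicator_def)
qed

text \<open>
  In the integral representations of both moments the constant and the quadratic terms agree, because the variances do. What remains is to
  compare a product of cosines with a Gaussian, and only the range \<open>t \<ge> 1 / B\<close> contributes an error.
\<close>

lemma khinchine_below_3_weighted:
  assumes "2 < p" "p \<le> 3" and B: "0 < B" "\<And>b. b \<in> set bs \<Longrightarrow> \<bar>b\<bar> \<le> B"
  shows "ennreal (rademacher_mean (\<lambda>x. \<bar>x\<bar> powr p) bs 0) * riesz_constant p \<le>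
    (\<integral>\<^sup>+g. ennreal (\<bar>sqrt (sum_squares bs) * g\<bar> powr p) \<partial>\<gamma>) * riesz_constant p + ennreal (B powr p / p)"
proof -
  let ?S = "sum_squares bs" and ?w = "riesz_weight p"
  let ?G = "\<lambda>t. ennreal (exp (- ((t * sqrt ?S)^2) / 2) - 1 + (t * sqrt ?S)^2 / 2)"
  have p: "0 < p" using assms by simp
  have sq: "(t * sqrt ?S)^2 = t^2 * ?S" for t using sum_squares_nonneg[of bs] by (simp add: power_mult_distrib)
  have "ennreal (rademacher_mean (\<lambda>x. \<bar>x\<bar> powr p) bs 0) * riesz_constant p =
      (\<integral>\<^sup>+t. ennreal ((\<Prod>b\<leftarrow>bs. cos (t * b)) - 1 + t^2 * ?S / 2) * ?w t \<partial>lborel)"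
    unfolding rademacher_mean_riesz[OF p] rademacher_mean_cos_excess by simp
  also have "\<dots> \<le> (\<integral>\<^sup>+t. ?G t * ?w t + ennreal (t powr (- p - 1)) * indicator {1 / B..} t \<partial>lborel)"
  proof (intro nn_integral_mono)
    fix t :: real
    show "ennreal ((\<Prod>b\<leftarrow>bs. cos (t * b)) - 1 + t^2 * ?S / 2) * ?w t \<le> ?G t * ?w t + ennreal (t powr (- p - 1)) * indicator {1 / B..} t"
    proof (cases "0 < t")
      case True
      let ?i = "indicator {1 / B..} t :: real"
      have nonneg: "0 \<le> exp (- ((t * sqrt ?S)^2) / 2) - 1 + (t * sqrt ?S)^2 / 2"
        using exp_ge_add_one_self[of "- ((t * sqrt ?S)^2) / 2"] by linarith
      have "(\<Prod>b\<leftarrow>bs. cos (t * b)) - 1 + t^2 * ?S / 2 \<le> (exp (- ((t * sqrt ?S)^2) / 2) - 1 + (t * sqrt ?S)^2 / 2) + ?i"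
        using prod_cos_le[OF B(2) True] by (simp add: sq)
      then have "ennreal ((\<Prod>b\<leftarrow>bs. cos (t * b)) - 1 + t^2 * ?S / 2) \<le> ?G t + ennreal ?i"
        using nonneg by (simp flip: ennreal_plus)
      then have "ennreal ((\<Prod>b\<leftarrow>bs. cos (t * b)) - 1 + t^2 * ?S / 2) * ?w t \<le> (?G t + ennreal ?i) * ?w t"
        by (rule mult_right_mono) simp
      also have "\<dots> = ?G t * ?w t + ennreal (t powr (- p - 1)) * indicator {1 / B..} t"
        using True by (simp add: distrib_right riesz_weight_def indicator_def)
      finally show ?thesis .
    qed (simp add: riesz_weight_def)
  qed
  also have "\<dots> = (\<integral>\<^sup>+t. ?G t * ?w t \<partial>lborel) + (\<integral>\<^sup>+t. ennreal (t powr (- p - 1)) * indicator {1 / B..} t \<partial>lborel)"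
    by (rule nn_integral_add) measurable
  also have "(\<integral>\<^sup>+t. ennreal (t powr (- p - 1)) * indicator {1 / B..} t \<partial>lborel) = ennreal (B powr p / p)"
    using riesz_tail[OF p, of "1 / B"] B(1) by (simp add: powr_divide powr_minus)
  also have "(\<integral>\<^sup>+t. ?G t * ?w t \<partial>lborel) = (\<integral>\<^sup>+g. ennreal (\<bar>sqrt ?S * g\<bar> powr p) \<partial>\<gamma>) * riesz_constant p"
    by (rule gaussian_mean_riesz[OF p, symmetric])
  finally show ?thesis .
qed

lemma rademacher_mean_square: "rademacher_mean (\<lambda>x. \<bar>x\<bar> powr 2) bs s = s^2 + sum_squares bs"
  by (induction bs arbitrary: s) (auto simp: powr_numeral power2_eq_square field_simps)

text \<open>
  This is \<open>1 / (2 * \<kappa>)\<close> for the lower bound \<open>\<kappa>\<close> of \<open>riesz_constant_ge\<close>; the 2 bounds \<open>p\<close> from below.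
\<close>

definition khinchine_slack :: real where
  "khinchine_slack = 8 / (cos 1 - 1 / 2)"

lemma khinchine_slack_ge_1: "1 \<le> khinchine_slack"
proof -
  have "cos (1::real) - 1 / 2 \<le> 8" using cos_le_one[of "1::real"] by linarith
  then show ?thesis using cos_1_gt_half by (simp add: khinchine_slack_def)
qed

text \<open>
  The slack is used for \<open>2 < p < 3\<close> only, where the function \<open>\<bar>x\<bar> powr (p - 2)\<close> is not convex and the exchange
  of signs for Gaussians fails.
\<close>

theorem khinchine_gaussian_constant:
  assumes p: "2 \<le> p" and B: "0 < B" "\<And>b. b \<in> set bs \<Longrightarrow> \<bar>b\<bar> \<le> B"
  shows "ennreal (rademacher_mean (\<lambda>x. \<bar>x\<bar> powr p) bs 0) \<le>
    (\<integral>\<^sup>+g. ennreal (\<bar>sqrt (sum_squares bs) * g\<bar> powr p) \<partial>\<gamma>) + ennreal ((khinchine_slack * B) powr p)"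
    (is "?r \<le> ?G + ?slack")
proof -
  consider "p = 2" | "2 < p" "p < 3" | "3 \<le> p" using p by linarith
  then show ?thesis
  proof cases
    case 1
    have "?G = (\<integral>\<^sup>+g. ennreal (sum_squares bs) * ennreal (g^2) \<partial>\<gamma>)"
      unfolding 1 using sum_squares_nonneg[of bs]
      by (intro nn_integral_cong) (simp add: powr_numeral power_mult_distrib flip: ennreal_mult)
    also have "\<dots> = ennreal (sum_squares bs)"
      by (simp add: nn_integral_cmult nn_integral_std_normal_square)
    finally have "?G = ennreal (sum_squares bs)" .
    moreover have "?r = ennreal (sum_squares bs)" unfolding 1 rademacher_mean_square by simp
    ultimately show ?thesis by simp
  next
    case 3
    then show ?thesis using khinchine_ge_3[OF 3, of bs 0] by (auto intro: order_trans)
  next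
    case 2
    let ?\<kappa> = "(cos 1 - 1/2) / 16 :: real"
    obtain k where k: "riesz_constant p = ennreal k" "0 \<le> k"
      using riesz_constant_finite[of p] 2 by (cases "riesz_constant p") auto
    have \<kappa>: "0 < ?\<kappa>" "?\<kappa> \<le> k" using cos_1_gt_half riesz_constant_ge[of p] 2 k by (auto simp: ennreal_le_iff)
    then have kpos: "0 < k" by linarith
    show ?thesis
    proof (cases ?G)
      case (real c)
      define r where "r = rademacher_mean (\<lambda>x. \<bar>x\<bar> powr p) bs 0"
      have r0: "0 \<le> r" unfolding r_def by (rule rademacher_mean_nonneg) simp
      have "ennreal (r * k) \<le> ennreal (c * k + B powr p / p)"
        using khinchine_below_3_weighted[of p B bs] 2 B real k r0 r_def
        by (simp add: ennreal_mult)
      then have "r * k \<le> c * k + B powr p / p" using real(1) k 2 by (subst (asm) ennreal_le_iff) auto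
      then have "r \<le> c + B powr p / (p * k)" using kpos 2 by (simp add: field_simps)
      also have "B powr p / (p * k) \<le> B powr p / (2 * ?\<kappa>)"
        using \<kappa> 2 by (intro divide_left_mono mult_mono) auto
      also have "\<dots> = khinchine_slack * B powr p" using cos_1_gt_half by (simp add: khinchine_slack_def field_simps)
      also have "\<dots> \<le> khinchine_slack powr p * B powr p"
        using powr_mono[of 1 p khinchine_slack] khinchine_slack_ge_1 p by (intro mult_right_mono) auto
      also have "\<dots> = (khinchine_slack * B) powr p"
        using khinchine_slack_ge_1 B(1) by (simp add: powr_mult)
      finally have "ennreal r \<le> ennreal (c + (khinchine_slack * B) powr p)" by (simp add: ennreal_leI)
      then show ?thesis using real by (simp add: r_def)
    qed simp
  qed
qed

lemma exp_moment_std_normal: "(\<integral>\<^sup>+g. ennreal (exp (l * g)) \<partial>\<gamma>) = ennreal (exp (l^2 / 2))"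
proof -
  have "std_normal_density g * exp (l * g) = exp (l^2 / 2) * normal_density l 1 g" for g
    by (simp add: normal_density_def power2_eq_square field_simps flip: exp_add)
  then have "(\<integral>\<^sup>+g. ennreal (exp (l * g)) \<partial>\<gamma>) =
      (\<integral>\<^sup>+g. ennreal (exp (l^2 / 2)) * ennreal (normal_density l 1 g) \<partial>lborel)"
    by (simp add: nn_integral_std_normal flip: ennreal_mult)
  also have "\<dots> = ennreal (exp (l^2 / 2)) * (\<integral>\<^sup>+g. ennreal (normal_density l 1 g) \<partial>lborel)"
    by (rule nn_integral_cmult) measurable
  also have "(\<integral>\<^sup>+g. ennreal (normal_density l 1 g) \<partial>lborel) = 1"
    by (subst nn_integral_eq_integral) auto
  finally show ?thesis by simp
qed

lemma gaussian_moment_le: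
  assumes p: "1 \<le> p"
  shows "(\<integral>\<^sup>+g. ennreal (\<bar>g\<bar> powr p) \<partial>\<gamma>) \<le> ennreal ((exp 2 * sqrt p) powr p)"
proof -
  have sp: "0 < sqrt p" "p / sqrt p = sqrt p" using p by (auto simp: real_div_sqrt)
  have "(\<integral>\<^sup>+g. ennreal (\<bar>g\<bar> powr p) \<partial>\<gamma>) \<le>
    (\<integral>\<^sup>+g. ennreal (sqrt p powr p) * (ennreal (exp (sqrt p * g)) + ennreal (exp (- sqrt p * g))) \<partial>\<gamma>)"
  proof (intro nn_integral_mono)
    fix g :: real
    have "\<bar>g\<bar> powr p \<le> sqrt p powr p * exp (sqrt p * \<bar>g\<bar>)"
      using powr_le_exp[of p "sqrt p" "\<bar>g\<bar>"] sp p by simp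
    also have "\<dots> \<le> sqrt p powr p * (exp (sqrt p * g) + exp (- sqrt p * g))"
      by (intro mult_left_mono) (auto simp: abs_if)
    finally show "ennreal (\<bar>g\<bar> powr p) \<le> ennreal (sqrt p powr p) * (ennreal (exp (sqrt p * g)) + ennreal (exp (- sqrt p * g)))"
      by (simp flip: ennreal_mult ennreal_plus)
  qed
  also have "\<dots> = ennreal (sqrt p powr p) * (ennreal (exp (p / 2)) + ennreal (exp (p / 2)))"
    using p exp_moment_std_normal[of "sqrt p"] exp_moment_std_normal[of "- sqrt p"]
    by (simp add: nn_integral_cmult nn_integral_add)
  also have "\<dots> = ennreal (sqrt p powr p * (2 * exp (p / 2)))"
    by (simp flip: ennreal_mult ennreal_plus)
  also have "\<dots> \<le> ennreal (sqrt p powr p * exp 2 powr p)"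
  proof (intro ennreal_leI mult_left_mono)
    have "2 \<le> exp p" using exp_ge_add_one_self[of p] p by linarith
    then have "2 * exp (p / 2) \<le> exp p * exp p" using p by (intro mult_mono) auto
    also have "\<dots> = exp 2 powr p" by (simp add: exp_powr_real flip: exp_add)
    finally show "2 * exp (p / 2) \<le> exp 2 powr p" .
  qed simp
  also have "sqrt p powr p * exp 2 powr p = (exp 2 * sqrt p) powr p"
    using p by (simp add: powr_mult)
  finally show ?thesis .
qed

section \<open>Moments of linear forms\<close>

lemma powr_superadditive:
  fixes u v p :: real
  assumes "0 \<le> u" "0 \<le> v" "1 \<le> p"
  shows "u powr p + v powr p \<le> (u + v) powr p"
proof (cases "u + v = 0")
  case False
  then have w: "0 < u + v" using assms by linarith
  have part: "t powr p \<le> t / (u + v) * (u + v) powr p" if "0 \<le> t" "t \<le> u + v" for t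
  proof -
    have "(t / (u + v)) powr p \<le> (t / (u + v)) powr 1"
      using that w assms(3) by (intro powr_mono') auto
    then show ?thesis using that w by (simp add: powr_divide field_simps)
  qed
  have "u powr p + v powr p \<le> (u / (u + v) + v / (u + v)) * (u + v) powr p"
    using part[of u] part[of v] assms by (simp add: distrib_right)
  also have "u / (u + v) + v / (u + v) = 1" using w by (simp flip: add_divide_distrib)
  finally show ?thesis by simp
qed (use assms in \<open>auto simp: add_nonneg_eq_0_iff\<close>)

context unconditional_log_concave
begin

lemma rademacher_mean_linear_measurable:
  assumes [measurable]: "\<phi> \<in> borel_measurable borel" "T \<in> borel_measurable (Leb I)" and "set is \<subseteq> I"
  shows "(\<lambda>x. rademacher_mean \<phi> (map (\<lambda>i. a i * x i) is) (T x)) \<in> borel_measurable (Leb I)"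
  using assms(2,3)
proof (induction "is" arbitrary: T)
  case Nil
  note [measurable] = Nil(1)
  show ?case by simp
next
  case (Cons i "is")
  have [measurable]: "(\<lambda>x. x i) \<in> borel_measurable (Leb I)"
    using Cons.prems by (intro measurable_coordinate) simp
  note [measurable] = Cons.prems(1)
  have [measurable]: "(\<lambda>x. rademacher_mean \<phi> (map (\<lambda>i. a i * x i) is) (T x + a i * x i)) \<in> borel_measurable (Leb I)"
    "(\<lambda>x. rademacher_mean \<phi> (map (\<lambda>i. a i * x i) is) (T x - a i * x i)) \<in> borel_measurable (Leb I)"
    using Cons.prems by (auto intro!: Cons.IH)
  show ?case by simp
qed

text \<open>
  The law is invariant under \<open>x i \<mapsto> - x i\<close>, so each coordinate may be averaged over its sign. The term \<open>T\<close> collects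
  the coordinates that have not been averaged yet.
\<close>

lemma nn_integral_sign_average:
  assumes \<phi>[measurable]: "\<phi> \<in> borel_measurable borel" and nonneg: "\<And>x. 0 \<le> \<phi> x"
    and "T \<in> borel_measurable (Leb I)" "distinct is" "set is \<subseteq> I"
    and "\<And>x i t. i \<in> set is \<Longrightarrow> T (x(i := t)) = T x"
  shows "(\<integral>\<^sup>+x. ennreal (\<phi> (T x + (\<Sum>i\<leftarrow>is. a i * x i))) \<partial>law) =
    (\<integral>\<^sup>+x. ennreal (rademacher_mean \<phi> (map (\<lambda>i. a i * x i) is) (T x)) \<partial>law)"
  using assms(3-)
proof (induction "is" arbitrary: T)
  case Nil
  then show ?case by simp
next
  case (Cons i "is")
  let ?r = "\<lambda>x. rademacher_mean \<phi> (map (\<lambda>i. a i * x i) is)"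
  have i: "i \<in> I" "i \<notin> set is" using Cons.prems by auto
  note [measurable] = Cons.prems(1) measurable_coordinate[OF i(1)]
  have [measurable]: "(\<lambda>x. ?r x (T x + a i * x i)) \<in> borel_measurable (Leb I)"
      "(\<lambda>x. ?r x (T x - a i * x i)) \<in> borel_measurable (Leb I)"
    using Cons.prems by (auto intro!: rademacher_mean_linear_measurable)
  have r0: "0 \<le> ?r x t" for x t using nonneg by (rule rademacher_mean_nonneg)
  have plus: "(\<integral>\<^sup>+x. ennreal (\<phi> (T x + (\<Sum>i\<leftarrow>i # is. a i * x i))) \<partial>law) = (\<integral>\<^sup>+x. ennreal (?r x (T x + a i * x i)) \<partial>law)"
  proof -
    have indep: "T (x(j := t)) + a i * (x(j := t)) i = T x + a i * x i" if "j \<in> set is" for x j t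
    proof -
      have "T (x(j := t)) = T x" using that by (intro Cons.prems(4)) simp
      moreover have "(x(j := t)) i = x i" using that i(2) by auto
      ultimately show ?thesis by simp
    qed
    have meas: "(\<lambda>x. T x + a i * x i) \<in> borel_measurable (Leb I)" by measurable
    have d: "distinct is" "set is \<subseteq> I" using Cons.prems(2,3) by auto
    have "(\<integral>\<^sup>+x. ennreal (\<phi> (T x + a i * x i + (\<Sum>i\<leftarrow>is. a i * x i))) \<partial>law) = (\<integral>\<^sup>+x. ennreal (?r x (T x + a i * x i)) \<partial>law)"
      by (rule Cons.IH[OF meas d indep])
    then show ?thesis by (simp add: add.assoc)
  qed
  have minus: "(\<integral>\<^sup>+x. ennreal (?r x (T x + a i * x i)) \<partial>law) = (\<integral>\<^sup>+x. ennreal (?r x (T x - a i * x i)) \<partial>law)"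
  proof -
    have "?r (x(i := - x i)) (T (x(i := - x i)) - a i * (x(i := - x i)) i) = ?r x (T x + a i * x i)" for x
    proof -
      have 1: "map (\<lambda>j. a j * (x(i := - x i)) j) is = map (\<lambda>j. a j * x j) is"
        using i(2) by (intro map_cong) auto
      have 2: "T (x(i := - x i)) = T x" by (rule Cons.prems(4)) simp
      show ?thesis unfolding 1 2 by simp
    qed
    then show ?thesis
      using nn_integral_flip[OF i(1), of "\<lambda>x. ennreal (?r x (T x - a i * x i))"] by (simp only:) measurable
  qed
  have "(\<integral>\<^sup>+x. ennreal (rademacher_mean \<phi> (map (\<lambda>i. a i * x i) (i # is)) (T x)) \<partial>law) =
      (\<integral>\<^sup>+x. ennreal (1/2) * (ennreal (?r x (T x + a i * x i)) + ennreal (?r x (T x - a i * x i))) \<partial>law)"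
    using r0 by (simp only: rademacher_mean.simps list.map ennreal_half_sum)
  also have "\<dots> = ennreal (1/2) * ((\<integral>\<^sup>+x. ennreal (?r x (T x + a i * x i)) \<partial>law) + (\<integral>\<^sup>+x. ennreal (?r x (T x - a i * x i)) \<partial>law))"
    by (subst nn_integral_cmult) (auto simp: nn_integral_add)
  also have "\<dots> = (\<integral>\<^sup>+x. ennreal (?r x (T x + a i * x i)) \<partial>law)"
  proof -
    have "ennreal (1/2) + ennreal (1/2) = 1" by (subst ennreal_plus[symmetric]) auto
    then show ?thesis unfolding minus[symmetric]
      by (simp only: distrib_left distrib_right[symmetric] mult_1)
  qed
  finally show ?case unfolding plus ..
qed

text \<open>
  Khinchine's inequality is applied at every point \<open>x\<close>, with \<open>s + total_excess s x\<close> as bound for all \<open>\<bar>a i * x i\<bar>\<close>.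
\<close>

theorem linear_form_moment:
  assumes n: "2 \<le> card I" and a: "\<And>i. i \<in> I \<Longrightarrow> \<bar>a i\<bar> \<le> 1" and p: "2 \<le> p" and A: "0 < A" "A = L2_set a I"
    and g: "0 \<le> g" "(\<integral>\<^sup>+t. ennreal (\<bar>t\<bar> powr p) \<partial>\<gamma>) = ennreal (g powr p)"
  defines "s \<equiv> 4 * ln (card I)"
  shows "(\<integral>\<^sup>+x. ennreal (\<bar>\<Sum>i\<in>I. a i * x i\<bar> powr p) \<partial>law) \<le>
    ennreal ((g * (A + exp 9 * sqrt p * s + 24 * p) + khinchine_slack * (s + 24 * p)) powr p)"
proof -
  let ?is = "sorted_list_of_set I" and ?c = khinchine_slack
  have s: "0 < s" using n by (simp add: s_def)
  let ?b = "\<lambda>x. map (\<lambda>i. a i * x i) ?is" and ?f = "\<lambda>x. L2_set (\<lambda>i. a i * x i) I" and ?B = "\<lambda>x. s + total_excess s x"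
  have [measurable]: "?f \<in> borel_measurable (Leb I)"
    unfolding L2_set_def using measurable_coordinate by measurable
  have sq: "sqrt (sum_squares (?b x)) = ?f x" for x
    by (simp add: L2_set_def sum_list_distinct_conv_sum_set comp_def)
  have "(\<integral>\<^sup>+x. ennreal (\<bar>\<Sum>i\<in>I. a i * x i\<bar> powr p) \<partial>law) = (\<integral>\<^sup>+x. ennreal (rademacher_mean (\<lambda>x. \<bar>x\<bar> powr p) (?b x) 0) \<partial>law)"
    using nn_integral_sign_average[of "\<lambda>x. \<bar>x\<bar> powr p" "\<lambda>_. 0" ?is a]
    by (simp add: sum_list_distinct_conv_sum_set)
  also have "\<dots> \<le> (\<integral>\<^sup>+x. ennreal (g powr p) * ennreal (?f x powr p) + ennreal (?c powr p) * ennreal (?B x powr p) \<partial>law)"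
  proof (intro nn_integral_mono)
    fix x
    have B: "0 < ?B x" using s by (simp add: total_excess_def sum_nonneg add_pos_nonneg)
    have le: "\<bar>b\<bar> \<le> ?B x" if "b \<in> set (?b x)" for b
    proof -
      obtain i where i: "i \<in> I" "b = a i * x i" using \<open>b \<in> set (?b x)\<close> by auto
      have "\<bar>b\<bar> \<le> 1 * \<bar>x i\<bar>" unfolding i(2) abs_mult using a[OF i(1)] by (intro mult_right_mono) auto
      also have "\<dots> \<le> s + max 0 (\<bar>x i\<bar> - s)" by simp
      also have "max 0 (\<bar>x i\<bar> - s) \<le> total_excess s x"
        unfolding total_excess_def using i(1) by (intro member_le_sum) auto
      finally show ?thesis by simp
    qed
    have "ennreal (rademacher_mean (\<lambda>x. \<bar>x\<bar> powr p) (?b x) 0) \<le>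
        (\<integral>\<^sup>+t. ennreal (\<bar>?f x * t\<bar> powr p) \<partial>\<gamma>) + ennreal ((?c * ?B x) powr p)"
      unfolding sq[symmetric] by (rule khinchine_gaussian_constant[OF p B le])
    also have "(\<integral>\<^sup>+t. ennreal (\<bar>?f x * t\<bar> powr p) \<partial>\<gamma>) = ennreal (g powr p) * ennreal (?f x powr p)"
      by (simp add: abs_mult powr_mult ennreal_mult nn_integral_multc g(2) mult.commute)
    also have "ennreal ((?c * ?B x) powr p) = ennreal (?c powr p) * ennreal (?B x powr p)"
      using khinchine_slack_ge_1 B by (simp add: powr_mult ennreal_mult)
    finally show "ennreal (rademacher_mean (\<lambda>x. \<bar>x\<bar> powr p) (?b x) 0) \<le>
        ennreal (g powr p) * ennreal (?f x powr p) + ennreal (?c powr p) * ennreal (?B x powr p)" .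
  qed
  also have "\<dots> = ennreal (g powr p) * (\<integral>\<^sup>+x. ennreal (?f x powr p) \<partial>law) + ennreal (?c powr p) * (\<integral>\<^sup>+x. ennreal (?B x powr p) \<partial>law)"
    by (simp add: nn_integral_add nn_integral_cmult)
  also have "\<dots> \<le> ennreal (g powr p) * ennreal ((A + exp 9 * sqrt p * s + 24 * p) powr p) + ennreal (?c powr p) * ennreal ((s + 24 * p) powr p)"
    using euclidean_norm_moment[OF n a _ A, of p] shifted_excess_moment[OF n, of p] p
    by (intro add_mono mult_left_mono) (auto simp: s_def)
  also have "\<dots> = ennreal ((g * (A + exp 9 * sqrt p * s + 24 * p)) powr p + (?c * (s + 24 * p)) powr p)"
    using g(1) A(1) s p khinchine_slack_ge_1
    by (simp add: powr_mult ennreal_mult)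
  also have "\<dots> \<le> ennreal ((g * (A + exp 9 * sqrt p * s + 24 * p) + ?c * (s + 24 * p)) powr p)"
    using g(1) A(1) s p khinchine_slack_ge_1 by (intro ennreal_leI powr_superadditive) auto
  finally show ?thesis .
qed

end

section \<open>From random vectors to even densities\<close>

text \<open>
  Log-concavity at midpoints, together with quasi-concavity. Both follow from convexity of the negative logarithm, and both
  survive the minimum with a reflected density.
\<close>

definition density_log_concave :: "'i set \<Rightarrow> (('i \<Rightarrow> real) \<Rightarrow> ennreal) \<Rightarrow> bool" where
  "density_log_concave I \<rho> \<longleftrightarrow> (\<forall>x\<in>space (Leb I). \<forall>y\<in>space (Leb I).
     \<rho> x * \<rho> y \<le> (\<rho> (\<lambda>i\<in>I. (x i + y i) / 2))^2 \<and>
     (\<forall>t\<in>{0<..<1}. min (\<rho> x) (\<rho> y) \<le> \<rho> (\<lambda>i\<in>I. (1 - t) * x i + t * y i)))"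

abbreviation flip :: "'i \<Rightarrow> ('i \<Rightarrow> real) \<Rightarrow> 'i \<Rightarrow> real" where
  "flip i x \<equiv> x(i := - x i)"

lemma exp_neg_mono: "u \<le> v \<Longrightarrow> u \<noteq> -\<infinity> \<Longrightarrow> exp_neg v \<le> exp_neg u"
  by (cases u; cases v) (auto simp: exp_neg_def)

lemma density_log_concave_exp_neg:
  assumes h: "convex_ereal n h"
  shows "density_log_concave {1..n} (\<lambda>x. exp_neg (h x))"
  unfolding density_log_concave_def
proof (intro ballI conjI)
  fix x y assume xy: "x \<in> space (euclid n)" "y \<in> space (euclid n)"
  have fin: "h z \<noteq> -\<infinity>" if "z \<in> space (euclid n)" for z using h that by (auto simp: convex_ereal_def)
  have conv: "h (\<lambda>i\<in>{1..n}. (1 - t) * x i + t * y i) \<le> ereal (1 - t) * h x + ereal t * h y" if "t \<in> {0<..<1}" for t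
    using h xy that unfolding convex_ereal_def by blast
  have mem: "(\<lambda>i\<in>{1..n}. f i) \<in> space (euclid n)" for f by (auto simp: space_PiM)
  {
    let ?m = "\<lambda>i\<in>{1..n}. (x i + y i) / 2"
    have "?m = (\<lambda>i\<in>{1..n}. (1 - 1/2) * x i + 1/2 * y i)" by (simp add: fun_eq_iff add_divide_distrib)
    then have m: "h ?m \<le> ereal (1/2) * h x + ereal (1/2) * h y" using conv[of "1/2"] by simp
    show "exp_neg (h x) * exp_neg (h y) \<le> (exp_neg (h ?m))^2"
    proof (cases "h x = \<infinity> \<or> h y = \<infinity>")
      case False
      then obtain u v where uv: "h x = ereal u" "h y = ereal v"
        using fin[OF xy(1)] fin[OF xy(2)] by (cases "h x"; cases "h y") auto
      have "exp_neg (h x) * exp_neg (h y) = (exp_neg (ereal (1/2) * h x + ereal (1/2) * h y))^2"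
        by (simp add: uv exp_neg_def ennreal_power flip: ennreal_mult exp_add exp_of_nat_mult)
      also have "\<dots> \<le> (exp_neg (h ?m))^2" by (intro power_mono exp_neg_mono m fin mem) simp
      finally show ?thesis .
    qed (auto simp: exp_neg_def)
  }
  fix t :: real assume t: "t \<in> {0<..<1}"
  have "h (\<lambda>i\<in>{1..n}. (1 - t) * x i + t * y i) \<le> max (h x) (h y)"
  proof -
    have "ereal (1 - t) * h x + ereal t * h y \<le> ereal (1 - t) * max (h x) (h y) + ereal t * max (h x) (h y)"
      using t by (intro add_mono ereal_mult_left_mono) auto
    also have "\<dots> = max (h x) (h y)"
    proof -
      have "max (h x) (h y) \<noteq> -\<infinity>" using fin xy by (simp add: max_def)
      then show ?thesis using t by (cases "max (h x) (h y)") (auto simp: algebra_simps)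
    qed
    finally show ?thesis using conv[OF t] by (rule order_trans[rotated])
  qed
  then have "exp_neg (max (h x) (h y)) \<le> exp_neg (h (\<lambda>i\<in>{1..n}. (1 - t) * x i + t * y i))"
    by (intro exp_neg_mono fin mem)
  then show "min (exp_neg (h x)) (exp_neg (h y)) \<le> exp_neg (h (\<lambda>i\<in>{1..n}. (1 - t) * x i + t * y i))"
    by (cases "h x \<le> h y") (auto simp: max_def intro: order_trans[rotated] min.cobounded1 min.cobounded2)
qed

lemma density_log_concave_flip_min:
  assumes lc: "density_log_concave I \<rho>" and i: "i \<in> I"
  shows "density_log_concave I (\<lambda>x. min (\<rho> x) (\<rho> (flip i x)))"
  unfolding density_log_concave_def
proof (intro ballI conjI)
  fix x y assume xy: "x \<in> space (Leb I)" "y \<in> space (Leb I)"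
  have fxy: "flip i x \<in> space (Leb I)" "flip i y \<in> space (Leb I)"
    using xy i by (auto simp: space_PiM PiE_def extensional_def)
  have mid: "flip i (\<lambda>j\<in>I. (x j + y j) / 2) = (\<lambda>j\<in>I. (flip i x j + flip i y j) / 2)"
    using i by (auto simp: fun_eq_iff minus_divide_left simp del: divide_minus_left)
  have "min (\<rho> x) (\<rho> (flip i x)) * min (\<rho> y) (\<rho> (flip i y)) \<le> \<rho> x * \<rho> y"
    "min (\<rho> x) (\<rho> (flip i x)) * min (\<rho> y) (\<rho> (flip i y)) \<le> \<rho> (flip i x) * \<rho> (flip i y)"
    by (auto intro!: mult_mono)
  moreover have "\<rho> x * \<rho> y \<le> (\<rho> (\<lambda>j\<in>I. (x j + y j) / 2))^2"
    using lc xy unfolding density_log_concave_def by blast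
  moreover have "\<rho> (flip i x) * \<rho> (flip i y) \<le> (\<rho> (flip i (\<lambda>j\<in>I. (x j + y j) / 2)))^2"
    using lc fxy unfolding density_log_concave_def mid by blast
  ultimately show "min (\<rho> x) (\<rho> (flip i x)) * min (\<rho> y) (\<rho> (flip i y)) \<le>
      (min (\<rho> (\<lambda>j\<in>I. (x j + y j) / 2)) (\<rho> (flip i (\<lambda>j\<in>I. (x j + y j) / 2))))^2"
    by (simp only: min_def split: if_split) (auto intro: order_trans)
  fix t :: real assume t: "t \<in> {0<..<1}"
  have comb: "flip i (\<lambda>j\<in>I. (1 - t) * x j + t * y j) = (\<lambda>j\<in>I. (1 - t) * flip i x j + t * flip i y j)"
    using i by (auto simp: fun_eq_iff)
  have "min (\<rho> x) (\<rho> y) \<le> \<rho> (\<lambda>j\<in>I. (1 - t) * x j + t * y j)"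
    using lc xy t unfolding density_log_concave_def by blast
  moreover have "min (\<rho> (flip i x)) (\<rho> (flip i y)) \<le> \<rho> (flip i (\<lambda>j\<in>I. (1 - t) * x j + t * y j))"
    using lc fxy t unfolding density_log_concave_def comb by blast
  ultimately show "min (min (\<rho> x) (\<rho> (flip i x))) (min (\<rho> y) (\<rho> (flip i y))) \<le>
      min (\<rho> (\<lambda>j\<in>I. (1 - t) * x j + t * y j)) (\<rho> (flip i (\<lambda>j\<in>I. (1 - t) * x j + t * y j)))"
    by (auto simp: min_le_iff_disj)
qed

text \<open>
  The density is only almost everywhere even. Its minimum with the reflected density agrees with it almost
  everywhere by invariance of the law, and is even in one more coordinate.
\<close>

lemma exists_even_density:
  fixes \<rho> :: "('i \<Rightarrow> real) \<Rightarrow> ennreal"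
  assumes "finite I" and \<rho>: "\<rho> \<in> borel_measurable (Leb I)" "density_log_concave I \<rho>" "(integral\<^sup>N (Leb I) \<rho>) = 1"
    and inv: "\<And>i. i \<in> I \<Longrightarrow> distr (density (Leb I) \<rho>) (Leb I) (flip i) = density (Leb I) \<rho>"
  obtains \<rho>' where "\<rho>' \<in> borel_measurable (Leb I)" "density_log_concave I \<rho>'" "density (Leb I) \<rho>' = density (Leb I) \<rho>"
    "\<And>i x. i \<in> I \<Longrightarrow> \<rho>' (flip i x) = \<rho>' x"
proof -
  have "\<exists>\<rho>'. \<rho>' \<in> borel_measurable (Leb I) \<and> density_log_concave I \<rho>' \<and> density (Leb I) \<rho>' = density (Leb I) \<rho> \<and>
    (\<forall>i\<in>J. \<forall>x. \<rho>' (flip i x) = \<rho>' x)" if "finite J" "J \<subseteq> I" for J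
    using that
  proof (induction J rule: finite_induct)
    case empty
    show ?case using \<rho> by blast
  next
    case (insert i J)
    then have "J \<subseteq> I" by simp
    from insert.IH[OF this] obtain r where r[measurable]: "r \<in> borel_measurable (Leb I)" and lc: "density_log_concave I r"
      and dens: "density (Leb I) r = density (Leb I) \<rho>" and even: "\<And>j x. j \<in> J \<Longrightarrow> r (flip j x) = r x" by blast
    have i: "i \<in> I" using insert by auto
    have [measurable]: "flip i \<in> measurable (Leb I) (Leb I)"
      using i by (intro measurable_fun_upd_coordinate) auto
    have ff: "flip i (flip i x) = x" for x :: "'i \<Rightarrow> real" by auto
    have "density (Leb I) (\<lambda>x. r (flip i x)) = density (Leb I) r"
    proof (rule measure_eqI)
      fix A assume "A \<in> sets (density (Leb I) (\<lambda>x. r (flip i x)))"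
      then have [measurable]: "A \<in> sets (Leb I)" by simp
      have "emeasure (density (Leb I) (\<lambda>x. r (flip i x))) A = (\<integral>\<^sup>+x. r (flip i x) * indicator A x \<partial>Leb I)"
        by (simp add: emeasure_density)
      also have "\<dots> = (\<integral>\<^sup>+x. r x * indicator A (flip i x) \<partial>Leb I)"
        using nn_integral_scale_coordinate[OF \<open>finite I\<close> i, of "\<lambda>x. r (flip i x) * indicator A x" "-1"] ff by simp
      also have "\<dots> = (\<integral>\<^sup>+x. indicator A (flip i x) \<partial>density (Leb I) r)"
        by (simp add: nn_integral_density)
      also have "\<dots> = (\<integral>\<^sup>+x. indicator A x \<partial>distr (density (Leb I) r) (Leb I) (flip i))"
        by (rule nn_integral_distr[symmetric]) measurable
      also have "distr (density (Leb I) r) (Leb I) (flip i) = density (Leb I) r"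
        unfolding dens by (rule inv[OF i])
      also have "(\<integral>\<^sup>+x. indicator A x \<partial>density (Leb I) r) = emeasure (density (Leb I) r) A"
        by (rule nn_integral_indicator) simp
      finally show "emeasure (density (Leb I) (\<lambda>x. r (flip i x))) A = emeasure (density (Leb I) r) A" .
    qed simp
    moreover have "(\<integral>\<^sup>+x. r (flip i x) \<partial>Leb I) \<noteq> \<infinity>"
    proof -
      have "emeasure (density (Leb I) r) (space (Leb I)) = emeasure (density (Leb I) \<rho>) (space (Leb I))"
        by (simp only: dens)
      then have "(integral\<^sup>N (Leb I) r) = 1" using \<rho> by (simp add: emeasure_density cong: nn_integral_cong)
      moreover have "(integral\<^sup>N (Leb I) r) = (\<integral>\<^sup>+x. r (flip i x) \<partial>Leb I)"
        using nn_integral_scale_coordinate[OF \<open>finite I\<close> i r, of "-1"] by simp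
      ultimately show ?thesis by simp
    qed
    ultimately have "AE x in Leb I. r (flip i x) = r x"
      by (subst (asm) finite_density_unique) auto
    then have "AE x in Leb I. min (r x) (r (flip i x)) = r x" by eventually_elim simp
    then have dens': "density (Leb I) (\<lambda>x. min (r x) (r (flip i x))) = density (Leb I) \<rho>"
      unfolding dens[symmetric] by (intro density_cong) auto
    have meas': "(\<lambda>x. min (r x) (r (flip i x))) \<in> borel_measurable (Leb I)" by measurable
    have even': "min (r (flip j x)) (r (flip i (flip j x))) = min (r x) (r (flip i x))" if "j \<in> insert i J" for j x
    proof (cases "j = i")
      case True
      then show ?thesis by (simp only: ff min.commute)
    next
      case False
      then have "j \<in> J" "flip i (flip j x) = flip j (flip i x)" using that by (auto simp: fun_eq_iff)
      then show ?thesis by (simp only: even)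
    qed
    show ?case
      using meas' density_log_concave_flip_min[OF lc i] dens' even'
      by (intro exI[of _ "\<lambda>x. min (r x) (r (flip i x))"] conjI ballI allI)
  qed
  from this[OF \<open>finite I\<close> order_refl] show ?thesis using that by blast
qed

text \<open>
  Change the coordinates of \<open>x\<close> into those of \<open>z\<close> one at a time. The new value \<open>z j\<close> lies between \<open>x j\<close> and \<open>- x j\<close>, where
  the density takes the same value, so quasi-concavity applies.
\<close>

lemma even_log_concave_antimono:
  assumes "finite I" and lc: "density_log_concave I \<rho>" and even: "\<And>i x. i \<in> I \<Longrightarrow> \<rho> (flip i x) = \<rho> x"
    and xz: "x \<in> space (Leb I)" "z \<in> space (Leb I)" "\<And>i. i \<in> I \<Longrightarrow> \<bar>z i\<bar> \<le> \<bar>x i\<bar>"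
  shows "\<rho> x \<le> \<rho> z"
proof -
  have "\<rho> x \<le> \<rho> (\<lambda>i. if i \<in> J then z i else x i)" if "finite J" "J \<subseteq> I" for J
    using that
  proof (induction J rule: finite_induct)
    case (insert j J)
    let ?w = "\<lambda>i. if i \<in> J then z i else x i" and ?w' = "\<lambda>i. if i \<in> insert j J then z i else x i"
    have j: "j \<in> I" "j \<notin> J" using insert by auto
    have w: "?w \<in> space (Leb I)" "flip j ?w \<in> space (Leb I)"
      using xz(1,2) insert.prems by (auto simp: space_PiM PiE_def extensional_def)
    have w': "?w' = ?w(j := z j)" by (auto simp: fun_eq_iff)
    have ext: "?w i = undefined" if "i \<notin> I" for i using w(1) that by (auto simp: space_PiM PiE_def extensional_def)
    consider "z j = x j" | "z j = - x j" | "\<bar>z j\<bar> < \<bar>x j\<bar>" using xz(3)[OF j(1)] by linarith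
    then have "\<rho> ?w \<le> \<rho> ?w'"
    proof cases
      case 1
      then have "?w' = ?w" unfolding w' using j(2) by (auto simp: fun_eq_iff)
      then show ?thesis by simp
    next
      case 2
      then have "?w' = flip j ?w" unfolding w' using j(2) by (auto simp: fun_eq_iff)
      then show ?thesis using even[OF j(1), of ?w] by simp
    next
      case 3
      define t where "t = (1 - z j / x j) / 2"
      have "\<bar>z j / x j\<bar> < 1" using 3 by (simp add: abs_divide)
      then have t: "t \<in> {0<..<1}" unfolding abs_less_iff t_def by simp
      have "x j \<noteq> 0" using 3 by auto
      then have zj: "z j = (1 - t) * x j + t * - x j" by (simp add: t_def field_simps)
      have comb: "(\<lambda>i\<in>I. (1 - t) * ?w i + t * flip j ?w i) = ?w'"
      proof
        fix i
        consider "i = j" | "i \<noteq> j" "i \<in> I" | "i \<notin> I" using j by blast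
        then show "(\<lambda>i\<in>I. (1 - t) * ?w i + t * flip j ?w i) i = ?w' i"
        proof cases
          case 1
          then show ?thesis using j zj by simp
        next
          case 2
          then show ?thesis unfolding w' by (simp add: left_diff_distrib)
        next
          case 3
          then have "?w' i = ?w i" using j by auto
          then have "?w' i = undefined" using ext[OF 3] by (simp only:)
          then show ?thesis using 3 by (simp only: restrict_apply if_False)
        qed
      qed
      have "min (\<rho> ?w) (\<rho> (flip j ?w)) \<le> \<rho> (\<lambda>i\<in>I. (1 - t) * ?w i + t * flip j ?w i)"
        using lc w t unfolding density_log_concave_def by blast
      then have "min (\<rho> ?w) (\<rho> (flip j ?w)) \<le> \<rho> ?w'" unfolding comb .
      then show ?thesis using even[OF j(1), of ?w] by simp
    qed
    then show ?case using insert by (auto intro: order_trans)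
  qed simp
  from this[OF \<open>finite I\<close> order_refl] have "\<rho> x \<le> \<rho> (\<lambda>i. if i \<in> I then z i else x i)" .
  also have "(\<lambda>i. if i \<in> I then z i else x i) = z"
    using xz(1,2) by (auto simp: fun_eq_iff space_PiM PiE_def extensional_def)
  finally show ?thesis .
qed

lemma even_log_concave_midpoint:
  assumes "finite I" and lc: "density_log_concave I \<rho>" and even: "\<And>i x. i \<in> I \<Longrightarrow> \<rho> (flip i x) = \<rho> x"
    and xyz: "x \<in> space (Leb I)" "y \<in> space (Leb I)" "z \<in> space (Leb I)"
    and le: "\<And>i. i \<in> I \<Longrightarrow> \<bar>z i\<bar> \<le> (\<bar>x i\<bar> + \<bar>y i\<bar>) / 2"
  shows "\<rho> x * \<rho> y \<le> (\<rho> z)^2"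
proof -
  let ?x = "\<lambda>i\<in>I. \<bar>x i\<bar>" and ?y = "\<lambda>i\<in>I. \<bar>y i\<bar>" and ?m = "\<lambda>i\<in>I. (\<bar>x i\<bar> + \<bar>y i\<bar>) / 2"
  have mem: "(\<lambda>i\<in>I. f i) \<in> space (Leb I)" for f by (auto simp: space_PiM)
  note mono = even_log_concave_antimono[OF \<open>finite I\<close> lc even]
  have "\<rho> x * \<rho> y \<le> \<rho> ?x * \<rho> ?y"
    using xyz by (intro mult_mono mono mem) auto
  also have "\<dots> \<le> (\<rho> (\<lambda>i\<in>I. (?x i + ?y i) / 2))^2"
    using lc mem unfolding density_log_concave_def by blast
  also have "(\<lambda>i\<in>I. (?x i + ?y i) / 2) = ?m" by (auto simp: fun_eq_iff)
  also have "(\<rho> ?m)^2 \<le> (\<rho> z)^2"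
    using xyz le by (intro power_mono mono mem) (auto intro: order_trans)
  finally show ?thesis .
qed

lemma nn_integral_prob_density:
  assumes "f \<in> borel_measurable M" "prob_space (density M f)"
  shows "(\<integral>\<^sup>+x. f x \<partial>M) = 1"
  using prob_space.emeasure_space_1[OF assms(2)] assms(1)
  by (simp add: emeasure_density cong: nn_integral_cong)

(* The index set keeps the form {1..n} under simplification. *)
declare One_nat_def [simp del]

text \<open>
  Reflection invariance also centres the coordinates, so that the covariance condition bounds the second moments.
\<close>

lemma unconditional_log_concave_representation:
  fixes M :: "'a measure" and X :: "nat \<Rightarrow> 'a \<Rightarrow> real"
  assumes "prob_space M" and iso: "isotropic_vector M n X" and unc: "unconditional_vector M n X"
    and lc: "log_concave_vector M n X"
  obtains \<rho> where "unconditional_log_concave {1..n} \<rho>" "distr M (euclid n) (joint n X) = density (euclid n) \<rho>"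
proof -
  interpret M: prob_space M by fact
  let ?L = "distr M (euclid n) (joint n X)"
  obtain h where h: "convex_ereal n h" and dist: "distributed M (euclid n) (joint n X) (\<lambda>x. exp_neg (h x))"
    using lc by (auto simp: log_concave_vector_def)
  let ?\<rho> = "\<lambda>x. exp_neg (h x)"
  have J[measurable]: "joint n X \<in> measurable M (euclid n)" and L: "?L = density (euclid n) ?\<rho>"
    and \<rho>: "?\<rho> \<in> borel_measurable (euclid n)"
    using dist by (auto simp: distributed_def)
  interpret L: prob_space ?L by (rule M.prob_space_distr[OF J])
  have coord: "(\<lambda>x. x i) \<in> borel_measurable (euclid n)" if "i \<in> {1..n}" for i using that by measurable
  have flip_meas: "flip i \<in> measurable (euclid n) (euclid n)" if "i \<in> {1..n}" for i
    using that coord by (intro measurable_fun_upd_coordinate) auto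
  have inv: "distr ?L (euclid n) (flip i) = ?L" if i: "i \<in> {1..n}" for i
  proof -
    let ?\<eta> = "\<lambda>j. if j = i then -1 else 1 :: real"
    have "flip i \<circ> joint n X = joint n (\<lambda>j \<omega>. ?\<eta> j * X j \<omega>)"
      using i by (auto simp: joint_def fun_eq_iff)
    then have "distr ?L (euclid n) (flip i) = distr M (euclid n) (joint n (\<lambda>j \<omega>. ?\<eta> j * X j \<omega>))"
      using distr_distr[OF flip_meas[OF i] J] by simp
    also have "\<dots> = ?L" using unc unfolding unconditional_vector_def by auto
    finally show ?thesis .
  qed
  have total: "(\<integral>\<^sup>+x. r x \<partial>euclid n) = 1" if "r \<in> borel_measurable (euclid n)" "?L = density (euclid n) r" for r
    using L.prob_space_axioms unfolding that(2) by (rule nn_integral_prob_density[OF that(1)])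
  obtain r where r: "r \<in> borel_measurable (euclid n)" "density_log_concave {1..n} r"
    "density (euclid n) r = density (euclid n) ?\<rho>" "\<And>i x. i \<in> {1..n} \<Longrightarrow> r (flip i x) = r x"
    using exists_even_density[OF _ \<rho> density_log_concave_exp_neg[OF h] total[OF \<rho> L]] inv unfolding L by blast
  have Lr: "?L = density (euclid n) r" using L r(3) by simp
  have variance: "(\<integral>\<^sup>+x. r x * ennreal ((x i)^2) \<partial>euclid n) \<le> 1" if i: "i \<in> {1..n}" for i
  proof -
    note [measurable] = coord[OF i] flip_meas[OF i]
    have Xi: "joint n X \<omega> i = X i \<omega>" for \<omega> using i by (simp add: joint_def)
    have "(\<lambda>\<omega>. joint n X \<omega> i) \<in> borel_measurable M" by measurable
    then have [measurable]: "X i \<in> borel_measurable M" by (simp add: Xi)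
    have mean: "(\<integral>x. x i \<partial>?L) = (\<integral>\<omega>. X i \<omega> \<partial>M)" by (subst integral_distr) (auto simp: Xi)
    have "(\<integral>x. x i \<partial>?L) = (\<integral>x. x i \<partial>distr ?L (euclid n) (flip i))" by (simp only: inv[OF i])
    also have "\<dots> = (\<integral>x. - x i \<partial>?L)" by (subst integral_distr) (auto simp: measurable_distr_eq1)
    finally have centred: "(\<integral>\<omega>. X i \<omega> \<partial>M) = 0" using mean by simp
    have "covariance M (X i) (X i) = 1" using iso i unfolding isotropic_vector_def by simp
    then have one: "(\<integral>\<omega>. (X i \<omega>)^2 \<partial>M) = 1"
      by (simp add: covariance_def centred power2_eq_square)
    then have "integrable M (\<lambda>\<omega>. (X i \<omega>)^2)" using not_integrable_integral_eq by fastforce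
    then have "(\<integral>\<^sup>+\<omega>. ennreal ((X i \<omega>)^2) \<partial>M) = 1" using one by (subst nn_integral_eq_integral) auto
    moreover have "(\<integral>\<^sup>+x. r x * ennreal ((x i)^2) \<partial>euclid n) = (\<integral>\<^sup>+x. ennreal ((x i)^2) \<partial>?L)"
      unfolding Lr using r(1) by (subst nn_integral_density) auto
    moreover have "\<dots> = (\<integral>\<^sup>+\<omega>. ennreal ((X i \<omega>)^2) \<partial>M)"
      by (subst nn_integral_distr) (auto simp: Xi)
    ultimately show ?thesis by simp
  qed
  have "unconditional_log_concave {1..n} r"
  proof
    show "r x * r y \<le> (r z)^2" if "x \<in> space (euclid n)" "y \<in> space (euclid n)" "z \<in> space (euclid n)"
      "\<And>i. i \<in> {1..n} \<Longrightarrow> \<bar>z i\<bar> \<le> (\<bar>x i\<bar> + \<bar>y i\<bar>) / 2" for x y z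
      by (rule even_log_concave_midpoint[OF _ r(2,4) that]) simp
  qed (use r(1) total[OF r(1) Lr] variance in auto)
  then show ?thesis using Lr that by blast
qed

lemma Lp_norm_le:
  assumes [measurable]: "Y \<in> borel_measurable M" and "0 < p" "0 \<le> D"
    and le: "(\<integral>\<^sup>+\<omega>. ennreal (\<bar>Y \<omega>\<bar> powr p) \<partial>M) \<le> ennreal (D powr p)"
  shows "has_moment M p Y \<and> Lp_norm M p Y \<le> D"
proof
  show int: "has_moment M p Y"
    unfolding has_moment_def
    by (rule integrableI_nonneg) (use le in \<open>auto intro: le_less_trans\<close>)
  have "ennreal (\<integral>\<omega>. \<bar>Y \<omega>\<bar> powr p \<partial>M) = (\<integral>\<^sup>+\<omega>. ennreal (\<bar>Y \<omega>\<bar> powr p) \<partial>M)"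
    using int unfolding has_moment_def by (intro nn_integral_eq_integral[symmetric]) auto
  then have "ennreal (\<integral>\<omega>. \<bar>Y \<omega>\<bar> powr p \<partial>M) \<le> ennreal (D powr p)" using le by simp
  then have "(\<integral>\<omega>. \<bar>Y \<omega>\<bar> powr p \<partial>M) \<le> D powr p" by (subst (asm) ennreal_le_iff) auto
  then have "Lp_norm M p Y \<le> (D powr p) powr (1 / p)"
    unfolding Lp_norm_def using assms(2) by (intro powr_mono2) auto
  then show "Lp_norm M p Y \<le> D" using assms(2,3) by (simp add: powr_powr)
qed

lemma gaussian_norm_facts:
  assumes p: "1 \<le> p"
  shows "0 \<le> gaussian_norm p" "gaussian_norm p \<le> exp 2 * sqrt p"
    "(\<integral>\<^sup>+t. ennreal (\<bar>t\<bar> powr p) \<partial>\<gamma>) = ennreal (gaussian_norm p powr p)"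
proof -
  have "has_moment \<gamma> p (\<lambda>x. x) \<and> Lp_norm \<gamma> p (\<lambda>x. x) \<le> exp 2 * sqrt p"
    using p gaussian_moment_le[OF p] by (intro Lp_norm_le) auto
  then have int: "integrable \<gamma> (\<lambda>x. \<bar>x\<bar> powr p)" and le: "gaussian_norm p \<le> exp 2 * sqrt p"
    by (auto simp: has_moment_def gaussian_norm_def)
  show "0 \<le> gaussian_norm p" by (simp add: gaussian_norm_def Lp_norm_def)
  show "gaussian_norm p \<le> exp 2 * sqrt p" by (rule le)
  have "(\<integral>\<^sup>+t. ennreal (\<bar>t\<bar> powr p) \<partial>\<gamma>) = ennreal (\<integral>t. \<bar>t\<bar> powr p \<partial>\<gamma>)"
    using int by (intro nn_integral_eq_integral) auto
  also have "(\<integral>t. \<bar>t\<bar> powr p \<partial>\<gamma>) = gaussian_norm p powr p"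
    using p by (simp add: gaussian_norm_def Lp_norm_def powr_powr)
  finally show "(\<integral>\<^sup>+t. ennreal (\<bar>t\<bar> powr p) \<partial>\<gamma>) = ennreal (gaussian_norm p powr p)" .
qed

text \<open>
  The sum of the coefficients of the four error terms that are estimated in \<open>error_term_le\<close>.
\<close>

definition moment_constant :: real where
  "moment_constant = 4 * exp 11 + 48 * exp 2 + 52 * khinchine_slack"

text \<open>
  All error terms are at most of order \<open>p powr (3 / 2) * l\<close> because \<open>g\<close> is of order \<open>sqrt p\<close>, and \<open>l = ln n\<close> is bounded below for
  \<open>n \<ge> 2\<close>.
\<close>

lemma error_term_le:
  fixes p l g c :: real
  assumes p: "2 \<le> p" and l: "1 / 2 \<le> l" and g: "0 \<le> g" "g \<le> exp 2 * sqrt p" and c: "0 \<le> c"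
  shows "g * (exp 9 * sqrt p * (4 * l) + 24 * p) + c * (4 * l + 24 * p)
    \<le> (4 * exp 11 + 48 * exp 2 + 52 * c) * p powr (3 / 2) * l"
proof -
  let ?q = "p * sqrt p"
  have q: "p powr (3 / 2) = ?q"
  proof -
    have "p powr (3 / 2) = p powr (1 + 1 / 2)" by simp
    also have "\<dots> = ?q" using p by (simp only: powr_add powr_half_sqrt) simp
    finally show ?thesis .
  qed
  have sp: "1 \<le> sqrt p" using p by simp
  have pq: "p \<le> ?q" using mult_left_mono[OF sp, of p] p by simp
  have q1: "1 \<le> ?q" using pq p by linarith
  have l2: "u \<le> 2 * u * l" if "0 \<le> u" for u using mult_left_mono[OF l, of "2 * u"] that by simp
  have 1: "g * (exp 9 * sqrt p * (4 * l)) \<le> 4 * exp 11 * ?q * l"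
  proof -
    have "g * (exp 9 * sqrt p * (4 * l)) \<le> (exp 2 * sqrt p) * (exp 9 * sqrt p * (4 * l))"
      using g(2) p l by (intro mult_right_mono) auto
    also have "\<dots> = 4 * (exp 2 * exp 9) * (sqrt p * sqrt p) * l" by (simp only: ac_simps)
    also have "\<dots> = 4 * exp 11 * p * l" using p by (simp flip: exp_add)
    also have "\<dots> \<le> 4 * exp 11 * ?q * l" using pq l by (intro mult_right_mono mult_left_mono) auto
    finally show ?thesis .
  qed
  have 2: "g * (24 * p) \<le> 48 * exp 2 * ?q * l"
  proof -
    have "g * (24 * p) \<le> (exp 2 * sqrt p) * (24 * p)" using g(2) p by (intro mult_right_mono) auto
    also have "\<dots> = 24 * exp 2 * ?q" by (simp only: ac_simps)
    also have "\<dots> \<le> 2 * (24 * exp 2 * ?q) * l" using p by (intro l2) auto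
    finally show ?thesis by simp
  qed
  have 3: "c * (4 * l) \<le> 4 * c * ?q * l"
  proof -
    have "c * (4 * l) = 4 * c * 1 * l" by simp
    also have "\<dots> \<le> 4 * c * ?q * l" using q1 c l by (intro mult_right_mono mult_left_mono) auto
    finally show ?thesis .
  qed
  have 4: "c * (24 * p) \<le> 48 * c * ?q * l"
  proof -
    have "c * (24 * p) \<le> c * (24 * ?q)" using pq c by (intro mult_left_mono) auto
    also have "\<dots> \<le> 2 * (c * (24 * ?q)) * l" using p c by (intro l2) auto
    finally show ?thesis by simp
  qed
  have "g * (exp 9 * sqrt p * (4 * l) + 24 * p) + c * (4 * l + 24 * p) \<le>
      4 * exp 11 * ?q * l + 48 * exp 2 * ?q * l + (4 * c * ?q * l + 48 * c * ?q * l)"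
    unfolding distrib_left using 1 2 3 4 by linarith
  also have "\<dots> = (4 * exp 11 + 48 * exp 2 + 52 * c) * ?q * l" by (simp add: algebra_simps)
  finally show ?thesis unfolding q .
qed

text \<open>
  Both norms and the linear form are homogeneous in \<open>a\<close>, so \<open>a\<close> may be divided by its maximum norm. Then
  \<open>linear_form_moment\<close> applies to an even density of the law of \<open>X\<close>.
\<close>

theorem corollary8:
  shows "\<exists>C :: real. \<forall>n :: nat. n \<ge> 2 \<longrightarrow>
    (\<forall>(M :: (nat \<Rightarrow> real) measure) (X :: nat \<Rightarrow> (nat \<Rightarrow> real) \<Rightarrow> real) (p :: real) (a :: nat \<Rightarrow> real).
      prob_space M \<longrightarrow>
      isotropic_vector M n X \<longrightarrow> unconditional_vector M n X \<longrightarrow> log_concave_vector M n X \<longrightarrow>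
      p \<ge> 2 \<longrightarrow>
      has_moment M p (\<lambda>\<omega>. \<Sum>i=1..n. a i * X i \<omega>) \<and>
      Lp_norm M p (\<lambda>\<omega>. \<Sum>i=1..n. a i * X i \<omega>)
        \<le> gaussian_norm p * L2_set a {1..n} + C * p powr (3 / 2) * ln (real n) * max_norm n a)"
proof (intro exI[of _ moment_constant] allI impI)
  fix n :: nat and M :: "(nat \<Rightarrow> real) measure" and X :: "nat \<Rightarrow> (nat \<Rightarrow> real) \<Rightarrow> real" and p :: real and a :: "nat \<Rightarrow> real"
  assume n: "2 \<le> n" and M: "prob_space M" and X: "isotropic_vector M n X" "unconditional_vector M n X" "log_concave_vector M n X"
    and p: "2 \<le> p"
  obtain \<rho> where "unconditional_log_concave {1..n} \<rho>" and L: "distr M (euclid n) (joint n X) = density (euclid n) \<rho>"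
    using unconditional_log_concave_representation[OF M X] by blast
  interpret unconditional_log_concave "{1..n}" \<rho> by fact
  let ?S = "\<lambda>\<omega>. \<Sum>i=1..n. a i * X i \<omega>" and ?m = "max_norm n a" and ?g = "gaussian_norm p"
  let ?E = "moment_constant * p powr (3 / 2) * ln (real n)"
  have J[measurable]: "joint n X \<in> measurable M (euclid n)" using X(2) by (simp add: unconditional_vector_def)
  have Xi: "joint n X \<omega> i = X i \<omega>" if "i \<in> {1..n}" for i \<omega> using that by (simp add: joint_def)
  have lin[measurable]: "(\<lambda>x. \<Sum>i\<in>{1..n}. b i * x i) \<in> borel_measurable (euclid n)" for b :: "nat \<Rightarrow> real"
    using measurable_coordinate by measurable
  have S_joint: "?S = (\<lambda>\<omega>. (\<lambda>x. \<Sum>i\<in>{1..n}. a i * x i) (joint n X \<omega>))"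
    by (auto simp: Xi intro!: sum.cong)
  have S_meas: "?S \<in> borel_measurable M" unfolding S_joint by measurable
  have S_moment: "(\<integral>\<^sup>+\<omega>. ennreal (\<bar>?S \<omega>\<bar> powr p) \<partial>M) = (\<integral>\<^sup>+x. ennreal (\<bar>\<Sum>i\<in>{1..n}. a i * x i\<bar> powr p) \<partial>law)"
    unfolding law_def L[symmetric] by (subst nn_integral_distr) (auto simp: Xi intro!: nn_integral_cong)
  have l: "1 / 2 \<le> ln (real n)"
  proof -
    have "exp (1/2) \<le> (2::real)"
    proof -
      have "exp (1/2) \<le> 1 + 1/2 + (1/2::real)^2" by (rule exp_bound) auto
      then show ?thesis by (simp add: power2_eq_square)
    qed
    also have "\<dots> \<le> real n" using n by simp
    finally have "ln (exp (1/2)) \<le> ln (real n)" using n by (subst ln_le_cancel_iff) auto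
    then show ?thesis by simp
  qed
  have le_m: "\<bar>a i\<bar> \<le> ?m" if "i \<in> {1..n}" for i
    unfolding max_norm_def using that by (intro Max_ge) auto
  have m0: "0 \<le> ?m" using le_m[of 1] n by auto
  have "(\<integral>\<^sup>+\<omega>. ennreal (\<bar>?S \<omega>\<bar> powr p) \<partial>M) \<le> ennreal ((?g * L2_set a {1..n} + ?E * ?m) powr p)"
  proof (cases "?m = 0")
    case True
    then have "a i = 0" if "i \<in> {1..n}" for i using le_m[OF that] by simp
    then have "?S \<omega> = 0" for \<omega> by (intro sum.neutral) auto
    then show ?thesis using p by simp
  next
    case False
    with m0 have m: "0 < ?m" by simp
    define b where "b i = a i / ?m" for i
    have ab: "a i = ?m * b i" for i using m by (simp add: b_def)
    have b: "\<bar>b i\<bar> \<le> 1" if "i \<in> {1..n}" for i using le_m[OF that] m by (simp add: b_def)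
    have "L2_set a {1..n} = L2_set (\<lambda>i. ?m * b i) {1..n}" by (simp add: ab[symmetric])
    also have "\<dots> = ?m * L2_set b {1..n}" using m by (simp add: L2_set_right_distrib)
    finally have A: "L2_set a {1..n} = ?m * L2_set b {1..n}" .
    have A0: "0 < L2_set b {1..n}"
    proof (rule ccontr)
      assume "\<not> ?thesis"
      then have "L2_set b {1..n} = 0" using L2_set_nonneg[of b "{1..n}"] by linarith
      then have "b i = 0" if "i \<in> {1..n}" for i using that by (simp add: L2_set_eq_0_iff)
      then have "a i = 0" if "i \<in> {1..n}" for i using that ab by simp
      then have "(\<lambda>i. \<bar>a i\<bar>) ` {1..n} = (\<lambda>i. 0) ` {1..n}" by (intro image_cong) auto
      also have "\<dots> = {0}" using n by (intro image_constant[of 1]) auto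
      finally have "(\<lambda>i. \<bar>a i\<bar>) ` {1..n} = {0}" .
      then show False using m by (simp add: max_norm_def)
    qed
    let ?K = "?g * (L2_set b {1..n} + exp 9 * sqrt p * (4 * ln (real n)) + 24 * p) + khinchine_slack * (4 * ln (real n) + 24 * p)"
    have g: "0 \<le> ?g" "?g \<le> exp 2 * sqrt p" "(\<integral>\<^sup>+t. ennreal (\<bar>t\<bar> powr p) \<partial>\<gamma>) = ennreal (?g powr p)"
      using gaussian_norm_facts[of p] p by auto
    have K0: "0 \<le> ?K" using g(1) A0 p l khinchine_slack_ge_1 by (intro add_nonneg_nonneg mult_nonneg_nonneg) auto
    have bound: "(\<integral>\<^sup>+x. ennreal (\<bar>\<Sum>i\<in>{1..n}. b i * x i\<bar> powr p) \<partial>law) \<le> ennreal (?K powr p)"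
      using linear_form_moment[of b p "L2_set b {1..n}" ?g] n b p A0 g by simp
    have "(\<integral>\<^sup>+\<omega>. ennreal (\<bar>?S \<omega>\<bar> powr p) \<partial>M) = (\<integral>\<^sup>+x. ennreal (?m powr p) * ennreal (\<bar>\<Sum>i\<in>{1..n}. b i * x i\<bar> powr p) \<partial>law)"
      unfolding S_moment
    proof (intro nn_integral_cong)
      fix x :: "nat \<Rightarrow> real"
      have "(\<Sum>i\<in>{1..n}. a i * x i) = ?m * (\<Sum>i\<in>{1..n}. b i * x i)"
        by (simp add: ab sum_distrib_left mult.assoc)
      then show "ennreal (\<bar>\<Sum>i\<in>{1..n}. a i * x i\<bar> powr p) = ennreal (?m powr p) * ennreal (\<bar>\<Sum>i\<in>{1..n}. b i * x i\<bar> powr p)"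
        using m by (simp add: abs_mult powr_mult ennreal_mult)
    qed
    also have "\<dots> = ennreal (?m powr p) * (\<integral>\<^sup>+x. ennreal (\<bar>\<Sum>i\<in>{1..n}. b i * x i\<bar> powr p) \<partial>law)"
      by (rule nn_integral_cmult) measurable
    also have "\<dots> \<le> ennreal (?m powr p) * ennreal (?K powr p)" by (intro mult_left_mono bound) simp
    also have "\<dots> = ennreal ((?m * ?K) powr p)" using m K0 by (simp add: powr_mult ennreal_mult)
    also have "\<dots> \<le> ennreal ((?g * L2_set a {1..n} + ?E * ?m) powr p)"
    proof (intro ennreal_leI powr_mono2)
      have "?K = ?g * L2_set b {1..n} + (?g * (exp 9 * sqrt p * (4 * ln (real n)) + 24 * p) + khinchine_slack * (4 * ln (real n) + 24 * p))"
        by (simp add: distrib_left)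
      also have "\<dots> \<le> ?g * L2_set b {1..n} + ?E"
        unfolding moment_constant_def
        using khinchine_slack_ge_1 by (intro add_left_mono error_term_le p l g) simp
      finally have "?m * ?K \<le> ?m * (?g * L2_set b {1..n} + ?E)" using m by (intro mult_left_mono) auto
      also have "\<dots> = ?g * L2_set a {1..n} + ?E * ?m" unfolding A by (simp add: distrib_left)
      finally show "?m * ?K \<le> ?g * L2_set a {1..n} + ?E * ?m" .
      show "0 \<le> ?m * ?K" using m K0 by simp
    qed (use p in simp)
    finally show ?thesis .
  qed
  moreover have "0 \<le> ?g * L2_set a {1..n} + ?E * ?m"
    using gaussian_norm_facts(1)[of p] p l m0 khinchine_slack_ge_1
    by (intro add_nonneg_nonneg mult_nonneg_nonneg) (auto simp: moment_constant_def)
  ultimately show "has_moment M p ?S \<and> Lp_norm M p ?S \<le> ?g * L2_set a {1..n} + ?E * ?m"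
    using p by (intro Lp_norm_le S_meas) auto
qed

end
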